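(* $\mathbf{GA}$ implies that all hereditarily normal manifolds of dimension greater than one are metrizable.
   Context: A manifold is a locally Euclidean topological space; a manifold of dimension $n$ is one in which every point has a neighborhood homeomorphic to $\mathbb{R}^n$ (no connectedness or second countability is assumed). A space is hereditarily normal ($T_5$) if each of its subspaces is normal (in particular the spaces are Hausdorff). $\mathbf{GA}$ is the conjunction of the following four statements. (1) $\mathfrak b>\omega_1$, where $\mathfrak b$ is the bounding number. (2) $\mathbf{CW}$: every normal, first countable space is $\aleph_1$-collectionwise Hausdorff. A space is $\aleph_1$-collectionwise Hausdorff if the points of any closed discrete subset of cardinality at most $\aleph_1$ can be surrounded by pairwise disjoint open sets. (3) $\mathbf{PPI}^+$: every sequentially compact non-compact regular space contains an uncountable free sequence; additionally, if the space is first countable, then it contains a copy of the ordinal space $\omega_1$. (An uncountable free sequence is $\{x_\alpha:\alpha<\omega_1\}$ such that for every $\alpha<\omega_1$ the closures of $\{x_\beta:\beta<\alpha\}$ and $\{x_\beta:\beta\ge\alpha\}$ are disjoint.) (4) $\mathbf{P}_{22}$: if $\mathcal I$ is a $P$-ideal on a stationary subset $B$ of $\omega_1$, then either (i) there is a stationary $E\subseteq B$ such that every countable subset of $E$ is in $\mathcal I$, or (ii) there is a stationary $D\subseteq B$ such that $[D]^{\aleph_0}\cap\mathcal I$ is empty. Here a collection $\mathcal I$ of countable subsets of a set $A$ is a $P$-ideal on $A$ if each subset of a member of $\mathcal I$ is in $\mathcal I$, finite unions of members of $\mathcal I$ are in $\mathcal I$, and whenever $\{I_n:n\in\omega\}\subseteq\mathcal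 I$ there is a $J\in\mathcal I$ such that $I_n\setminus J$ is finite for all $n$. *)

theory Defs
  imports "HOL-Analysis.Analysis"
begin

unbundle cardinal_syntax

section \<open>The ordinal space \<open>\<omega>\<^sub>1\<close>\<close>

text \<open>
  \<open>cardSuc natLeq\<close> is the library's cardinal successor of \<open>\<aleph>\<^sub>0\<close>, a well-order of type \<open>\<omega>\<^sub>1\<close>.
  Its elements are made into a type, so that \<open>\<alpha> :: omega1\<close> ranges over the countable ordinals.
\<close>

typedef omega1 = "Field (cardSuc natLeq)"
proof -
  have "Field (cardSuc natLeq) \<noteq> {}"
    using Cinfinite_cardSuc[OF natLeq_Cinfinite] by (auto simp: cinfinite_def)
  then show ?thesis by blast
qed

lemma omega1_wo_rel: "wo_rel (cardSuc natLeq)"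
  unfolding wo_rel_def
  using cardSuc_Card_order[OF natLeq_Card_order] by (simp add: card_order_on_def)

instantiation omega1 :: wellorder
begin

definition less_eq_omega1 :: "omega1 \<Rightarrow> omega1 \<Rightarrow> bool"
  where "\<alpha> \<le> \<beta> \<longleftrightarrow> (Rep_omega1 \<alpha>, Rep_omega1 \<beta>) \<in> cardSuc natLeq"

definition less_omega1 :: "omega1 \<Rightarrow> omega1 \<Rightarrow> bool"
  where "\<alpha> < \<beta> \<longleftrightarrow> \<alpha> \<le> \<beta> \<and> \<alpha> \<noteq> (\<beta> :: omega1)"

instance
proof
  note wo = omega1_wo_rel
  fix \<alpha> \<beta> \<gamma> :: omega1
  show refl: "\<alpha> \<le> \<alpha>"
    using wo_rel.REFL[OF wo] Rep_omega1[of \<alpha>]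
    by (auto simp: less_eq_omega1_def refl_on_def)
  show "\<alpha> \<le> \<beta> \<Longrightarrow> \<beta> \<le> \<gamma> \<Longrightarrow> \<alpha> \<le> \<gamma>"
    using wo_rel.TRANS[OF wo] unfolding less_eq_omega1_def by (blast dest: transD)
  show antisym: "\<alpha> \<le> \<beta> \<Longrightarrow> \<beta> \<le> \<alpha> \<Longrightarrow> \<alpha> = \<beta>"
    using wo_rel.ANTISYM[OF wo] unfolding less_eq_omega1_def
    by (metis Rep_omega1_inject antisymD)
  show "\<alpha> < \<beta> \<longleftrightarrow> \<alpha> \<le> \<beta> \<and> \<not> \<beta> \<le> \<alpha>"
    using refl antisym by (auto simp: less_omega1_def)
  show "\<alpha> \<le> \<beta> \<or> \<beta> \<le> \<alpha>"
    using wo_rel.TOTALS[OF wo] Rep_omega1[of \<alpha>] Rep_omega1[of \<beta>]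
    unfolding less_eq_omega1_def by blast
next
  fix P :: "omega1 \<Rightarrow> bool" and \<alpha>
  assume step: "\<And>\<alpha>. (\<And>\<beta>. \<beta> < \<alpha> \<Longrightarrow> P \<beta>) \<Longrightarrow> P \<alpha>"
  have wf: "wf (inv_image (cardSuc natLeq - Id) Rep_omega1)"
    using wo_rel.WF[OF omega1_wo_rel] by (rule wf_inv_image)
  show "P \<alpha>"
  proof (induction \<alpha> rule: wf_induct_rule[OF wf])
    case (1 \<alpha>)
    show ?case
      by (rule step, rule 1)
        (auto simp: less_omega1_def less_eq_omega1_def Rep_omega1_inject)
  qed
qed

end

instantiation omega1 :: order_topology
begin

definition open_omega1 :: "omega1 set \<Rightarrow> bool"
  where "open_omega1 = generate_topology (range (\<lambda>\<alpha>. {..<\<alpha>}) \<union> range (\<lambda>\<alpha>. {\<alpha><..}))"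

instance by standard (rule open_omega1_def)

end

text \<open>Being an uncountable well-order all of whose proper initial segments are countable pins
  down the order type as \<open>\<omega>\<^sub>1\<close>.\<close>

lemma card_of_omega1: "|UNIV :: omega1 set| =o cardSuc natLeq"
proof -
  have "bij_betw Rep_omega1 UNIV (Field (cardSuc natLeq))"
    by (metis bij_betw_def inj_on_def Rep_omega1_inject type_definition.Rep_range
        type_definition_omega1)
  then have "|UNIV :: omega1 set| =o |Field (cardSuc natLeq)|"
    using card_of_ordIso by blast
  then show ?thesis
    using card_of_Field_ordIso[OF cardSuc_Card_order[OF natLeq_Card_order]] ordIso_transitive
    by blast
qed

lemma countable_iff_natLeq: "countable A \<longleftrightarrow> |A| \<le>o natLeq"
proof -
  have "countable A \<longleftrightarrow> |A| \<le>o |UNIV :: nat set|"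
    unfolding countable_def card_of_ordLeq[symmetric] by blast
  then show ?thesis
    using card_of_nat ordLeq_ordIso_trans ordIso_symmetric by blast
qed

lemma uncountable_omega1: "uncountable (UNIV :: omega1 set)"
  unfolding countable_iff_natLeq
  using card_of_omega1 cardSuc_greater[OF natLeq_Card_order]
  by (meson not_ordLess_ordLeq ordIso_symmetric ordLess_ordIso_trans)

lemma countable_lessThan_omega1: "countable {..<\<alpha> :: omega1}"
proof -
  have "|underS (cardSuc natLeq) (Rep_omega1 \<alpha>)| <o cardSuc natLeq"
    by (rule card_of_underS[OF cardSuc_Card_order[OF natLeq_Card_order] Rep_omega1])
  then have "countable (underS (cardSuc natLeq) (Rep_omega1 \<alpha>))"
    unfolding countable_iff_natLeq
    using cardSuc_ordLeq_ordLess[OF natLeq_Card_order card_of_Card_order] by blast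
  moreover have "Rep_omega1 ` {..<\<alpha>} \<subseteq> underS (cardSuc natLeq) (Rep_omega1 \<alpha>)"
    by (auto simp: underS_def less_omega1_def less_eq_omega1_def Rep_omega1_inject)
  ultimately have "countable (Rep_omega1 ` {..<\<alpha>})"
    by (rule countable_subset[rotated])
  then show ?thesis
    by (rule countable_image_inj_on) (simp add: inj_on_def Rep_omega1_inject)
qed

text \<open>Closed means closed in the order topology of \<open>\<omega>\<^sub>1\<close>.\<close>

definition club :: "omega1 set \<Rightarrow> bool"
  where "club C \<longleftrightarrow> closed C \<and> (\<forall>\<alpha>. \<exists>\<gamma>\<in>C. \<alpha> < \<gamma>)"

definition stationary :: "omega1 set \<Rightarrow> bool"
  where "stationary S \<longleftrightarrow> (\<forall>C. club C \<longrightarrow> S \<inter> C \<noteq> {})"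


section \<open>The bounding number\<close>

definition unbounded_family :: "(nat \<Rightarrow> nat) set \<Rightarrow> bool"
  where "unbounded_family F \<longleftrightarrow> \<not> (\<exists>g. \<forall>f\<in>F. \<forall>\<^sub>F n in sequentially. f n \<le> g n)"

text \<open>The least cardinality of an unbounded family; cardinals are represented, as in the
  library, by well-orders up to \<open>=o\<close>.\<close>

definition bounding_number :: "(nat \<Rightarrow> nat) rel"
  where "bounding_number =
    (SOME r. (\<exists>F. unbounded_family F \<and> r = |F| ) \<and> (\<forall>G. unbounded_family G \<longrightarrow> r \<le>o |G| ))"

lemma bounding_number:
  "\<exists>F. unbounded_family F \<and> bounding_number = |F|"
  "unbounded_family G \<Longrightarrow> bounding_number \<le>o |G|"
proof -
  let ?R = "card_of ` {F. unbounded_family F}"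
  have "\<not> (\<forall>\<^sub>F n in sequentially. Suc (g n) \<le> g n)" for g :: "nat \<Rightarrow> nat"
    by simp
  then have "unbounded_family UNIV"
    unfolding unbounded_family_def by (metis UNIV_I)
  then have "?R \<noteq> {}" by blast
  moreover have "\<forall>r\<in>?R. Well_order r" by (auto simp: card_of_Well_order)
  ultimately have "\<exists>r\<in>?R. \<forall>r'\<in>?R. r \<le>o r'" by (rule exists_minim_Well_order)
  then have "\<exists>r. (\<exists>F. unbounded_family F \<and> r = |F| ) \<and> (\<forall>G. unbounded_family G \<longrightarrow> r \<le>o |G| )"
    by auto
  from someI_ex[OF this]
  have "(\<exists>F. unbounded_family F \<and> bounding_number = |F| ) \<and>
      (\<forall>G. unbounded_family G \<longrightarrow> bounding_number \<le>o |G| )"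
    unfolding bounding_number_def .
  then show "\<exists>F. unbounded_family F \<and> bounding_number = |F|"
    and "unbounded_family G \<Longrightarrow> bounding_number \<le>o |G|"
    by blast+
qed


section \<open>Topological notions\<close>

text \<open>The library's \<^const>\<open>normal_space\<close> and \<^const>\<open>regular_space\<close> do not include any
  separation of points. All spaces are meant to be Hausdorff, so \<^const>\<open>Hausdorff_space\<close> is
  added explicitly wherever one of them is used.\<close>

definition aleph1_collectionwise_Hausdorff :: "'a topology \<Rightarrow> bool"
  where "aleph1_collectionwise_Hausdorff X \<longleftrightarrow>
    (\<forall>D. closedin X D \<and> subtopology X D = discrete_topology D \<and>
         |D| \<le>o |UNIV :: omega1 set| \<longrightarrow>
      (\<exists>U. (\<forall>d\<in>D. openin X (U d) \<and> d \<in> U d) \<and> disjoint_family_on U D))"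

definition sequentially_compact_space :: "'a topology \<Rightarrow> bool"
  where "sequentially_compact_space X \<longleftrightarrow>
    (\<forall>\<sigma> :: nat \<Rightarrow> 'a. range \<sigma> \<subseteq> topspace X \<longrightarrow>
      (\<exists>l r. strict_mono r \<and> limitin X (\<sigma> \<circ> r) l sequentially))"

definition has_uncountable_free_sequence :: "'a topology \<Rightarrow> bool"
  where "has_uncountable_free_sequence X \<longleftrightarrow>
    (\<exists>x :: omega1 \<Rightarrow> 'a. range x \<subseteq> topspace X \<and>
      (\<forall>\<alpha>. disjnt (X closure_of (x ` {..<\<alpha>})) (X closure_of (x ` {\<alpha>..}))))"

definition contains_copy_of_omega1 :: "'a topology \<Rightarrow> bool"
  where "contains_copy_of_omega1 X \<longleftrightarrow>
    (\<exists>S \<subseteq> topspace X. subtopology X S homeomorphic_space (euclidean :: omega1 topology))"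

definition T5_space :: "'a topology \<Rightarrow> bool"
  where "T5_space X \<longleftrightarrow> Hausdorff_space X \<and> hereditarily normal_space X"

text \<open>Every point has a (not necessarily open) neighbourhood \<open>N\<close> homeomorphic to \<open>\<real>\<^sup>n\<close>.\<close>

definition manifold_of_dim :: "nat \<Rightarrow> 'a topology \<Rightarrow> bool"
  where "manifold_of_dim n X \<longleftrightarrow>
    (\<forall>x\<in>topspace X. \<exists>U N. openin X U \<and> x \<in> U \<and> U \<subseteq> N \<and> N \<subseteq> topspace X \<and>
      subtopology X N homeomorphic_space Euclidean_space n)"


section \<open>The axiom \<open>GA\<close>\<close>

text \<open>
  HOL cannot quantify over types inside a formula. The two statements about all topological
  spaces are therefore parametrised by a type and speak about all spaces whose points are
  elements of that type. Each instance follows from the unrestricted statement. For spaces with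
  points in \<open>'a\<close> the instance to use is the one at \<open>'a set set\<close>, which also covers spaces built
  from sets of subsets of the original space (families of closed sets, filters, compactifications).
\<close>

definition CW :: "'u itself \<Rightarrow> bool"
  where "CW _ \<longleftrightarrow>
    (\<forall>X :: 'u topology. Hausdorff_space X \<and> normal_space X \<and> first_countable X \<longrightarrow>
      aleph1_collectionwise_Hausdorff X)"

definition PPI_plus :: "'u itself \<Rightarrow> bool"
  where "PPI_plus _ \<longleftrightarrow>
    (\<forall>X :: 'u topology. Hausdorff_space X \<and> regular_space X \<and>
        sequentially_compact_space X \<and> \<not> compact_space X \<longrightarrow>
      has_uncountable_free_sequence X \<and>
      (first_countable X \<longrightarrow> contains_copy_of_omega1 X))"

text \<open>Taking \<open>\<F> = {}\<close> in the clause on finite unions gives \<open>{} \<in> \<I>\<close>.\<close>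

definition P_ideal_on :: "'a set \<Rightarrow> 'a set set \<Rightarrow> bool"
  where "P_ideal_on A \<I> \<longleftrightarrow>
    (\<forall>I\<in>\<I>. I \<subseteq> A \<and> countable I) \<and>
    (\<forall>I\<in>\<I>. \<forall>J\<subseteq>I. J \<in> \<I>) \<and>
    (\<forall>\<F>. finite \<F> \<and> \<F> \<subseteq> \<I> \<longrightarrow> \<Union>\<F> \<in> \<I>) \<and>
    (\<forall>I :: nat \<Rightarrow> 'a set. range I \<subseteq> \<I> \<longrightarrow> (\<exists>J\<in>\<I>. \<forall>n. finite (I n - J)))"

definition P22 :: bool
  where "P22 \<longleftrightarrow>
    (\<forall>B \<I>. stationary B \<and> P_ideal_on B \<I> \<longrightarrow>
      (\<exists>E\<subseteq>B. stationary E \<and> (\<forall>Y\<subseteq>E. countable Y \<longrightarrow> Y \<in> \<I>)) \<or>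
      (\<exists>D\<subseteq>B. stationary D \<and> {Y. Y \<subseteq> D \<and> countable Y \<and> infinite Y} \<inter> \<I> = {}))"

definition GA :: "'u itself \<Rightarrow> bool"
  where "GA T \<longleftrightarrow> |UNIV :: omega1 set| <o bounding_number \<and> CW T \<and> PPI_plus T \<and> P22"

end

theory Submission
  imports Defs
begin

text \<open>
  The components of a manifold are open, so metrics on them can be glued, and a second countable
  manifold is metrizable by Urysohn's theorem. The task is to show that a connected hereditarily
  normal manifold \<open>X\<close> of dimension \<open>n > 1\<close> is second countable. Three arguments are combined.

  \<^bold>\<open>A dichotomy.\<close> Let \<open>x\<close> be an \<open>\<omega>\<^sub>1\<close>-sequence in a locally compact space that is covered by
  \<open>\<omega>\<^sub>1\<close> many open Lindelof sets, each containing only countably many of its terms. The countable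
  sets of indices along which \<open>x\<close> is locally finite form a \<open>P\<close>-ideal because the bounding number
  exceeds \<open>\<omega>\<^sub>1\<close>. By
  \<open>P\<^sub>2\<^sub>2\<close> there is a stationary set of indices on which \<open>x\<close> is relatively discrete, or one on which
  the values of \<open>x\<close> have a sequentially compact, non-compact closure; in the latter case
  \<open>PPI\<^sup>+\<close> yields an uncountable free sequence and a copy of \<open>\<omega>\<^sub>1\<close> in that closure
  (\<open>relatively_discrete_or_sequentially_compact\<close>).

  \<^bold>\<open>Exhaustions.\<close> A relatively discrete set is closed in an open subspace, which is again normal;
  hence \<open>CW\<close> separates every relatively discrete set of size at most \<open>\<aleph>\<^sub>1\<close> by disjoint open sets. In
  particular the closure of a second countable open set has no uncountable relatively discrete
  subset, and free sequences are relatively discrete. So both alternatives of the dichotomy fail in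
  such a closure, and it has to be contained in a second countable open set. Therefore \<open>X\<close> is the
  union of a continuous increasing chain of connected, second countable open sets \<open>P \<alpha>\<close> for
  \<open>\<alpha> < \<omega>\<^sub>1\<close>, the closure of each contained in the next. Points \<open>y \<alpha>\<close> chosen on the boundary of
  \<open>P \<alpha>\<close> for stationarily many \<open>\<alpha>\<close> are never relatively discrete: disjoint neighbourhoods of
  them reach below \<open>\<alpha>\<close>, and by pressing down uncountably many would meet a single \<open>P \<beta>\<close>. Only the
  second alternative is left for such choices, and it gives a copy of \<open>\<omega>\<^sub>1\<close>. Hence, if \<open>X\<close>
  contains no copy of \<open>\<omega>\<^sub>1\<close>, the boundaries are empty for a closed unbounded set of \<open>\<alpha>\<close>, some
  \<open>P \<alpha>\<close> is clopen, and \<open>X = P \<alpha>\<close>.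

  \<^bold>\<open>There is no copy of \<open>\<omega>\<^sub>1\<close>.\<close> Let \<open>w\<close> embed \<open>\<omega>\<^sub>1\<close> into \<open>X\<close>; then \<open>w \<alpha>\<close> lies on the
  boundary of \<open>P \<alpha>\<close> for a closed unbounded set of \<open>\<alpha>\<close>. Suppose the component of \<open>w \<alpha>\<close> in that
  boundary is trivial. Since \<open>n > 1\<close>, a unicoherence argument in a chart gives a small neighbourhood of
  \<open>w \<alpha>\<close> whose frontier is inside \<open>P \<alpha>\<close> or outside its closure
  (\<open>neighbourhood_with_one_sided_frontier\<close>). The latter contradicts the connectedness of \<open>P \<alpha>\<close>, and
  the former can hold only for a nonstationary set of \<open>\<alpha>\<close>, by pressing down twice. So for
  stationarily many \<open>\<alpha>\<close> there is a point \<open>y \<alpha>\<close> off the copy in the component of \<open>w \<alpha>\<close>. Applied in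
  the complement of the copy, the dichotomy gives a closed set \<open>K\<close> that is disjoint from the
  copy and contains \<open>y \<alpha>\<close> for stationarily many \<open>\<alpha>\<close>. Take a continuous \<open>f\<close> that is \<open>0\<close> on the
  copy and \<open>1\<close> on \<open>K\<close>. A connected part of the boundary of \<open>P \<alpha>\<close> joins \<open>w \<alpha>\<close> to \<open>y \<alpha>\<close>, so it
  meets the boundary of \<open>{f \<noteq> 0}\<close>. By the dichotomy once more, this boundary contains another copy of
  \<open>\<omega>\<^sub>1\<close>. But hereditary normality excludes that, by an argument in the spirit of Katetov's
  theorem on products (\<open>no_omega1_in_zero_set_boundary\<close>).
\<close>

section \<open>Closed unbounded and stationary sets of countable ordinals\<close>

instance omega1 :: linorder_topology ..

definition limit_ord :: "omega1 \<Rightarrow> bool"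
  where "limit_ord \<alpha> \<longleftrightarrow> (\<exists>\<beta>. \<beta> < \<alpha>) \<and> (\<forall>\<beta><\<alpha>. \<exists>\<gamma>. \<beta> < \<gamma> \<and> \<gamma> < \<alpha>)"

lemma countable_atMost_omega1: "countable {..\<alpha> :: omega1}"
  using countable_lessThan_omega1[of \<alpha>] by (simp flip: ivl_disj_un_singleton(2))

lemma countable_imp_bounded_omega1:
  fixes A :: "omega1 set"
  assumes "countable A"
  shows "\<exists>\<gamma>. \<forall>\<alpha>\<in>A. \<alpha> < \<gamma>"
proof (rule ccontr)
  assume "\<not> ?thesis"
  then have "UNIV = (\<Union>\<alpha>\<in>A. {..\<alpha>})" by (auto simp: not_less)
  moreover have "countable (\<Union>\<alpha>\<in>A. {..\<alpha>})"
    using assms countable_atMost_omega1 by blast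
  ultimately show False using uncountable_omega1 by simp
qed

lemma omega1_no_greatest: "\<exists>\<gamma> :: omega1. \<alpha> < \<gamma>"
  using countable_imp_bounded_omega1[of "{\<alpha>}"] by auto

definition next_ord :: "omega1 \<Rightarrow> omega1"
  where "next_ord \<alpha> = (LEAST \<gamma>. \<alpha> < \<gamma>)"

lemma less_next_ord: "\<alpha> < next_ord \<alpha>"
  unfolding next_ord_def using omega1_no_greatest by (metis LeastI)

lemma next_ord_le: "\<alpha> < \<beta> \<Longrightarrow> next_ord \<alpha> \<le> \<beta>"
  unfolding next_ord_def by (rule Least_le)

lemma open_atMost_omega1: "open {..\<alpha> :: omega1}"
proof -
  have "\<beta> \<le> \<alpha> \<longleftrightarrow> \<beta> < next_ord \<alpha>" for \<beta>
    using less_next_ord[of \<alpha>] next_ord_le[of \<alpha> \<beta>] by (meson le_less_trans not_le)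
  then have "{..\<alpha>} = {..<next_ord \<alpha>}" by auto
  then show ?thesis by simp
qed

lemma closed_greaterThan_omega1: "closed {\<alpha> :: omega1 <..}"
  using open_atMost_omega1[of \<alpha>] by (simp add: closed_def)

text \<open>
  Closedness in \<open>\<omega>\<^sub>1\<close> only concerns limit ordinals, because all other points are isolated.
\<close>

lemma closed_omega1I:
  fixes C :: "omega1 set"
  assumes "\<And>\<alpha>. limit_ord \<alpha> \<Longrightarrow> (\<And>\<beta>. \<beta> < \<alpha> \<Longrightarrow> \<exists>c\<in>C. \<beta> < c \<and> c < \<alpha>) \<Longrightarrow> \<alpha> \<in> C"
  shows "closed C"
  unfolding closed_def
proof (subst open_subopen, intro ballI)
  fix \<alpha> assume \<alpha>: "\<alpha> \<in> - C"
  show "\<exists>T. open T \<and> \<alpha> \<in> T \<and> T \<subseteq> - C"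
  proof (cases "\<exists>\<beta><\<alpha>. \<forall>c\<in>C. \<not> (\<beta> < c \<and> c < \<alpha>)")
    case True
    then obtain \<beta> where \<beta>: "\<beta> < \<alpha>" "\<forall>c\<in>C. \<not> (\<beta> < c \<and> c < \<alpha>)" by blast
    have "{\<beta><..} \<inter> {..\<alpha>} \<subseteq> - C" using \<alpha> \<beta> by fastforce
    moreover have "open ({\<beta><..} \<inter> {..\<alpha>})" by (intro open_Int open_atMost_omega1) auto
    ultimately show ?thesis using \<beta>(1) by fastforce
  next
    case False
    then have ex: "\<And>\<beta>. \<beta> < \<alpha> \<Longrightarrow> \<exists>c\<in>C. \<beta> < c \<and> c < \<alpha>" by blast
    have "\<not> \<beta> < \<alpha>" for \<beta>
      using assms[of \<alpha>] ex \<alpha> unfolding limit_ord_def by blast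
    then have "{..\<alpha>} \<subseteq> - C" using \<alpha> by (metis Compl_iff atMost_iff order_le_less subsetI)
    then show ?thesis using open_atMost_omega1 by blast
  qed
qed

lemma closed_omega1D:
  fixes C :: "omega1 set"
  assumes "closed C" "limit_ord \<alpha>" "\<And>\<beta>. \<beta> < \<alpha> \<Longrightarrow> \<exists>c\<in>C. \<beta> < c \<and> c < \<alpha>"
  shows "\<alpha> \<in> C"
proof (rule ccontr)
  assume "\<alpha> \<notin> C"
  obtain \<beta> where "\<beta> < \<alpha>" using assms(2) by (auto simp: limit_ord_def)
  with \<open>\<alpha> \<notin> C\<close> obtain b where "b < \<alpha>" "{b<..\<alpha>} \<subseteq> - C"
    using open_left[of "- C" \<alpha> \<beta>] assms(1) by auto
  with assms(3)[of b] show False by force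
qed

text \<open>A strictly increasing \<open>\<omega>\<close>-sequence has a supremum, and the supremum is a limit ordinal.\<close>

lemma omega1_strict_mono_sup:
  fixes s :: "nat \<Rightarrow> omega1"
  assumes "\<And>k. s k < s (Suc k)"
  obtains \<alpha> where "limit_ord \<alpha>" "\<And>k. s k < \<alpha>" "\<And>\<beta>. \<beta> < \<alpha> \<Longrightarrow> \<exists>k. \<beta> < s k"
proof -
  define \<alpha> where "\<alpha> = (LEAST \<alpha>. \<forall>k. s k < \<alpha>)"
  have "\<exists>\<alpha>. \<forall>k. s k < \<alpha>" using countable_imp_bounded_omega1[of "range s"] by auto
  then have 1: "\<forall>k. s k < \<alpha>" unfolding \<alpha>_def by (rule LeastI_ex)
  have 2: "\<exists>k. \<beta> < s k" if "\<beta> < \<alpha>" for \<beta>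
  proof -
    have "\<not> (\<forall>k. s k < \<beta>)"
      using not_less_Least[of \<beta> "\<lambda>\<alpha>. \<forall>k. s k < \<alpha>"] that unfolding \<alpha>_def by blast
    then obtain k where "\<not> s k < \<beta>" by blast
    then have "\<beta> < s (Suc k)" using assms[of k] by (meson leI le_less_trans)
    then show ?thesis by blast
  qed
  have "limit_ord \<alpha>" unfolding limit_ord_def using 1 2 by blast
  with 1 2 show thesis using that by blast
qed

lemma club_greaterThan: "club {\<gamma><..}"
  unfolding club_def
proof (intro conjI allI closed_greaterThan_omega1)
  fix \<alpha> :: omega1
  obtain \<delta> where "max \<alpha> \<gamma> < \<delta>" using omega1_no_greatest by blast
  then show "\<exists>\<delta>\<in>{\<gamma><..}. \<alpha> < \<delta>" by auto
qed

text \<open>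
  Diagonal intersections: a point of the intersection above a given one is the supremum of a
  sequence in which, between the \<open>k\<close>-th and the next term, every \<open>C \<beta>\<close> with \<open>\<beta>\<close> below the \<open>k\<close>-th
  term has an element. The limit condition is built in, as it is needed in most applications.
\<close>

lemma club_diagonal:
  assumes "\<And>\<beta>. club (C \<beta>)"
  shows "club {\<alpha>. limit_ord \<alpha> \<and> (\<forall>\<beta><\<alpha>. \<alpha> \<in> C \<beta>)}" (is "club ?D")
  unfolding club_def
proof (intro conjI allI)
  show "closed ?D"
  proof (rule closed_omega1I)
    fix \<alpha> assume \<alpha>: "limit_ord \<alpha>" "\<And>\<beta>. \<beta> < \<alpha> \<Longrightarrow> \<exists>d\<in>?D. \<beta> < d \<and> d < \<alpha>"
    have "\<alpha> \<in> C \<beta>" if "\<beta> < \<alpha>" for \<beta>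
    proof (rule closed_omega1D[OF _ \<alpha>(1)])
      show "closed (C \<beta>)" using assms by (simp add: club_def)
      fix \<beta>' assume "\<beta>' < \<alpha>"
      then have "max \<beta> \<beta>' < \<alpha>" using that by simp
      then obtain d where "d \<in> ?D" "max \<beta> \<beta>' < d" "d < \<alpha>" using \<alpha>(2) by blast
      then show "\<exists>c\<in>C \<beta>. \<beta>' < c \<and> c < \<alpha>" by auto
    qed
    with \<alpha>(1) show "\<alpha> \<in> ?D" by blast
  qed
next
  fix \<gamma>0 :: omega1
  have "\<exists>\<delta>>\<gamma>. \<forall>\<beta>\<le>\<gamma>. \<exists>c\<in>C \<beta>. \<gamma> < c \<and> c < \<delta>" for \<gamma>
  proof -
    have "\<forall>\<beta>. \<exists>c. c \<in> C \<beta> \<and> \<gamma> < c" using assms unfolding club_def by blast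
    then obtain c where c: "\<And>\<beta>. c \<beta> \<in> C \<beta>" "\<And>\<beta>. \<gamma> < c \<beta>" by metis
    obtain \<delta> where "\<forall>\<beta>\<in>c ` {..\<gamma>}. \<beta> < \<delta>"
      using countable_imp_bounded_omega1[of "c ` {..\<gamma>}"] countable_atMost_omega1 by blast
    then have "\<gamma> < \<delta> \<and> (\<forall>\<beta>\<le>\<gamma>. \<exists>c\<in>C \<beta>. \<gamma> < c \<and> c < \<delta>)"
      using c by (meson atMost_iff imageI order_refl order_less_trans)
    then show ?thesis by blast
  qed
  then obtain g where g: "\<And>\<gamma>. \<gamma> < g \<gamma>" "\<And>\<gamma> \<beta>. \<beta> \<le> \<gamma> \<Longrightarrow> \<exists>c\<in>C \<beta>. \<gamma> < c \<and> c < g \<gamma>"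
    by metis
  define s where "s = rec_nat \<gamma>0 (\<lambda>_. g)"
  have s: "s 0 = \<gamma>0" "s (Suc k) = g (s k)" for k by (simp_all add: s_def)
  have inc: "s k < s (Suc k)" for k using g(1) s by simp
  then obtain \<alpha> where \<alpha>: "limit_ord \<alpha>" "\<And>k. s k < \<alpha>" "\<And>\<beta>. \<beta> < \<alpha> \<Longrightarrow> \<exists>k. \<beta> < s k"
    using omega1_strict_mono_sup[of s] by blast
  have "\<alpha> \<in> C \<beta>" if "\<beta> < \<alpha>" for \<beta>
  proof (rule closed_omega1D[OF _ \<alpha>(1)])
    show "closed (C \<beta>)" using assms by (simp add: club_def)
    fix \<beta>' assume "\<beta>' < \<alpha>"
    then have "max \<beta> \<beta>' < \<alpha>" using that by simp
    then obtain k where k: "max \<beta> \<beta>' < s k" using \<alpha>(3) by blast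
    then have "\<beta> \<le> s k" by auto
    then obtain c where "c \<in> C \<beta>" "s k < c" "c < s (Suc k)" using g(2)[of \<beta> "s k"] s(2) by metis
    then show "\<exists>c\<in>C \<beta>. \<beta>' < c \<and> c < \<alpha>" using k \<alpha>(2)[of "Suc k"] by (meson less_trans max_less_iff_conj)
  qed
  then show "\<exists>\<gamma>\<in>?D. \<gamma>0 < \<gamma>" using \<alpha>(1) \<alpha>(2)[of 0] s(1) by auto
qed

lemma club_Int:
  assumes "club C" "club D"
  shows "club (C \<inter> D)"
  unfolding club_def
proof (intro conjI allI)
  show "closed (C \<inter> D)" using assms by (auto simp: club_def)
  fix \<gamma> :: omega1
  obtain \<delta> where \<delta>: "\<gamma> < \<delta>" using omega1_no_greatest by blast
  have "club (if \<beta> = \<gamma> then C else D)" for \<beta> using assms by simp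
  from club_diagonal[of "\<lambda>\<beta>. if \<beta> = \<gamma> then C else D", OF this]
  obtain \<alpha> where \<alpha>: "\<delta> < \<alpha>" "\<forall>\<beta><\<alpha>. \<alpha> \<in> (if \<beta> = \<gamma> then C else D)"
    unfolding club_def by blast
  have "\<alpha> \<in> C" "\<alpha> \<in> D" using \<alpha> \<delta> by (metis less_trans, metis less_trans order_less_irrefl)
  then show "\<exists>\<alpha>\<in>C \<inter> D. \<gamma> < \<alpha>" using \<alpha>(1) \<delta> by (meson IntI less_trans)
qed

lemma club_limit_closed_under: "club {\<alpha>. limit_ord \<alpha> \<and> (\<forall>\<beta><\<alpha>. f \<beta> < \<alpha>)}"
  using club_diagonal[of "\<lambda>\<beta>. {f \<beta><..}"] club_greaterThan by simp

lemma club_limit_ord: "club {\<alpha>. limit_ord \<alpha>}"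
  using club_limit_closed_under[of "\<lambda>\<beta>. \<beta>"] by (simp cong: conj_cong)

lemma stationary_Int_club: "stationary S \<Longrightarrow> club C \<Longrightarrow> stationary (S \<inter> C)"
  unfolding stationary_def by (metis club_Int inf_assoc)

lemma club_imp_stationary: "club C \<Longrightarrow> stationary C"
  unfolding stationary_def using club_Int by (fastforce simp: club_def)

lemma stationary_unbounded: "stationary S \<Longrightarrow> \<exists>\<alpha>\<in>S. \<gamma> < \<alpha>"
  unfolding stationary_def using club_greaterThan[of \<gamma>] by blast

lemma stationary_imp_uncountable: "stationary S \<Longrightarrow> uncountable S"
  using countable_imp_bounded_omega1 stationary_unbounded by (meson less_asym)

text \<open>
  Fodor's lemma: if no fibre were stationary, each would miss some closed unbounded set, and \<open>f\<close>
  could not take any value at a point of \<open>S\<close> in their diagonal intersection.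
\<close>

theorem pressing_down:
  assumes "stationary S" "\<And>\<alpha>. \<alpha> \<in> S \<Longrightarrow> f \<alpha> < \<alpha>"
  obtains \<beta> where "stationary {\<alpha>\<in>S. f \<alpha> = \<beta>}"
proof (rule ccontr)
  assume "\<not> thesis"
  with that have "\<forall>\<beta>. \<exists>C. club C \<and> {\<alpha>\<in>S. f \<alpha> = \<beta>} \<inter> C = {}"
    unfolding stationary_def by blast
  then obtain C where C: "\<And>\<beta>. club (C \<beta>)" "\<And>\<beta>. {\<alpha>\<in>S. f \<alpha> = \<beta>} \<inter> C \<beta> = {}" by metis
  obtain \<alpha> where "\<alpha> \<in> S" "\<forall>\<beta><\<alpha>. \<alpha> \<in> C \<beta>"
    using assms(1) club_diagonal[of C] C(1) unfolding stationary_def by blast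
  then show False using C(2)[of "f \<alpha>"] assms(2) by blast
qed

lemma compact_atMost_omega1: "compact {..\<delta> :: omega1}"
proof (induction \<delta> rule: less_induct)
  case (less \<delta>)
  show ?case
  proof (rule compactI)
    fix \<C> assume \<C>: "\<forall>t\<in>\<C>. open t" "{..\<delta>} \<subseteq> \<Union>\<C>"
    then obtain U where U: "U \<in> \<C>" "\<delta> \<in> U" "open U" by auto
    show "\<exists>\<C>'\<subseteq>\<C>. finite \<C>' \<and> {..\<delta>} \<subseteq> \<Union>\<C>'"
    proof (cases "\<exists>\<beta>. \<beta> < \<delta>")
      case True
      then obtain b where b: "b < \<delta>" "{b<..\<delta>} \<subseteq> U" using open_left U by blast
      have "{..b} \<subseteq> \<Union>\<C>" using \<C>(2) b(1) by auto
      then obtain \<D> where "\<D> \<subseteq> \<C>" "finite \<D>" "{..b} \<subseteq> \<Union>\<D>"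
        using less.IH[OF b(1)] \<C>(1) by (meson compactE)
      moreover have "{..\<delta>} \<subseteq> {..b} \<union> {b<..\<delta>}" by auto
      ultimately show ?thesis using b(2) U(1) by (intro exI[of _ "insert U \<D>"]) auto
    next
      case False
      then have "{..\<delta>} = {\<delta>}" by (auto simp: order_le_less)
      then show ?thesis using U by (intro exI[of _ "{U}"]) auto
    qed
  qed
qed

lemma uncountable_isolated_omega1: "uncountable {\<alpha> :: omega1. open {\<alpha>}}"
proof -
  have "{next_ord \<alpha>} = {\<alpha><..} \<inter> {..next_ord \<alpha>}" for \<alpha>
    using less_next_ord next_ord_le by (force simp: order_antisym)
  then have "open {next_ord \<alpha>}" for \<alpha>
    using open_atMost_omega1 by (metis open_Int open_greaterThan)
  moreover have "inj next_ord"
    using less_next_ord next_ord_le by (metis injI leD linorder_neqE)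
  ultimately show ?thesis
    using uncountable_omega1 by (metis (mono_tags, lifting) countable_image_inj_on countable_subset image_subset_iff mem_Collect_eq)
qed

lemma connected_omega1_imp_eq:
  fixes S :: "omega1 set"
  assumes "connected S" "\<alpha> \<in> S" "\<beta> \<in> S"
  shows "\<alpha> = \<beta>"
proof -
  have *: False if "\<gamma> < \<delta>" "\<gamma> \<in> S" "\<delta> \<in> S" for \<gamma> \<delta>
    using connectedD[OF assms(1) open_atMost_omega1[of \<gamma>] open_greaterThan[of \<gamma>]] that by fastforce
  show ?thesis using * assms(2,3) by (metis linorder_neqE)
qed

section \<open>From sets of subsets to points\<close>

text \<open>
  \<open>CW\<close> and \<open>PPI\<^sup>+\<close> are given for spaces whose points are sets of subsets of the manifold. They
  descend to spaces whose points are points of the manifold along this homeomorphic copy.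
\<close>

definition singleton_copy :: "'a topology \<Rightarrow> 'a set set topology"
  where "singleton_copy X =
    pullback_topology ((\<lambda>x. {{x}}) ` topspace X) (\<lambda>s. the_elem (the_elem s)) X"

lemma homeomorphic_maps_singleton_copy:
  "homeomorphic_maps X (singleton_copy X) (\<lambda>x. {{x}}) (\<lambda>s. the_elem (the_elem s))"
  unfolding homeomorphic_maps_def
proof (intro conjI ballI)
  show "continuous_map X (singleton_copy X) (\<lambda>x. {{x}})"
    unfolding singleton_copy_def by (rule continuous_map_pullback') (auto simp: o_def)
  have "continuous_map X X id" by simp
  from continuous_map_pullback[OF this]
  show "continuous_map (singleton_copy X) X (\<lambda>s. the_elem (the_elem s))"
    unfolding singleton_copy_def by (simp add: o_def id_def)
qed (auto simp: singleton_copy_def topspace_pullback_topology)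

lemma CW_lower:
  assumes "CW TYPE('a set set)"
  shows "CW TYPE('a)"
  unfolding CW_def
proof (intro allI impI)
  fix X :: "'a topology"
  assume X: "Hausdorff_space X \<and> normal_space X \<and> first_countable X"
  define Y where "Y = singleton_copy X"
  define e where "e = (\<lambda>x :: 'a. {{x}})"
  have hm: "homeomorphic_map X Y e" "X homeomorphic_space Y"
    using homeomorphic_maps_singleton_copy[of X]
    unfolding Y_def e_def homeomorphic_map_maps homeomorphic_space_def by blast+
  have "Hausdorff_space Y" "normal_space Y" "first_countable Y"
    using X hm(2) homeomorphic_Hausdorff_space homeomorphic_normal_space
      homeomorphic_space_first_countability by blast+
  then have Y: "aleph1_collectionwise_Hausdorff Y" using assms unfolding CW_def by blast
  show "aleph1_collectionwise_Hausdorff X"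
    unfolding aleph1_collectionwise_Hausdorff_def
  proof (intro allI impI)
    fix D
    assume D: "closedin X D \<and> subtopology X D = discrete_topology D \<and> |D| \<le>o |UNIV :: omega1 set|"
    then have DX: "D \<subseteq> topspace X" and iso: "D \<inter> X derived_set_of D = {}"
      using closedin_subset by (auto simp: subtopology_eq_discrete_topology_eq)
    have cl: "closedin Y (e ` D)"
      using D hm(1) DX homeomorphic_map_closedness by blast
    have der: "Y derived_set_of (e ` D) = e ` (X derived_set_of D)"
      using homeomorphic_map_derived_set_of[OF hm(1) DX] .
    have inj: "inj e" by (auto simp: e_def inj_def)
    have "e ` D \<inter> e ` (X derived_set_of D) = {}"
      using iso inj by (metis image_Int image_empty)
    then have disc: "subtopology Y (e ` D) = discrete_topology (e ` D)"
      using closedin_subset[OF cl] der by (simp add: subtopology_eq_discrete_topology_eq)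
    have card: "|e ` D| \<le>o |UNIV :: omega1 set|"
      using D card_of_image ordLeq_transitive by blast
    have "\<exists>U. (\<forall>d\<in>e ` D. openin Y (U d) \<and> d \<in> U d) \<and> disjoint_family_on U (e ` D)"
      using Y[unfolded aleph1_collectionwise_Hausdorff_def, rule_format, of "e ` D"] cl disc card by simp
    then obtain U where U: "\<And>d. d \<in> e ` D \<Longrightarrow> openin Y (U d) \<and> d \<in> U d" "disjoint_family_on U (e ` D)"
      by auto
    define V where "V d = {x \<in> topspace X. e x \<in> U (e d)}" for d
    have "openin X (V d) \<and> d \<in> V d" if "d \<in> D" for d
      using openin_continuous_map_preimage[OF homeomorphic_imp_continuous_map[OF hm(1)], of "U (e d)"]
        U(1)[of "e d"] that DX by (auto simp: V_def)
    moreover have "disjoint_family_on V D"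
    proof (unfold disjoint_family_on_def, intro ballI impI)
      fix c d assume "c \<in> D" "d \<in> D" "c \<noteq> d"
      then have "e c \<noteq> e d" using inj by (auto dest: injD)
      then have "U (e c) \<inter> U (e d) = {}"
        using disjoint_family_onD[OF U(2)] \<open>c \<in> D\<close> \<open>d \<in> D\<close> by simp
      then show "V c \<inter> V d = {}" by (auto simp: V_def)
    qed
    ultimately show "\<exists>U. (\<forall>d\<in>D. openin X (U d) \<and> d \<in> U d) \<and> disjoint_family_on U D" by blast
  qed
qed

lemma sequentially_compact_homeomorphic_image:
  assumes "homeomorphic_maps X Y f g" "sequentially_compact_space X"
  shows "sequentially_compact_space Y"
  unfolding sequentially_compact_space_def
proof (intro allI impI)
  fix \<sigma> :: "nat \<Rightarrow> 'b" assume \<sigma>: "range \<sigma> \<subseteq> topspace Y"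
  have f: "continuous_map X Y f" and g: "continuous_map Y X g" and fg: "\<And>y. y \<in> topspace Y \<Longrightarrow> f (g y) = y"
    using assms(1) by (auto simp: homeomorphic_maps_def)
  have "range (g \<circ> \<sigma>) \<subseteq> topspace X"
    using g \<sigma> by (auto simp: continuous_map_def Pi_iff)
  then obtain l r where r: "strict_mono r" "limitin X ((g \<circ> \<sigma>) \<circ> r) l sequentially"
    using assms(2) unfolding sequentially_compact_space_def by blast
  have "limitin Y (f \<circ> ((g \<circ> \<sigma>) \<circ> r)) (f l) sequentially"
    using continuous_map_limit[OF f r(2)] .
  moreover have "f \<circ> ((g \<circ> \<sigma>) \<circ> r) = \<sigma> \<circ> r" using fg \<sigma> by (auto simp: fun_eq_iff)
  ultimately show "\<exists>l r. strict_mono r \<and> limitin Y (\<sigma> \<circ> r) l sequentially" using r(1) by auto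
qed

lemma PPI_plus_lower:
  assumes "PPI_plus TYPE('a set set)"
  shows "PPI_plus TYPE('a)"
  unfolding PPI_plus_def
proof (intro allI impI)
  fix X :: "'a topology"
  assume X: "Hausdorff_space X \<and> regular_space X \<and> sequentially_compact_space X \<and> \<not> compact_space X"
  define Y where "Y = singleton_copy X"
  define e where "e = (\<lambda>x :: 'a. {{x}})"
  define d where "d = (\<lambda>s :: 'a set set. the_elem (the_elem s))"
  have hms: "homeomorphic_maps X Y e d" "homeomorphic_maps Y X d e"
    using homeomorphic_maps_singleton_copy[of X] homeomorphic_maps_sym
    unfolding Y_def e_def d_def by blast+
  have hm: "homeomorphic_map Y X d" "X homeomorphic_space Y"
    using hms unfolding homeomorphic_map_maps homeomorphic_space_def by blast+
  have Y: "Hausdorff_space Y" "regular_space Y" "sequentially_compact_space Y" "\<not> compact_space Y"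
    using X hm(2) homeomorphic_Hausdorff_space homeomorphic_regular_space homeomorphic_compact_space
      sequentially_compact_homeomorphic_image[OF hms(1)] by blast+
  have injd: "inj_on d (topspace Y)" using hm(1) by (simp add: homeomorphic_eq_everything_map)
  have im: "d ` topspace Y = topspace X" using hm(1) by (simp add: homeomorphic_eq_everything_map)
  have "has_uncountable_free_sequence Y"
    using assms Y unfolding PPI_plus_def by blast
  then obtain x :: "omega1 \<Rightarrow> 'a set set" where x: "range x \<subseteq> topspace Y"
      "\<And>\<alpha>. disjnt (Y closure_of (x ` {..<\<alpha>})) (Y closure_of (x ` {\<alpha>..}))"
    unfolding has_uncountable_free_sequence_def by blast
  have "has_uncountable_free_sequence X"
    unfolding has_uncountable_free_sequence_def
  proof (intro exI[of _ "d \<circ> x"] conjI allI)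
    show "range (d \<circ> x) \<subseteq> topspace X" using x(1) im by auto
    fix \<alpha>
    have "X closure_of ((d \<circ> x) ` A) = d ` (Y closure_of (x ` A))" for A
      using homeomorphic_map_closure_of[OF hm(1), of "x ` A"] x(1) by (auto simp: image_comp)
    then show "disjnt (X closure_of ((d \<circ> x) ` {..<\<alpha>})) (X closure_of ((d \<circ> x) ` {\<alpha>..}))"
      using x(2)[of \<alpha>]
      by (simp add: disjnt_def flip: inj_on_image_Int[OF injd closure_of_subset_topspace closure_of_subset_topspace])
  qed
  moreover have "contains_copy_of_omega1 X" if "first_countable X"
  proof -
    have "first_countable Y" using that hm(2) homeomorphic_space_first_countability by blast
    then obtain S where S: "S \<subseteq> topspace Y" "subtopology Y S homeomorphic_space (euclidean :: omega1 topology)"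
      using assms Y unfolding PPI_plus_def contains_copy_of_omega1_def by blast
    have "d ` S \<subseteq> topspace X" using S(1) im by blast
    moreover have "subtopology X (d ` S) homeomorphic_space subtopology Y S"
    proof -
      have "homeomorphic_map (subtopology Y S) (subtopology X (d ` S)) d"
        using hm(1) S(1) by (intro homeomorphic_map_subtopologies) (use S(1) im in auto)
      then show ?thesis using homeomorphic_map_imp_homeomorphic_space homeomorphic_space_sym by blast
    qed
    ultimately show ?thesis
      unfolding contains_copy_of_omega1_def using S(2) homeomorphic_space_trans by blast
  qed
  ultimately show "has_uncountable_free_sequence X \<and> (first_countable X \<longrightarrow> contains_copy_of_omega1 X)" by blast
qed

section \<open>The dichotomy for \<open>\<omega>\<^sub>1\<close>-sequences in locally compact spaces\<close>

lemma card_le_omega1_if_countable: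
  assumes "countable A"
  shows "|A| \<le>o |UNIV :: omega1 set|"
proof -
  have "infinite (UNIV :: omega1 set)" using uncountable_omega1 countable_finite by blast
  then have "natLeq \<le>o |UNIV :: omega1 set|" using infinite_iff_natLeq_ordLeq by blast
  then show ?thesis using assms countable_iff_natLeq ordLeq_transitive by blast
qed

lemma card_of_image_omega1: "|f ` (A :: omega1 set)| \<le>o |UNIV :: omega1 set|"
  using card_of_image card_of_mono1[OF subset_UNIV] ordLeq_transitive by blast

lemma eventually_dominated_if_small:
  assumes "|UNIV :: omega1 set| <o bounding_number" "|F| \<le>o |UNIV :: omega1 set|"
  shows "\<exists>g :: nat \<Rightarrow> nat. \<forall>f\<in>F. \<forall>\<^sub>F n in sequentially. f n \<le> g n"
proof -
  have "\<not> unbounded_family F"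
    using assms bounding_number(2) by (meson not_ordLess_ordLeq ordLeq_transitive)
  then show ?thesis unfolding unbounded_family_def by blast
qed

text \<open>
  Only the existence of pseudo-unions needs an argument. Number the union of the sets \<open>a n\<close> by
  \<open>e\<close>. Each \<open>V\<close> meets \<open>a n\<close> in finitely many indices, whose numbers are bounded by \<open>f V n\<close>. As
  there are at most \<open>\<aleph>\<^sub>1\<close> many sets \<open>V\<close>, a single function \<open>g\<close> eventually dominates all \<open>f V\<close>, and
  dropping from each \<open>a n\<close> the indices numbered up to \<open>g n\<close> leaves a set with finite traces.
\<close>

lemma P_ideal_finite_traces:
  fixes x :: "'i \<Rightarrow> 'a"
  assumes b: "|UNIV :: omega1 set| <o bounding_number" and V: "|\<V>| \<le>o |UNIV :: omega1 set|"
  shows "P_ideal_on B {a. a \<subseteq> B \<and> countable a \<and> (\<forall>V\<in>\<V>. finite {\<alpha>\<in>a. x \<alpha> \<in> V})}" (is "P_ideal_on B ?I")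
  unfolding P_ideal_on_def
proof (intro conjI allI impI ballI)
  fix I J assume "I \<in> ?I" "J \<subseteq> I"
  then have "J \<subseteq> B" "countable J" by (auto intro: countable_subset)
  moreover have "finite {\<alpha>\<in>J. x \<alpha> \<in> V}" if "V \<in> \<V>" for V
    using \<open>I \<in> ?I\<close> \<open>J \<subseteq> I\<close> that by (auto intro: finite_subset[of _ "{\<alpha>\<in>I. x \<alpha> \<in> V}"])
  ultimately show "J \<in> ?I" by blast
next
  fix \<F> assume F: "finite \<F> \<and> \<F> \<subseteq> ?I"
  have "finite {\<alpha>\<in>\<Union>\<F>. x \<alpha> \<in> V}" if "V \<in> \<V>" for V
  proof -
    have "{\<alpha>\<in>\<Union>\<F>. x \<alpha> \<in> V} = (\<Union>a\<in>\<F>. {\<alpha>\<in>a. x \<alpha> \<in> V})" by auto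
    then show ?thesis using F that by auto
  qed
  moreover have "countable (\<Union>a\<in>\<F>. a)" using F by (intro countable_UN[OF countable_finite]) auto
  ultimately show "\<Union>\<F> \<in> ?I" using F by simp blast
next
  fix a :: "nat \<Rightarrow> 'i set" assume "range a \<subseteq> ?I"
  then have a: "\<And>n. a n \<subseteq> B" "\<And>n. countable (a n)" "\<And>n V. V \<in> \<V> \<Longrightarrow> finite {\<alpha>\<in>a n. x \<alpha> \<in> V}"
    by blast+
  define A where "A = (\<Union>n. a n)"
  have "countable A" using a(2) by (auto simp: A_def)
  then obtain e :: "'i \<Rightarrow> nat" where e: "inj_on e A" by (auto simp: countable_def)
  define f where "f V n = Max (insert 0 (e ` {\<alpha>\<in>a n. x \<alpha> \<in> V}))" for V n
  have f: "e \<alpha> \<le> f V n" if "V \<in> \<V>" "\<alpha> \<in> a n" "x \<alpha> \<in> V" for V n \<alpha>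
    unfolding f_def using a(3)[OF that(1), of n] that by (intro Max_ge) auto
  have "|f ` \<V>| \<le>o |UNIV :: omega1 set|" using V card_of_image ordLeq_transitive by blast
  from eventually_dominated_if_small[OF b this]
  obtain g where g: "\<forall>h\<in>f ` \<V>. \<forall>\<^sub>F n in sequentially. h n \<le> g n" ..
  define J where "J = (\<Union>n. {\<alpha>\<in>a n. g n < e \<alpha>})"
  have "finite {\<alpha>\<in>J. x \<alpha> \<in> V}" if V: "V \<in> \<V>" for V
  proof -
    obtain N where N: "\<And>n. n \<ge> N \<Longrightarrow> f V n \<le> g n" using g V by (auto simp: eventually_sequentially)
    have "{\<alpha>\<in>J. x \<alpha> \<in> V} \<subseteq> (\<Union>n<N. {\<alpha>\<in>a n. x \<alpha> \<in> V})"
    proof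
      fix \<alpha> assume "\<alpha> \<in> {\<alpha>\<in>J. x \<alpha> \<in> V}"
      then obtain n where n: "\<alpha> \<in> a n" "g n < e \<alpha>" "x \<alpha> \<in> V" by (auto simp: J_def)
      then have "n < N" using N[of n] f[OF V, of \<alpha> n] by (meson leD le_trans not_less)
      then show "\<alpha> \<in> (\<Union>n<N. {\<alpha>\<in>a n. x \<alpha> \<in> V})" using n by blast
    qed
    then show ?thesis by (rule finite_subset) (use a(3)[OF V] in auto)
  qed
  moreover have "J \<subseteq> B" "J \<subseteq> A" using a(1) by (auto simp: J_def A_def)
  ultimately have "J \<in> ?I" using \<open>countable A\<close> countable_subset by auto
  moreover have "finite (a n - J)" for n
  proof (rule finite_imageD)
    have "e ` (a n - J) \<subseteq> {..g n}" by (auto simp: J_def not_less)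
    then show "finite (e ` (a n - J))" by (rule finite_subset) simp
    show "inj_on e (a n - J)" using e by (rule inj_on_subset) (auto simp: A_def)
  qed
  ultimately show "\<exists>J\<in>?I. \<forall>n. finite (a n - J)" by blast
qed auto

lemma locally_finite_closed_discrete:
  assumes "Hausdorff_space X" "S \<subseteq> topspace X"
    and "\<And>z. z \<in> topspace X \<Longrightarrow> \<exists>U. openin X U \<and> z \<in> U \<and> finite (S \<inter> U)"
  shows "closedin X S" "subtopology X S = discrete_topology S"
proof -
  have "X derived_set_of S = {}"
    using assms(3) by (fastforce simp: derived_set_of_infinite_openin[OF assms(1)])
  then show "closedin X S" "subtopology X S = discrete_topology S"
    using assms(2) by (auto simp: closedin_contains_derived_set subtopology_eq_discrete_topology_eq)
qed

lemma first_countable_decreasing_base: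
  assumes "first_countable X" "z \<in> topspace X"
  obtains B :: "nat \<Rightarrow> 'a set" where "\<And>n. openin X (B n)" "\<And>n. z \<in> B n" "decseq B"
    "\<And>U. openin X U \<Longrightarrow> z \<in> U \<Longrightarrow> \<exists>n. B n \<subseteq> U"
proof -
  obtain \<B> where "countable \<B>" "\<forall>V\<in>\<B>. openin X V"
      "\<forall>U. openin X U \<and> z \<in> U \<longrightarrow> (\<exists>V\<in>\<B>. z \<in> V \<and> V \<subseteq> U)"
    using bspec[OF assms(1)[unfolded first_countable_def] assms(2)] by auto
  then have \<B>: "countable \<B>" "\<And>V. V \<in> \<B> \<Longrightarrow> openin X V"
      "\<And>U. openin X U \<Longrightarrow> z \<in> U \<Longrightarrow> \<exists>V\<in>\<B>. z \<in> V \<and> V \<subseteq> U"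
    by auto
  define \<C> where "\<C> = {V\<in>\<B>. z \<in> V}"
  have "\<C> \<noteq> {}" using \<B>(3)[OF openin_topspace assms(2)] by (auto simp: \<C>_def)
  moreover have "countable \<C>" using \<B>(1) by (simp add: \<C>_def)
  ultimately have "range (from_nat_into \<C>) = \<C>" by (rule range_from_nat_into)
  then obtain V :: "nat \<Rightarrow> 'a set" where V: "range V = \<C>" ..
  have Vo: "openin X (V i)" "z \<in> V i" for i
    using V \<B>(2) rangeI[of V i] by (auto simp: \<C>_def)
  define B where "B n = (\<Inter>i\<le>n. V i)" for n
  show thesis
  proof
    show "openin X (B n)" for n unfolding B_def using Vo(1) by (intro openin_INT2) auto
    show "z \<in> B n" for n using Vo(2) by (auto simp: B_def)
    show "decseq B" by (force simp: decseq_def B_def)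
    fix U assume "openin X U" "z \<in> U"
    then obtain W where W: "W \<in> \<C>" "W \<subseteq> U" using \<B>(3) by (auto simp: \<C>_def)
    then obtain n where "V n = W" using V by blast
    then show "\<exists>n. B n \<subseteq> U" using W(2) by (auto simp: B_def intro!: exI[of _ n])
  qed
qed

text \<open>
  Choosing the terms of the subsequence from a decreasing countable neighbourhood base makes it converge.
\<close>

lemma cluster_point_imp_subsequence:
  assumes "first_countable X" "z \<in> topspace X"
    and "\<And>U. openin X U \<Longrightarrow> z \<in> U \<Longrightarrow> infinite {n :: nat. \<sigma> n \<in> U}"
  shows "\<exists>r :: nat \<Rightarrow> nat. strict_mono r \<and> limitin X (\<sigma> \<circ> r) z sequentially"
proof -
  obtain B where B: "\<And>n. openin X (B n)" "\<And>n. z \<in> B n" "decseq B"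
      "\<And>U. openin X U \<Longrightarrow> z \<in> U \<Longrightarrow> \<exists>n. B n \<subseteq> U"
    using first_countable_decreasing_base[OF assms(1,2)] by metis
  have ex: "\<exists>m>N. \<sigma> m \<in> B k" for N k
    using assms(3)[OF B(1)[of k] B(2)] by (auto simp: infinite_nat_iff_unbounded)
  obtain r where r: "\<And>k. \<sigma> (r k) \<in> B k" "\<And>k. r k < r (Suc k)"
    using dependent_nat_choice[of "\<lambda>k m. \<sigma> m \<in> B k" "\<lambda>_ m m'. m < m'"] ex by metis
  show ?thesis
  proof (intro exI conjI)
    show "strict_mono r" using r(2) by (simp add: strict_mono_Suc_iff)
    show "limitin X (\<sigma> \<circ> r) z sequentially"
      unfolding limitin_sequentially
    proof (intro conjI allI impI assms(2))
      fix U assume "openin X U \<and> z \<in> U"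
      then obtain n where n: "B n \<subseteq> U" using B(4) by blast
      have "(\<sigma> \<circ> r) k \<in> U" if "n \<le> k" for k
        using r(1)[of k] n decseqD[OF B(3) that] by auto
      then show "\<exists>N. \<forall>k\<ge>N. (\<sigma> \<circ> r) k \<in> U" by blast
    qed
  qed
qed

text \<open>
  If a sequence in the closure had no cluster point, Tietze's theorem would give a continuous
  function taking distinct integer values along it; approximating its terms by points \<open>x \<alpha>\<close> up to
  an error \<open>1/3\<close> in that function yields an infinite locally finite subfamily.
\<close>

lemma sequentially_compact_closure:
  fixes x :: "'i \<Rightarrow> 'a"
  assumes Y: "Hausdorff_space Y" "normal_space Y" "first_countable Y"
    and x: "x ` D \<subseteq> topspace Y"
    and D: "\<And>a. a \<subseteq> D \<Longrightarrow> countable a \<Longrightarrow> infinite a \<Longrightarrow>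
       \<exists>z\<in>topspace Y. \<forall>U. openin Y U \<and> z \<in> U \<longrightarrow> infinite {\<alpha>\<in>a. x \<alpha> \<in> U}"
  shows "sequentially_compact_space (subtopology Y (Y closure_of (x ` D)))"
  unfolding sequentially_compact_space_def
proof (intro allI impI)
  let ?K = "Y closure_of (x ` D)"
  fix \<sigma> :: "nat \<Rightarrow> 'a"
  assume \<sigma>0: "range \<sigma> \<subseteq> topspace (subtopology Y ?K)"
  have KY: "?K \<subseteq> topspace Y" by (rule closure_of_subset_topspace)
  with \<sigma>0 have \<sigma>: "\<And>n. \<sigma> n \<in> ?K" "\<And>n. \<sigma> n \<in> topspace Y" by auto
  show "\<exists>l r. strict_mono r \<and> limitin (subtopology Y ?K) (\<sigma> \<circ> r) l sequentially"
  proof (rule ccontr)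
    assume no: "\<not> ?thesis"
    have loc: "\<exists>U. openin Y U \<and> z \<in> U \<and> finite {n. \<sigma> n \<in> U}" if z: "z \<in> topspace Y" for z
    proof (rule ccontr)
      assume "\<not> ?thesis"
      then have "\<forall>U. openin Y U \<and> z \<in> U \<longrightarrow> infinite {n. \<sigma> n \<in> U}" by blast
      then have "infinite {n. \<sigma> n \<in> U}" if "openin Y U" "z \<in> U" for U using that by simp
      from cluster_point_imp_subsequence[OF Y(3) z this]
      obtain r where r: "strict_mono r" "limitin Y (\<sigma> \<circ> r) z sequentially" by auto
      have "z \<in> ?K"
        by (rule limitin_closedin[OF r(2)]) (use \<sigma>(1) in auto)
      then have "limitin (subtopology Y ?K) (\<sigma> \<circ> r) z sequentially"
        using r(2) \<sigma>(1) by (simp add: limitin_subtopology)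
      then show False using no r(1) by blast
    qed
    define S where "S = range \<sigma>"
    have S: "S \<subseteq> ?K" "S \<subseteq> topspace Y" using \<sigma> by (auto simp: S_def)
    have fib: "finite {n. \<sigma> n = s}" if "s \<in> S" for s
    proof -
      have "s \<in> topspace Y" using S(2) that by auto
      from loc[OF this] obtain U where U: "s \<in> U" "finite {n. \<sigma> n \<in> U}" by auto
      show ?thesis by (rule finite_subset[OF _ U(2)]) (use U(1) in auto)
    qed
    have Sinf: "infinite S"
    proof
      assume "finite S"
      then have "finite (\<Union>s\<in>S. {n. \<sigma> n = s})" using fib by blast
      moreover have "(\<Union>s\<in>S. {n. \<sigma> n = s}) = UNIV" by (auto simp: S_def)
      ultimately show False by simp
    qed
    have Sfin: "\<exists>U. openin Y U \<and> z \<in> U \<and> finite (S \<inter> U)" if z: "z \<in> topspace Y" for z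
    proof -
      obtain U where U: "openin Y U" "z \<in> U" "finite {n. \<sigma> n \<in> U}" using loc[OF z] by blast
      have "S \<inter> U \<subseteq> \<sigma> ` {n. \<sigma> n \<in> U}" by (auto simp: S_def)
      then have "finite (S \<inter> U)" using U(3) finite_subset by blast
      then show ?thesis using U by blast
    qed
    have Scd: "closedin Y S" "subtopology Y S = discrete_topology S"
      using locally_finite_closed_discrete[OF Y(1) S(2)] Sfin by blast+
    have "countable S" by (simp add: S_def)
    then obtain h :: "'a \<Rightarrow> nat" where h: "inj_on h S" by (auto simp: countable_def)
    have "continuous_map (subtopology Y S) euclideanreal (\<lambda>s. real (h s))"
      by (simp add: Scd(2))
    then obtain g where g: "continuous_map Y euclideanreal g" "\<And>s. s \<in> S \<Longrightarrow> g s = real (h s)"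
      using Tietze_extension_realinterval[OF Y(2) Scd(1), of UNIV "\<lambda>s. real (h s)"] by auto
    have gopen: "openin Y {y \<in> topspace Y. \<bar>g y - c\<bar> < e}" for c e
    proof -
      have "{y \<in> topspace Y. \<bar>g y - c\<bar> < e} = {y \<in> topspace Y. g y \<in> ball c e}"
        by (auto simp: dist_real_def)
      then show ?thesis using openin_continuous_map_preimage[OF g(1), of "ball c e"] by simp
    qed
    have "\<exists>\<alpha>\<in>D. \<bar>g (x \<alpha>) - real (h s)\<bar> < 1/3" if s: "s \<in> S" for s
    proof -
      have "s \<in> {y \<in> topspace Y. \<bar>g y - real (h s)\<bar> < 1/3}" using s S(2) g(2) by auto
      moreover have "s \<in> ?K" using s S(1) by auto
      ultimately have "{y \<in> topspace Y. \<bar>g y - real (h s)\<bar> < 1/3} \<inter> ?K \<noteq> {}" by blast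
      then have "{y \<in> topspace Y. \<bar>g y - real (h s)\<bar> < 1/3} \<inter> x ` D \<noteq> {}"
        unfolding openin_Int_closure_of_eq_empty[OF gopen] .
      then show ?thesis by auto
    qed
    then obtain \<alpha> where \<alpha>: "\<And>s. s \<in> S \<Longrightarrow> \<alpha> s \<in> D" "\<And>s. s \<in> S \<Longrightarrow> \<bar>g (x (\<alpha> s)) - real (h s)\<bar> < 1/3"
      by metis
    have "inj_on \<alpha> S"
    proof (rule inj_onI)
      fix s t assume st: "s \<in> S" "t \<in> S" "\<alpha> s = \<alpha> t"
      have "\<bar>real (h s) - real (h t)\<bar> < 1" using \<alpha>(2)[OF st(1)] \<alpha>(2)[OF st(2)] unfolding st(3) by linarith
      then have "h s = h t" by linarith
      then show "s = t" using h st by (auto dest: inj_onD)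
    qed
    then have inf: "infinite (\<alpha> ` S)" using Sinf by (simp add: finite_image_iff)
    have sub: "\<alpha> ` S \<subseteq> D" and cnt: "countable (\<alpha> ` S)" using \<alpha>(1) \<open>countable S\<close> by auto
    have "\<exists>z\<in>topspace Y. \<forall>U. openin Y U \<and> z \<in> U \<longrightarrow> infinite {\<beta>\<in>\<alpha> ` S. x \<beta> \<in> U}"
      by (rule D[OF sub cnt inf])
    then obtain z where z: "z \<in> topspace Y"
        "\<forall>U. openin Y U \<and> z \<in> U \<longrightarrow> infinite {\<beta>\<in>\<alpha> ` S. x \<beta> \<in> U}" ..
    define U where "U = {y \<in> topspace Y. \<bar>g y - g z\<bar> < 1/3}"
    have "infinite {\<beta>\<in>\<alpha> ` S. x \<beta> \<in> U}"
      using z(1) gopen[of "g z" "1/3"] by (intro z(2)[rule_format]) (auto simp: U_def)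
    moreover have "{\<beta>\<in>\<alpha> ` S. x \<beta> \<in> U} \<subseteq> \<alpha> ` {s\<in>S. \<bar>real (h s) - g z\<bar> < 1}"
    proof clarify
      fix s assume s: "s \<in> S" "x (\<alpha> s) \<in> U"
      then have "\<bar>g (x (\<alpha> s)) - g z\<bar> < 1/3" by (simp add: U_def)
      then have "\<bar>real (h s) - g z\<bar> < 1" using \<alpha>(2)[OF s(1)] by linarith
      then show "\<alpha> s \<in> \<alpha> ` {s\<in>S. \<bar>real (h s) - g z\<bar> < 1}" using s(1) by blast
    qed
    moreover have "finite {s\<in>S. \<bar>real (h s) - g z\<bar> < 1}"
    proof (rule finite_imageD[of h])
      have "h ` {s\<in>S. \<bar>real (h s) - g z\<bar> < 1} \<subseteq> {..nat \<lceil>g z + 1\<rceil>}"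
      proof (rule image_subsetI)
        fix s assume "s \<in> {s\<in>S. \<bar>real (h s) - g z\<bar> < 1}"
        then have "\<bar>real (h s) - g z\<bar> < 1" by simp
        then have "real (h s) \<le> g z + 1" by linarith
        then show "h s \<in> {..nat \<lceil>g z + 1\<rceil>}" by (simp add: le_nat_iff le_ceiling_iff) linarith
      qed
      then show "finite (h ` {s\<in>S. \<bar>real (h s) - g z\<bar> < 1})" by (rule finite_subset) simp
      show "inj_on h {s\<in>S. \<bar>real (h s) - g z\<bar> < 1}" using h by (rule inj_on_subset) auto
    qed
    ultimately show False using finite_surj by blast
  qed
qed

text \<open>
  Each Lindelof piece is covered by countably many relatively compact open sets, and a union of
  \<open>\<omega>\<^sub>1\<close> many countable sets has at most \<open>\<aleph>\<^sub>1\<close> elements.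
\<close>

lemma small_relatively_compact_cover:
  fixes L :: "omega1 \<Rightarrow> 'a set"
  assumes Y: "Hausdorff_space Y" "locally_compact_space Y"
    and L: "\<And>\<xi>. openin Y (L \<xi>)" "\<And>\<xi>. Lindelof_space (subtopology Y (L \<xi>))" "(\<Union>\<xi>. L \<xi>) = topspace Y"
  obtains \<V> where "|\<V>| \<le>o |UNIV :: omega1 set|" "\<And>V. V \<in> \<V> \<Longrightarrow> openin Y V"
    "\<And>V. V \<in> \<V> \<Longrightarrow> compactin Y (Y closure_of V)" "\<Union>\<V> = topspace Y"
proof -
  have ex: "\<exists>\<W>. countable \<W> \<and> (\<forall>W\<in>\<W>. openin Y W \<and> compactin Y (Y closure_of W)) \<and> L \<xi> \<subseteq> \<Union>\<W>" for \<xi>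
  proof -
    have "\<forall>z\<in>topspace Y. \<exists>U. openin Y U \<and> compactin Y (Y closure_of U) \<and> z \<in> U"
      using Y locally_compact_space_compact_closure_of by blast
    then obtain U where U: "\<And>z. z \<in> topspace Y \<Longrightarrow> openin Y (U z) \<and> compactin Y (Y closure_of (U z)) \<and> z \<in> U z"
      by metis
    have sub: "L \<xi> \<subseteq> topspace Y" using L(1) openin_subset by blast
    have "\<And>V. V \<in> U ` L \<xi> \<Longrightarrow> openin Y V" using U sub by blast
    moreover have "L \<xi> \<subseteq> \<Union>(U ` L \<xi>)" using U sub by blast
    ultimately obtain \<W> where "countable \<W>" "\<W> \<subseteq> U ` L \<xi>" "L \<xi> \<subseteq> \<Union>\<W>"
      using L(2)[of \<xi>] unfolding Lindelof_space_subtopology_subset[OF sub] by metis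
    then show ?thesis using U sub by (intro exI[of _ \<W>]) blast
  qed
  then obtain \<W> where \<W>: "\<And>\<xi>. countable (\<W> \<xi>)" "\<And>\<xi> W. W \<in> \<W> \<xi> \<Longrightarrow> openin Y W \<and> compactin Y (Y closure_of W)"
      "\<And>\<xi>. L \<xi> \<subseteq> \<Union>(\<W> \<xi>)"
    by metis
  show thesis
  proof
    have "infinite (UNIV :: omega1 set)" using uncountable_omega1 countable_finite by blast
    then show "|\<Union>\<xi>. \<W> \<xi>| \<le>o |UNIV :: omega1 set|"
      by (rule card_of_UNION_ordLeq_infinite) (auto intro: card_le_omega1_if_countable \<W>(1) card_of_mono1)
    show "\<And>V. V \<in> (\<Union>\<xi>. \<W> \<xi>) \<Longrightarrow> openin Y V" "\<And>V. V \<in> (\<Union>\<xi>. \<W> \<xi>) \<Longrightarrow> compactin Y (Y closure_of V)"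
      using \<W>(2) by auto
    show "\<Union>(\<Union>\<xi>. \<W> \<xi>) = topspace Y"
    proof
      show "\<Union>(\<Union>\<xi>. \<W> \<xi>) \<subseteq> topspace Y" using \<W>(2) openin_subset by blast
      show "topspace Y \<subseteq> \<Union>(\<Union>\<xi>. \<W> \<xi>)" unfolding L(3)[symmetric] using \<W>(3) by blast
    qed
  qed
qed

text \<open>
  Fix a cover \<open>\<V>\<close> by at most \<open>\<aleph>\<^sub>1\<close> relatively compact open sets. A countable set of indices has
  finite traces on all members of \<open>\<V>\<close> iff \<open>x\<close> is locally finite along it, and these sets form a
  \<open>P\<close>-ideal. If all countable subsets of \<open>E\<close> are in the ideal, then \<open>x\<close> is locally finite on \<open>E\<close>
  itself, since each \<open>L \<xi>\<close> sees only countably many indices. If no infinite subset of \<open>D\<close> is in the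
  ideal, every infinite part of \<open>x ` D\<close> has a cluster point, which passes to the closure.
\<close>

theorem relatively_discrete_or_sequentially_compact:
  fixes x :: "omega1 \<Rightarrow> 'a" and L :: "omega1 \<Rightarrow> 'a set"
  assumes ax: "|UNIV :: omega1 set| <o bounding_number" P22
    and Y: "Hausdorff_space Y" "normal_space Y" "first_countable Y" "locally_compact_space Y"
    and L: "\<And>\<xi>. openin Y (L \<xi>)" "\<And>\<xi>. Lindelof_space (subtopology Y (L \<xi>))" "(\<Union>\<xi>. L \<xi>) = topspace Y"
    and B: "stationary B" "\<And>\<alpha>. \<alpha> \<in> B \<Longrightarrow> x \<alpha> \<in> topspace Y"
    and few: "\<And>\<xi>. countable {\<alpha>\<in>B. x \<alpha> \<in> L \<xi>}"
  shows "(\<exists>E\<subseteq>B. stationary E \<and> subtopology Y (x ` E) = discrete_topology (x ` E)) \<or>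
    (\<exists>D\<subseteq>B. stationary D \<and> sequentially_compact_space (subtopology Y (Y closure_of (x ` D))) \<and>
       \<not> compact_space (subtopology Y (Y closure_of (x ` D))))"
proof -
  obtain \<V> where \<V>: "|\<V>| \<le>o |UNIV :: omega1 set|" "\<And>V. V \<in> \<V> \<Longrightarrow> openin Y V"
      "\<And>V. V \<in> \<V> \<Longrightarrow> compactin Y (Y closure_of V)" "\<Union>\<V> = topspace Y"
    using small_relatively_compact_cover[OF Y(1,4) L] by metis
  define \<I> where "\<I> = {a. a \<subseteq> B \<and> countable a \<and> (\<forall>V\<in>\<V>. finite {\<alpha>\<in>a. x \<alpha> \<in> V})}"
  have "P_ideal_on B \<I>" unfolding \<I>_def by (rule P_ideal_finite_traces[OF ax(1) \<V>(1)])
  with B(1) have "(\<exists>E\<subseteq>B. stationary E \<and> (\<forall>a\<subseteq>E. countable a \<longrightarrow> a \<in> \<I>)) \<or>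
      (\<exists>D\<subseteq>B. stationary D \<and> {a. a \<subseteq> D \<and> countable a \<and> infinite a} \<inter> \<I> = {})"
    by (intro ax(2)[unfolded P22_def, rule_format] conjI)
  then show ?thesis
  proof (elim disjE exE conjE)
    fix E assume 1: "E \<subseteq> B" "stationary E" "\<forall>a\<subseteq>E. countable a \<longrightarrow> a \<in> \<I>"
    have "\<exists>U. openin Y U \<and> z \<in> U \<and> finite (x ` E \<inter> U)" if "z \<in> topspace Y" for z
    proof -
      have "z \<in> \<Union>\<V>" "z \<in> (\<Union>\<xi>. L \<xi>)" unfolding \<V>(4) L(3) by (rule that)+
      then obtain \<xi> V where V: "z \<in> L \<xi>" "V \<in> \<V>" "z \<in> V" by auto
      have cnt: "countable {\<alpha>\<in>E. x \<alpha> \<in> L \<xi>}"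
        using few[of \<xi>] by (rule countable_subset[rotated]) (use 1(1) in auto)
      have "{\<alpha>\<in>E. x \<alpha> \<in> L \<xi>} \<in> \<I>" by (rule 1(3)[rule_format, OF _ cnt]) simp
      then have fin: "finite {\<alpha>\<in>{\<alpha>\<in>E. x \<alpha> \<in> L \<xi>}. x \<alpha> \<in> V}" using V(2) unfolding \<I>_def by blast
      have eq: "{\<alpha>\<in>{\<alpha>\<in>E. x \<alpha> \<in> L \<xi>}. x \<alpha> \<in> V} = {\<alpha>\<in>E. x \<alpha> \<in> L \<xi> \<inter> V}" by auto
      show ?thesis
      proof (intro exI conjI)
        show "openin Y (L \<xi> \<inter> V)" by (intro openin_Int L(1) \<V>(2) V(2))
        show "z \<in> L \<xi> \<inter> V" using V by simp
        have "finite {\<alpha>\<in>E. x \<alpha> \<in> L \<xi> \<inter> V}" using fin unfolding eq .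
        moreover have "x ` E \<inter> (L \<xi> \<inter> V) = x ` {\<alpha>\<in>E. x \<alpha> \<in> L \<xi> \<inter> V}" by auto
        ultimately show "finite (x ` E \<inter> (L \<xi> \<inter> V))" by simp
      qed
    qed
    moreover have "x ` E \<subseteq> topspace Y" using B(2) 1(1) by blast
    ultimately have "subtopology Y (x ` E) = discrete_topology (x ` E)"
      by (intro locally_finite_closed_discrete(2)[OF Y(1)])
    then show ?thesis using 1(1,2) by blast
  next
    fix D assume 2: "D \<subseteq> B" "stationary D" "{a. a \<subseteq> D \<and> countable a \<and> infinite a} \<inter> \<I> = {}"
    let ?K = "Y closure_of (x ` D)"
    have xD: "x ` D \<subseteq> topspace Y" using B(2) 2(1) by blast
    have "sequentially_compact_space (subtopology Y ?K)"
    proof (rule sequentially_compact_closure[OF Y(1-3) xD])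
      fix a assume a: "a \<subseteq> D" "countable a" "infinite a"
      show "\<exists>z\<in>topspace Y. \<forall>U. openin Y U \<and> z \<in> U \<longrightarrow> infinite {\<alpha>\<in>a. x \<alpha> \<in> U}"
      proof (rule ccontr)
        assume "\<not> ?thesis"
        then have "\<forall>z\<in>topspace Y. \<exists>U. openin Y U \<and> z \<in> U \<and> finite {\<alpha>\<in>a. x \<alpha> \<in> U}" by blast
        then obtain U where U: "\<And>z. z \<in> topspace Y \<Longrightarrow> openin Y (U z) \<and> z \<in> U z \<and> finite {\<alpha>\<in>a. x \<alpha> \<in> U z}"
          by metis
        have "finite {\<alpha>\<in>a. x \<alpha> \<in> V}" if V: "V \<in> \<V>" for V
        proof -
          let ?C = "Y closure_of V"
          have C: "?C \<subseteq> topspace Y" by (rule closure_of_subset_topspace)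
          then have "\<forall>W\<in>U ` ?C. openin Y W" "?C \<subseteq> \<Union>(U ` ?C)" using U by blast+
          then obtain F where F: "finite F" "F \<subseteq> ?C" "?C \<subseteq> \<Union>(U ` F)"
            using compactinD[OF \<V>(3)[OF V], of "U ` ?C"] by (metis finite_subset_image)
          have "V \<subseteq> ?C" using closure_of_subset[OF openin_subset[OF \<V>(2)[OF V]]] .
          then have "{\<alpha>\<in>a. x \<alpha> \<in> V} \<subseteq> (\<Union>z\<in>F. {\<alpha>\<in>a. x \<alpha> \<in> U z})" using F(3) by blast
          moreover have "finite (\<Union>z\<in>F. {\<alpha>\<in>a. x \<alpha> \<in> U z})" using F(1,2) U C by blast
          ultimately show ?thesis by (rule finite_subset)
        qed
        then have "a \<in> \<I>" using a 2(1) by (auto simp: \<I>_def)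
        then show False using 2(3) a by blast
      qed
    qed
    moreover have "\<not> compact_space (subtopology Y ?K)"
    proof
      assume "compact_space (subtopology Y ?K)"
      then have "compactin Y ?K" using closure_of_subset_topspace by (simp add: compactin_subspace)
      moreover have "?K \<subseteq> \<Union>(range L)" using L(3) closure_of_subset_topspace by metis
      ultimately obtain F where F: "finite F" "?K \<subseteq> \<Union>(L ` F)"
        using compactinD[of Y ?K "range L"] L(1) by (metis (no_types, lifting) finite_subset_image image_iff)
      have "D \<subseteq> (\<Union>\<xi>\<in>F. {\<alpha>\<in>B. x \<alpha> \<in> L \<xi>})"
        using F(2) closure_of_subset[OF xD] 2(1) by blast
      moreover have "countable (\<Union>\<xi>\<in>F. {\<alpha>\<in>B. x \<alpha> \<in> L \<xi>})"
        using F(1) few by (intro countable_UN[OF countable_finite]) auto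
      ultimately show False using stationary_imp_uncountable[OF 2(2)] countable_subset by blast
    qed
    ultimately show ?thesis using 2(1,2) by blast
  qed
qed

section \<open>Hereditarily normal, locally second countable spaces\<close>

definition locally_second_countable :: "'a topology \<Rightarrow> bool"
  where "locally_second_countable X \<longleftrightarrow>
    (\<forall>x\<in>topspace X. \<exists>U. openin X U \<and> x \<in> U \<and> second_countable (subtopology X U))"

lemma second_countable_subtopology_mono:
  assumes "second_countable (subtopology X U)" "S \<subseteq> U"
  shows "second_countable (subtopology X S)"
  using second_countable_subtopology[OF assms(1), of S] assms(2)
  by (simp add: subtopology_subtopology inf.absorb2)

lemma second_countable_subtopology_Union:
  assumes "countable \<U>" "\<And>U. U \<in> \<U> \<Longrightarrow> openin X U"
    "\<And>U. U \<in> \<U> \<Longrightarrow> second_countable (subtopology X U)"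
  shows "second_countable (subtopology X (\<Union>\<U>))"
proof -
  have op: "openin (subtopology X U) V \<longleftrightarrow> openin X V \<and> V \<subseteq> U" if "U \<in> \<U>" for U V
    using openin_open_subtopology[OF assms(2)[OF that]] .
  have "\<exists>\<B>. countable \<B> \<and> (\<forall>B\<in>\<B>. openin X B \<and> B \<subseteq> U) \<and>
      (\<forall>V x. openin X V \<and> V \<subseteq> U \<and> x \<in> V \<longrightarrow> (\<exists>B\<in>\<B>. x \<in> B \<and> B \<subseteq> V))" if "U \<in> \<U>" for U
    using assms(3)[OF that] unfolding second_countable_def op[OF that] by simp
  then have "\<forall>U\<in>\<U>. \<exists>\<B>. countable \<B> \<and> (\<forall>B\<in>\<B>. openin X B \<and> B \<subseteq> U) \<and>
      (\<forall>V x. openin X V \<and> V \<subseteq> U \<and> x \<in> V \<longrightarrow> (\<exists>B\<in>\<B>. x \<in> B \<and> B \<subseteq> V))" ..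
  from bchoice[OF this] obtain \<B> where \<B>: "\<forall>U\<in>\<U>. countable (\<B> U) \<and> (\<forall>B\<in>\<B> U. openin X B \<and> B \<subseteq> U) \<and>
      (\<forall>V x. openin X V \<and> V \<subseteq> U \<and> x \<in> V \<longrightarrow> (\<exists>B\<in>\<B> U. x \<in> B \<and> B \<subseteq> V))" ..
  have un: "openin X (\<Union>\<U>)" using assms(2) by (rule openin_Union)
  show ?thesis
    unfolding second_countable_def openin_open_subtopology[OF un]
  proof (intro exI conjI ballI allI impI)
    show "countable (\<Union>U\<in>\<U>. \<B> U)" using assms(1) \<B> by (intro countable_UN) auto
    fix B assume "B \<in> (\<Union>U\<in>\<U>. \<B> U)"
    then obtain U where U: "U \<in> \<U>" "B \<in> \<B> U" by auto
    show "openin X B" using \<B>[rule_format, OF U(1)] U(2) by simp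
    have "B \<subseteq> U" using \<B>[rule_format, OF U(1)] U(2) by simp
    then show "B \<subseteq> \<Union>\<U>" using U(1) by auto
  next
    fix V x assume V: "(openin X V \<and> V \<subseteq> \<Union>\<U>) \<and> x \<in> V"
    then obtain U where U: "U \<in> \<U>" "x \<in> U" by auto
    have *: "\<forall>V x. openin X V \<and> V \<subseteq> U \<and> x \<in> V \<longrightarrow> (\<exists>B\<in>\<B> U. x \<in> B \<and> B \<subseteq> V)"
      using \<B>[rule_format, OF U(1)] by simp
    have "\<exists>B\<in>\<B> U. x \<in> B \<and> B \<subseteq> V \<inter> U"
      by (rule *[rule_format]) (use V U assms(2)[OF U(1)] in auto)
    then show "\<exists>B\<in>(\<Union>U\<in>\<U>. \<B> U). x \<in> B \<and> B \<subseteq> V" using U(1) by auto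
  qed
qed

lemma locally_second_countable_imp_first_countable:
  assumes "locally_second_countable X"
  shows "first_countable X"
  unfolding first_countable_def
proof
  fix x assume x: "x \<in> topspace X"
  then obtain U where U: "openin X U" "x \<in> U" "second_countable (subtopology X U)"
    using assms unfolding locally_second_countable_def by blast
  have "x \<in> topspace (subtopology X U)" using x U(2) by simp
  then obtain \<B> where \<B>: "countable \<B>" "\<forall>V\<in>\<B>. openin (subtopology X U) V"
      "\<forall>V. openin (subtopology X U) V \<and> x \<in> V \<longrightarrow> (\<exists>B\<in>\<B>. x \<in> B \<and> B \<subseteq> V)"
    using bspec[OF second_countable_imp_first_countable[OF U(3), unfolded first_countable_def], of x]
    by auto
  show "\<exists>\<B>. countable \<B> \<and> (\<forall>V\<in>\<B>. openin X V) \<and>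
      (\<forall>W. openin X W \<and> x \<in> W \<longrightarrow> (\<exists>V\<in>\<B>. x \<in> V \<and> V \<subseteq> W))"
  proof (intro exI conjI allI impI)
    show "countable \<B>" by fact
    show "\<forall>V\<in>\<B>. openin X V" using \<B>(2) unfolding openin_open_subtopology[OF U(1)] by simp
    fix W assume "openin X W \<and> x \<in> W"
    then have "openin (subtopology X U) (W \<inter> U) \<and> x \<in> W \<inter> U"
      unfolding openin_open_subtopology[OF U(1)] using U by auto
    from \<B>(3)[rule_format, OF this] have "\<exists>B\<in>\<B>. x \<in> B \<and> B \<subseteq> W \<inter> U" .
    then show "\<exists>B\<in>\<B>. x \<in> B \<and> B \<subseteq> W" by auto
  qed
qed

lemma T5_subtopology: "T5_space X \<Longrightarrow> T5_space (subtopology X S)"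
  by (simp add: T5_space_def Hausdorff_space_subtopology hereditarily_subtopology)

lemma T5_imp_normal: "T5_space X \<Longrightarrow> normal_space X"
  by (simp add: T5_space_def hereditarily_inc)

lemma T5_imp_Hausdorff: "T5_space X \<Longrightarrow> Hausdorff_space X"
  by (simp add: T5_space_def)

lemma T5_imp_regular: "T5_space X \<Longrightarrow> regular_space X"
  using T5_imp_normal T5_imp_Hausdorff normal_t1_imp_regular_space Hausdorff_imp_t1_space by blast

lemma T5_shrinking:
  assumes "T5_space X" "closedin X S" "openin X U" "S \<subseteq> U"
  shows "\<exists>V. openin X V \<and> S \<subseteq> V \<and> X closure_of V \<subseteq> U"
  using T5_imp_normal[OF assms(1)] assms(2-4) unfolding normal_space_alt by simp

text \<open>A relatively discrete set is closed in an open subspace, and that subspace is normal too.\<close>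

lemma relatively_discrete_imp_separated:
  assumes CW: "CW TYPE('a)" and X: "T5_space (X :: 'a topology)" "first_countable X"
    and D: "D \<subseteq> topspace X" "subtopology X D = discrete_topology D" "|D| \<le>o |UNIV :: omega1 set|"
  obtains U where "\<And>d. d \<in> D \<Longrightarrow> openin X (U d)" "\<And>d. d \<in> D \<Longrightarrow> d \<in> U d" "disjoint_family_on U D"
proof -
  have "\<exists>T. openin X T \<and> T \<inter> D = {d}" if "d \<in> D" for d
  proof -
    have "openin (subtopology X D) {d}" using D(2) that by simp
    then show ?thesis unfolding openin_subtopology by metis
  qed
  then obtain T where T: "\<And>d. d \<in> D \<Longrightarrow> openin X (T d)" "\<And>d. d \<in> D \<Longrightarrow> T d \<inter> D = {d}" by metis
  define G where "G = (\<Union>d\<in>D. T d)"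
  have G: "openin X G" "D \<subseteq> G" using T by (auto simp: G_def)
  have Gtop: "topspace (subtopology X G) = G" using openin_subset[OF G(1)] by auto
  have "openin X (\<Union>d\<in>D. T d - {d})"
  proof (rule openin_Union, clarify)
    fix d assume d: "d \<in> D"
    have "closedin X {d}"
      using T5_imp_Hausdorff[OF X(1)] d D(1) by (meson Hausdorff_imp_t1_space closedin_t1_singleton subsetD)
    then show "openin X (T d - {d})" using T(1)[OF d] by (intro openin_diff)
  qed
  moreover have "(\<Union>d\<in>D. T d - {d}) = G - D" using T(2) by (auto simp: G_def)
  ultimately have "openin (subtopology X G) (G - D)"
    by (simp add: openin_open_subtopology[OF G(1)])
  then have cl: "closedin (subtopology X G) D"
    unfolding closedin_def Gtop using G(2) by simp
  have "aleph1_collectionwise_Hausdorff (subtopology X G)"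
    using CW T5_subtopology[OF X(1), of G] first_countable_subtopology[OF X(2), of G]
    unfolding CW_def by (simp add: T5_imp_normal T5_imp_Hausdorff)
  moreover have "subtopology (subtopology X G) D = discrete_topology D"
    using D(2) G(2) by (simp add: subtopology_subtopology inf.absorb2)
  ultimately have "\<exists>U. (\<forall>d\<in>D. openin (subtopology X G) (U d) \<and> d \<in> U d) \<and> disjoint_family_on U D"
    using cl D(3) unfolding aleph1_collectionwise_Hausdorff_def by simp
  then obtain U where U: "\<forall>d\<in>D. openin (subtopology X G) (U d) \<and> d \<in> U d" "disjoint_family_on U D"
    by auto
  show thesis
    by (rule that[OF _ _ U(2)]) (use U(1) in \<open>auto simp: openin_open_subtopology[OF G(1)]\<close>)
qed

text \<open>
  A second countable open set has a countable dense subset, in which each \<open>V d\<close> picks its own point.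
\<close>

lemma countable_disjoint_open_meeting_second_countable:
  assumes U: "openin X U" "second_countable (subtopology X U)"
    and V: "\<And>d. d \<in> D \<Longrightarrow> openin X (V d)" "\<And>d. d \<in> D \<Longrightarrow> V d \<inter> U \<noteq> {}" "disjoint_family_on V D"
  shows "countable D"
proof -
  obtain C where C: "countable C" "C \<subseteq> topspace (subtopology X U)"
      "subtopology X U closure_of C = topspace (subtopology X U)"
    using second_countable_imp_separable_space[OF U(2)] unfolding separable_space_def by auto
  have "\<exists>c. c \<in> C \<inter> V d" if d: "d \<in> D" for d
  proof -
    have op: "openin (subtopology X U) (V d \<inter> U)"
      using V(1)[OF d] U(1) by (simp add: openin_open_subtopology openin_Int)
    have "V d \<inter> U \<subseteq> subtopology X U closure_of C"
      unfolding C(3) using openin_subset[OF op] .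
    then have "(V d \<inter> U) \<inter> subtopology X U closure_of C \<noteq> {}" using V(2)[OF d] by blast
    then have "(V d \<inter> U) \<inter> C \<noteq> {}" unfolding openin_Int_closure_of_eq_empty[OF op] .
    then show ?thesis by auto
  qed
  then obtain c where c: "\<And>d. d \<in> D \<Longrightarrow> c d \<in> C \<inter> V d" by metis
  have "inj_on c D"
  proof (rule inj_onI, rule ccontr)
    fix d e assume de: "d \<in> D" "e \<in> D" "c d = c e" "d \<noteq> e"
    then have "V d \<inter> V e = {}" using V(3) by (simp add: disjoint_family_on_def)
    then show False using c[OF de(1)] c[OF de(2)] de(3) by auto
  qed
  moreover have "countable (c ` D)" by (rule countable_subset[OF _ C(1)]) (use c in auto)
  ultimately show ?thesis by (rule countable_image_inj_on[rotated])
qed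

text \<open>
  The disjoint neighbourhoods that separate \<open>D\<close> all meet \<open>U\<close>.
\<close>

lemma countable_relatively_discrete_in_closure:
  assumes CW: "CW TYPE('a)" and X: "T5_space (X :: 'a topology)" "first_countable X"
    and U: "openin X U" "second_countable (subtopology X U)"
    and D: "D \<subseteq> X closure_of U" "subtopology X D = discrete_topology D" "|D| \<le>o |UNIV :: omega1 set|"
  shows "countable D"
proof -
  have "D \<subseteq> topspace X" using D(1) closure_of_subset_topspace by (rule subset_trans)
  from relatively_discrete_imp_separated[OF CW X this D(2,3)]
  obtain V where V: "\<And>d. d \<in> D \<Longrightarrow> openin X (V d)" "\<And>d. d \<in> D \<Longrightarrow> d \<in> V d" "disjoint_family_on V D"
    by metis
  show ?thesis
  proof (rule countable_disjoint_open_meeting_second_countable[OF U V(1) _ V(3)])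
    fix d assume d: "d \<in> D"
    have "V d \<inter> X closure_of U \<noteq> {}" using V(2)[OF d] d D(1) by auto
    then show "V d \<inter> U \<noteq> {}" unfolding openin_Int_closure_of_eq_empty[OF V(1)[OF d]] .
  qed
qed

lemma free_sequence_imp_relatively_discrete:
  fixes z :: "omega1 \<Rightarrow> 'a"
  assumes z: "range z \<subseteq> topspace X"
    and free: "\<And>\<alpha>. disjnt (X closure_of (z ` {..<\<alpha>})) (X closure_of (z ` {\<alpha>..}))"
  shows "inj z" "subtopology X (range z) = discrete_topology (range z)"
proof -
  have sub: "z ` A \<subseteq> X closure_of (z ` A)" for A using z by (intro closure_of_subset) auto
  have less: "z \<beta> \<noteq> z \<alpha>" if "\<beta> < \<alpha>" for \<alpha> \<beta>
  proof -
    have "z \<beta> \<in> X closure_of (z ` {..<\<alpha>})" using sub[of "{..<\<alpha>}"] that by auto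
    moreover have "z \<alpha> \<in> X closure_of (z ` {\<alpha>..})" using sub[of "{\<alpha>..}"] by auto
    ultimately show ?thesis using free[of \<alpha>] by (metis disjnt_iff)
  qed
  then show inj: "inj z" by (metis injI linorder_neqE)
  have "openin (subtopology X (range z)) {z \<alpha>}" for \<alpha>
  proof -
    define \<gamma> where "\<gamma> = next_ord \<alpha>"
    have \<gamma>: "\<alpha> < \<gamma>" "\<And>\<beta>. \<alpha> < \<beta> \<Longrightarrow> \<gamma> \<le> \<beta>"
      unfolding \<gamma>_def by (rule less_next_ord, rule next_ord_le)
    define N where "N = topspace X - (X closure_of (z ` {..<\<alpha>}) \<union> X closure_of (z ` {\<gamma>..}))"
    have "openin X N" unfolding N_def by (intro openin_diff closedin_Un closedin_closure_of openin_topspace)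
    moreover have "N \<inter> range z = {z \<alpha>}"
    proof (intro equalityI subsetI)
      fix y assume "y \<in> N \<inter> range z"
      then obtain \<beta> where \<beta>: "y = z \<beta>" "z \<beta> \<in> N" by auto
      have "\<not> \<beta> < \<alpha>" using \<beta>(2) sub[of "{..<\<alpha>}"] by (auto simp: N_def)
      moreover have "\<not> \<alpha> < \<beta>" using \<beta>(2) sub[of "{\<gamma>..}"] \<gamma>(2) by (auto simp: N_def)
      ultimately show "y \<in> {z \<alpha>}" using \<beta>(1) by (metis linorder_neqE singletonI)
    next
      fix y assume y: "y \<in> {z \<alpha>}"
      have "z \<alpha> \<in> X closure_of (z ` {\<alpha>..})" using sub[of "{\<alpha>..}"] by auto
      then have "z \<alpha> \<notin> X closure_of (z ` {..<\<alpha>})" using free[of \<alpha>] by (metis disjnt_iff)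
      moreover have "z \<alpha> \<in> X closure_of (z ` {..<\<gamma>})" using sub[of "{..<\<gamma>}"] \<gamma>(1) by auto
      then have "z \<alpha> \<notin> X closure_of (z ` {\<gamma>..})" using free[of \<gamma>] by (metis disjnt_iff)
      ultimately show "y \<in> N \<inter> range z" using y z by (auto simp: N_def)
    qed
    ultimately show ?thesis unfolding openin_subtopology by metis
  qed
  moreover have "topspace (subtopology X (range z)) = range z" using z by auto
  ultimately show "subtopology X (range z) = discrete_topology (range z)"
    using discrete_topology_unique[of "range z" "subtopology X (range z)"] by auto
qed

text \<open>
  Otherwise points \<open>p \<xi>\<close> of the closure \<open>F\<close> can be chosen recursively outside the second countable
  neighbourhoods \<open>V (p \<eta>)\<close> of the earlier ones. The dichotomy is applied to this sequence in the part
  of \<open>F\<close> covered by these neighbourhoods. Both alternatives lead to an uncountable relatively discrete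
  subset of \<open>F\<close>: either a subsequence or, by \<open>PPI\<^sup>+\<close>, a free sequence.
\<close>

theorem closure_in_second_countable_open:
  assumes ax: "CW TYPE('a)" "PPI_plus TYPE('a)" "|UNIV :: omega1 set| <o bounding_number" P22
    and X: "T5_space (X :: 'a topology)" "locally_compact_space X" "locally_second_countable X"
    and U: "openin X U" "second_countable (subtopology X U)"
  shows "\<exists>V. openin X V \<and> second_countable (subtopology X V) \<and> X closure_of U \<subseteq> V"
proof (rule ccontr)
  assume no: "\<not> ?thesis"
  have fc: "first_countable X" using locally_second_countable_imp_first_countable X(3) by blast
  define F where "F = X closure_of U"
  have F: "F \<subseteq> topspace X" "closedin X F" unfolding F_def by (auto simp: closure_of_subset_topspace)
  obtain V where V: "\<And>p. p \<in> F \<Longrightarrow> openin X (V p)" "\<And>p. p \<in> F \<Longrightarrow> p \<in> V p"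
      "\<And>p. p \<in> F \<Longrightarrow> second_countable (subtopology X (V p))"
    using X(3) F(1) unfolding locally_second_countable_def by (metis subsetD)
  have notcov: "\<not> F \<subseteq> \<Union>(V ` A)" if A: "countable A" "A \<subseteq> F" for A
  proof
    assume "F \<subseteq> \<Union>(V ` A)"
    moreover have "openin X (\<Union>(V ` A))" using V(1) A(2) by (intro openin_Union) auto
    moreover have "second_countable (subtopology X (\<Union>(V ` A)))"
      using V(1,3) A by (intro second_countable_subtopology_Union) auto
    ultimately show False using no unfolding F_def by blast
  qed
  have "\<exists>p :: omega1 \<Rightarrow> 'a. \<forall>\<xi>. p \<xi> \<in> F \<and> (\<forall>\<eta><\<xi>. p \<xi> \<notin> V (p \<eta>))"
  proof (rule dependent_wf_choice[OF wf, where P = "\<lambda>p \<xi> r. r \<in> F \<and> (\<forall>\<eta><\<xi>. r \<notin> V (p \<eta>))"])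
    fix p q :: "omega1 \<Rightarrow> 'a" and \<xi> :: omega1 and r
    assume "\<And>\<eta>. (\<eta>, \<xi>) \<in> {(x, y). x < y} \<Longrightarrow> p \<eta> = q \<eta>"
    then show "(r \<in> F \<and> (\<forall>\<eta><\<xi>. r \<notin> V (p \<eta>))) = (r \<in> F \<and> (\<forall>\<eta><\<xi>. r \<notin> V (q \<eta>)))" by simp
  next
    fix \<xi> :: omega1 and p
    assume "\<And>\<eta>. (\<eta>, \<xi>) \<in> {(x, y). x < y} \<Longrightarrow> p \<eta> \<in> F \<and> (\<forall>\<zeta><\<eta>. p \<eta> \<notin> V (p \<zeta>))"
    then have "p ` {..<\<xi>} \<subseteq> F" by auto
    moreover have "countable (p ` {..<\<xi>})" using countable_lessThan_omega1 by (rule countable_image)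
    ultimately have "\<not> F \<subseteq> \<Union>(V ` p ` {..<\<xi>})" using notcov by blast
    then show "\<exists>r. r \<in> F \<and> (\<forall>\<eta><\<xi>. r \<notin> V (p \<eta>))" by auto
  qed
  then obtain p :: "omega1 \<Rightarrow> 'a" where p: "\<And>\<xi>. p \<xi> \<in> F" "\<And>\<xi> \<eta>. \<eta> < \<xi> \<Longrightarrow> p \<xi> \<notin> V (p \<eta>)" by auto
  have injp: "inj p" using p V(2) by (metis injI linorder_neqE)
  define G where "G = (\<Union>\<xi>. V (p \<xi>))"
  have G: "openin X G" unfolding G_def using V(1) p(1) by (intro openin_Union) auto
  define Y where "Y = subtopology X (G \<inter> F)"
  have Ytop: "topspace Y = G \<inter> F" using F(1) by (auto simp: Y_def)
  have Ysub: "subtopology Y S = subtopology X S" if "S \<subseteq> G \<inter> F" for S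
    using that unfolding Y_def subtopology_subtopology by (simp add: inf.absorb2)
  have YT5: "T5_space Y" unfolding Y_def by (rule T5_subtopology[OF X(1)])
  have Yfc: "first_countable Y" unfolding Y_def by (rule first_countable_subtopology[OF fc])
  have lcG: "locally_compact_space (subtopology X G)"
    using locally_compact_space_open_subset X(1,2) G T5_imp_Hausdorff by blast
  have "closedin (subtopology X G) (G \<inter> F)" using F(2) by (simp add: closedin_subtopology_Int_closed)
  from locally_compact_space_closed_subset[OF lcG this]
  have Ylc: "locally_compact_space Y" by (simp add: Y_def subtopology_subtopology flip: Int_assoc)
  define L where "L \<xi> = V (p \<xi>) \<inter> F" for \<xi>
  have Lsub: "L \<xi> \<subseteq> G \<inter> F" for \<xi> by (auto simp: L_def G_def)
  have L1: "openin Y (L \<xi>)" for \<xi>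
  proof -
    have "L \<xi> = V (p \<xi>) \<inter> (G \<inter> F)" by (auto simp: L_def G_def)
    then show ?thesis unfolding Y_def openin_subtopology using V(1)[OF p(1)] by blast
  qed
  have L2: "Lindelof_space (subtopology Y (L \<xi>))" for \<xi>
    unfolding Ysub[OF Lsub]
    by (intro second_countable_imp_Lindelof_space second_countable_subtopology_mono[OF V(3)[OF p(1)]])
      (auto simp: L_def)
  have L3: "(\<Union>\<xi>. L \<xi>) = topspace Y" unfolding Ytop by (auto simp: L_def G_def)
  have pY: "p \<alpha> \<in> topspace Y" for \<alpha> unfolding Ytop using V(2)[OF p(1)] p(1) by (auto simp: G_def)
  have few: "countable {\<alpha>\<in>UNIV. p \<alpha> \<in> L \<xi>}" for \<xi>
    by (rule countable_subset[OF _ countable_atMost_omega1[of \<xi>]])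
      (use p(2) in \<open>auto simp: L_def not_less[symmetric]\<close>)
  have discF: "countable D" if "D \<subseteq> topspace Y" "subtopology Y D = discrete_topology D"
      "|D| \<le>o |UNIV :: omega1 set|" for D
  proof (rule countable_relatively_discrete_in_closure[OF ax(1) X(1) fc U _ _ that(3)])
    show "D \<subseteq> X closure_of U" using that(1) unfolding Ytop F_def by auto
    show "subtopology X D = discrete_topology D" using that Ysub[of D] Ytop by simp
  qed
  have "club UNIV" unfolding club_def using omega1_no_greatest by auto
  then have st: "stationary UNIV" by (rule club_imp_stationary)
  from relatively_discrete_or_sequentially_compact[OF ax(3,4) T5_imp_Hausdorff[OF YT5] T5_imp_normal[OF YT5]
      Yfc Ylc L1 L2 L3 st pY few]
  show False
  proof (elim disjE exE conjE)
    fix E assume E: "stationary E" "subtopology Y (p ` E) = discrete_topology (p ` E)"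
    have "p ` E \<subseteq> topspace Y" using pY by auto
    then have "countable (p ` E)" by (rule discF[OF _ E(2) card_of_image_omega1])
    then have "countable E" using injp by (metis countable_image_inj_on inj_on_subset subset_UNIV)
    then show False using stationary_imp_uncountable[OF E(1)] by simp
  next
    fix D :: "omega1 set"
    define Z where "Z = subtopology Y (Y closure_of (p ` D))"
    assume "sequentially_compact_space (subtopology Y (Y closure_of (p ` D)))"
      "\<not> compact_space (subtopology Y (Y closure_of (p ` D)))"
    then have "has_uncountable_free_sequence Z"
      using ax(2) T5_subtopology[OF YT5] unfolding PPI_plus_def Z_def
      by (simp add: T5_imp_Hausdorff T5_imp_regular)
    then obtain z :: "omega1 \<Rightarrow> 'a" where z: "range z \<subseteq> topspace Z"
        "\<And>\<alpha>. disjnt (Z closure_of (z ` {..<\<alpha>})) (Z closure_of (z ` {\<alpha>..}))"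
      unfolding has_uncountable_free_sequence_def by auto
    note disc = free_sequence_imp_relatively_discrete[OF z]
    have zK: "range z \<subseteq> Y closure_of (p ` D)" using z(1) by (auto simp: Z_def)
    then have "subtopology Y (range z) = discrete_topology (range z)"
      using disc(2) by (simp add: Z_def subtopology_subtopology inf.absorb2)
    moreover have "range z \<subseteq> topspace Y" using z(1) by (auto simp: Z_def)
    ultimately have "countable (range z)" by (intro discF card_of_image_omega1)
    then show False using disc(1) uncountable_omega1 countable_image_inj_on by blast
  qed
qed

section \<open>Exhaustions of length \<open>\<omega>\<^sub>1\<close>\<close>

text \<open>
  The inclusion of closures makes the boundaries of the \<open>P \<alpha>\<close> pairwise disjoint. Continuity at
  limits is what makes pressing down applicable: an open set that meets \<open>P \<alpha>\<close> for a limit \<open>\<alpha>\<close>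
  already meets \<open>P \<beta>\<close> for some \<open>\<beta> < \<alpha>\<close>.
\<close>

definition exhaustion :: "'a topology \<Rightarrow> (omega1 \<Rightarrow> 'a set) \<Rightarrow> bool"
  where "exhaustion X P \<longleftrightarrow>
    (\<forall>\<alpha>. openin X (P \<alpha>) \<and> second_countable (subtopology X (P \<alpha>)) \<and> connectedin X (P \<alpha>)) \<and>
    (\<forall>\<alpha> \<beta>. \<alpha> < \<beta> \<longrightarrow> X closure_of (P \<alpha>) \<subseteq> P \<beta>) \<and>
    (\<forall>\<alpha>. limit_ord \<alpha> \<longrightarrow> P \<alpha> = (\<Union>\<beta><\<alpha>. P \<beta>)) \<and>
    (\<Union>\<alpha>. P \<alpha>) = topspace X"

lemma exhaustionD:
  assumes "exhaustion X P"
  shows "openin X (P \<alpha>)" "second_countable (subtopology X (P \<alpha>))" "connectedin X (P \<alpha>)"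
    "\<alpha> < \<beta> \<Longrightarrow> X closure_of (P \<alpha>) \<subseteq> P \<beta>"
    "limit_ord \<alpha> \<Longrightarrow> P \<alpha> = (\<Union>\<beta><\<alpha>. P \<beta>)"
    "(\<Union>\<alpha>. P \<alpha>) = topspace X"
  using assms unfolding exhaustion_def by simp_all

lemma exhaustion_mono:
  assumes "exhaustion X P" "\<alpha> \<le> \<beta>"
  shows "P \<alpha> \<subseteq> P \<beta>"
proof (cases "\<alpha> = \<beta>")
  case False
  then have "X closure_of (P \<alpha>) \<subseteq> P \<beta>" using exhaustionD(4)[OF assms(1)] assms(2) by simp
  then show ?thesis
    using closure_of_subset[OF openin_subset[OF exhaustionD(1)[OF assms(1)]]] by (rule subset_trans[rotated])
qed simp

lemma exhaustion_boundary_less: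
  assumes "exhaustion X P" "y \<in> X closure_of (P \<alpha>) - P \<alpha>" "y \<in> P \<xi>"
  shows "\<alpha> < \<xi>"
  using exhaustion_mono[OF assms(1), of \<xi> \<alpha>] assms(2,3) by (metis DiffD2 not_le subsetD)

text \<open>
  Countably many indices witness that \<open>z\<close> is in the closure, and they have an upper bound.
\<close>

lemma closure_of_omega1_chain:
  fixes P :: "omega1 \<Rightarrow> 'a set"
  assumes "first_countable X" "mono P" "z \<in> X closure_of (\<Union>\<alpha>. P \<alpha>)"
  shows "\<exists>\<alpha>. z \<in> X closure_of (P \<alpha>)"
proof -
  have z: "z \<in> topspace X" using assms(3) closure_of_subset_topspace by (metis subsetD)
  obtain B :: "nat \<Rightarrow> 'a set" where B: "\<And>n. openin X (B n)" "\<And>n. z \<in> B n" "decseq B"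
    "\<And>U. openin X U \<Longrightarrow> z \<in> U \<Longrightarrow> \<exists>n. B n \<subseteq> U"
    using first_countable_decreasing_base[OF assms(1) z] by metis
  have "\<exists>\<alpha>. B n \<inter> P \<alpha> \<noteq> {}" for n
  proof -
    have "B n \<inter> X closure_of (\<Union>\<alpha>. P \<alpha>) \<noteq> {}" using B(2) assms(3) by auto
    then have "B n \<inter> (\<Union>\<alpha>. P \<alpha>) \<noteq> {}" unfolding openin_Int_closure_of_eq_empty[OF B(1)] .
    then show ?thesis by auto
  qed
  then obtain \<alpha> where \<alpha>: "\<And>n. B n \<inter> P (\<alpha> n) \<noteq> {}" by metis
  obtain \<gamma> where \<gamma>: "\<forall>\<beta>\<in>range \<alpha>. \<beta> < \<gamma>" using countable_imp_bounded_omega1[of "range \<alpha>"] by auto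
  have "z \<in> X closure_of (P \<gamma>)"
    unfolding in_closure_of
  proof (intro conjI z allI impI)
    fix T assume T: "z \<in> T \<and> openin X T"
    then obtain n where n: "B n \<subseteq> T" using B(4) by metis
    have "P (\<alpha> n) \<subseteq> P \<gamma>" by (rule monoD[OF assms(2)]) (use \<gamma> in \<open>simp add: less_imp_le\<close>)
    then show "\<exists>y. y \<in> P \<gamma> \<and> y \<in> T" using \<alpha>[of n] n by blast
  qed
  then show ?thesis ..
qed

text \<open>
  A step passes from \<open>U\<close> to the component of a base point \<open>p0\<close> in a second countable open set containing
  the closure of \<open>U\<close>. Iterating it gives sets \<open>Q \<alpha>\<close>; the exhaustion consists of the unions
  \<open>P \<alpha>\<close> of the \<open>Q \<beta>\<close> with \<open>\<beta> < \<alpha>\<close>, so that continuity at limits is automatic. The union of all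
  of them is open and, by first countability, closed.
\<close>

theorem exhaustion_exists:
  assumes ax: "CW TYPE('a)" "PPI_plus TYPE('a)" "|UNIV :: omega1 set| <o bounding_number" P22
    and X: "T5_space (X :: 'a topology)" "locally_compact_space X" "locally_second_countable X"
    "locally_connected_space X" "connected_space X"
  shows "\<exists>P. exhaustion X P"
proof (cases "topspace X = {}")
  case True
  have "second_countable (subtopology X {})" 
    unfolding second_countable_def by (intro exI[of _ "{}"]) auto
  then have "exhaustion X (\<lambda>_. {})" by (auto simp: exhaustion_def True)
  then show ?thesis by blast
next
  case False
  then obtain p0 where p0: "p0 \<in> topspace X" by blast
  have fc: "first_countable X" using locally_second_countable_imp_first_countable X(3) by blast
  define good where "good U \<longleftrightarrow> openin X U \<and> second_countable (subtopology X U) \<and> connectedin X U \<and>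
      (U \<noteq> {} \<longrightarrow> p0 \<in> U)" for U
  have step: "\<exists>V. good V \<and> p0 \<in> V \<and> X closure_of U \<subseteq> V" if U: "good U" for U
  proof -
    obtain V1 where V1: "openin X V1" "second_countable (subtopology X V1)" "X closure_of U \<subseteq> V1"
      using closure_in_second_countable_open[OF ax X(1-3), of U] U unfolding good_def by blast
    obtain V2 where V2: "openin X V2" "p0 \<in> V2" "second_countable (subtopology X V2)"
      using X(3) p0 unfolding locally_second_countable_def by blast
    define V3 where "V3 = \<Union>{V1, V2}"
    have V3: "openin X V3" "p0 \<in> V3" "X closure_of U \<subseteq> V3"
      unfolding V3_def using V1 V2 by auto
    have V3c: "second_countable (subtopology X V3)"
      unfolding V3_def by (rule second_countable_subtopology_Union) (use V1 V2 in auto)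
    define V where "V = connected_component_of_set (subtopology X V3) p0"
    have "locally_connected_space (subtopology X V3)"
      using locally_connected_space_open_subset X(4) V3(1) by blast
    then have "openin (subtopology X V3) V" unfolding V_def
      by (simp add: openin_connected_component_of_locally_connected_space)
    then have Vo: "openin X V" "V \<subseteq> V3" using openin_open_subtopology[OF V3(1)] by blast+
    have pV: "p0 \<in> V" unfolding V_def using p0 V3(2) by (simp add: connected_component_of_refl)
    have "connectedin (subtopology X V3) V" unfolding V_def by (rule connectedin_connected_component_of)
    then have "connectedin X V" by (simp add: connectedin_subtopology)
    then have "good V" unfolding good_def
      using Vo pV second_countable_subtopology_mono[OF V3c] by simp
    moreover have "X closure_of U \<subseteq> V"
    proof (cases "U = {}")
      case False
      have con: "connectedin X (X closure_of U)" using U unfolding good_def by (simp add: connectedin_closure_of)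
      have "p0 \<in> U" using U False by (simp add: good_def)
      then have "p0 \<in> X closure_of U" using U unfolding good_def by (meson closure_of_subset openin_subset subsetD)
      moreover have "connectedin (subtopology X V3) (X closure_of U)"
        using con V3(3) by (simp add: connectedin_subtopology)
      ultimately show ?thesis unfolding V_def by (intro connected_component_of_maximal)
    qed simp
    ultimately show ?thesis using pV by blast
  qed
  define st where "st U = (SOME V. good V \<and> p0 \<in> V \<and> X closure_of U \<subseteq> V)" for U
  have st: "good (st U)" "p0 \<in> st U" "X closure_of U \<subseteq> st U" if "good U" for U
    using someI_ex[OF step[OF that]] unfolding st_def by simp_all
  have "\<exists>Q :: omega1 \<Rightarrow> 'a set. \<forall>\<alpha>. Q \<alpha> = st (\<Union>\<beta><\<alpha>. Q \<beta>)"
  proof (rule dependent_wf_choice[OF wf, where P = "\<lambda>Q \<alpha> r. r = st (\<Union>\<beta><\<alpha>. Q \<beta>)"])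
    fix Q R :: "omega1 \<Rightarrow> 'a set" and \<alpha> :: omega1 and r
    assume "\<And>\<beta>. (\<beta>, \<alpha>) \<in> {(x, y). x < y} \<Longrightarrow> Q \<beta> = R \<beta>"
    then have "(\<Union>\<beta><\<alpha>. Q \<beta>) = (\<Union>\<beta><\<alpha>. R \<beta>)" by simp
    then show "(r = st (\<Union>\<beta><\<alpha>. Q \<beta>)) = (r = st (\<Union>\<beta><\<alpha>. R \<beta>))" by simp
  qed simp
  then obtain Q :: "omega1 \<Rightarrow> 'a set" where Q: "\<And>\<alpha>. Q \<alpha> = st (\<Union>\<beta><\<alpha>. Q \<beta>)" by auto
  define P where "P \<alpha> = (\<Union>\<beta><\<alpha>. Q \<beta>)" for \<alpha>
  have QP: "Q \<alpha> = st (P \<alpha>)" for \<alpha> unfolding P_def by (rule Q)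
  have good: "good (P \<alpha>)" for \<alpha>
  proof (induction \<alpha> rule: less_induct)
    case (less \<alpha>)
    then have gQ: "good (Q \<beta>)" "p0 \<in> Q \<beta>" if "\<beta> < \<alpha>" for \<beta>
      using st[of "P \<beta>"] that unfolding QP by simp_all
    have "openin X (P \<alpha>)" unfolding P_def using gQ(1) by (auto simp: good_def)
    moreover have "second_countable (subtopology X (P \<alpha>))"
      unfolding P_def
      by (rule second_countable_subtopology_Union)
        (use gQ(1) countable_lessThan_omega1 in \<open>auto simp: good_def\<close>)
    moreover have "connectedin X (P \<alpha>)"
    proof (cases "\<exists>\<beta>. \<beta> < \<alpha>")
      case True
      have "p0 \<in> \<Inter>(Q ` {..<\<alpha>})" using gQ(2) by simp
      then have "\<Inter>(Q ` {..<\<alpha>}) \<noteq> {}" by blast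
      then show ?thesis unfolding P_def
        by (intro connectedin_Union) (use gQ(1) in \<open>auto simp: good_def\<close>)
    next
      case False
      then have "P \<alpha> = {}" by (auto simp: P_def)
      then show ?thesis by simp
    qed
    moreover have "p0 \<in> P \<alpha>" if "P \<alpha> \<noteq> {}" using that gQ(2) by (auto simp: P_def)
    ultimately show ?case by (simp add: good_def)
  qed
  have clP: "X closure_of (P \<alpha>) \<subseteq> Q \<alpha>" for \<alpha> unfolding QP by (rule st(3)[OF good])
  have Psub: "P \<alpha> \<subseteq> X closure_of (P \<alpha>)" for \<alpha>
    using good[of \<alpha>] unfolding good_def by (meson closure_of_subset openin_subset)
  have QsubP: "Q \<alpha> \<subseteq> P \<beta>" if "\<alpha> < \<beta>" for \<alpha> \<beta> using that by (auto simp: P_def)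
  have mono: "mono P"
  proof (rule monoI)
    fix \<alpha> \<beta> :: omega1 assume "\<alpha> \<le> \<beta>"
    then have "{..<\<alpha>} \<subseteq> {..<\<beta>}" by auto
    then show "P \<alpha> \<subseteq> P \<beta>" unfolding P_def by (rule UN_mono) simp
  qed
  have PQ: "(\<Union>\<alpha>. P \<alpha>) = topspace X"
  proof -
    have "openin X (\<Union>\<alpha>. P \<alpha>)" using good by (auto simp: good_def)
    moreover have "closedin X (\<Union>\<alpha>. P \<alpha>)"
    proof -
      have "X closure_of (\<Union>\<alpha>. P \<alpha>) \<subseteq> (\<Union>\<alpha>. P \<alpha>)"
      proof
        fix z assume "z \<in> X closure_of (\<Union>\<alpha>. P \<alpha>)"
        from closure_of_omega1_chain[OF fc mono this] obtain \<alpha> where "z \<in> X closure_of (P \<alpha>)" ..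
        moreover obtain \<beta> where "\<alpha> < \<beta>" using omega1_no_greatest by blast
        ultimately show "z \<in> (\<Union>\<alpha>. P \<alpha>)" using clP[of \<alpha>] QsubP[of \<alpha> \<beta>] by blast
      qed
      moreover have "(\<Union>\<alpha>. P \<alpha>) \<subseteq> topspace X" using \<open>openin X (\<Union>\<alpha>. P \<alpha>)\<close> by (rule openin_subset)
      ultimately show ?thesis using closure_of_subset_eq[of "\<Union>\<alpha>. P \<alpha>" X] by blast
    qed
    moreover have "p0 \<in> (\<Union>\<alpha>. P \<alpha>)"
    proof -
      obtain \<alpha> \<beta> :: omega1 where "\<alpha> < \<beta>" using omega1_no_greatest by blast
      then show ?thesis using QsubP[of \<alpha> \<beta>] st(2)[OF good[of \<alpha>]] unfolding QP by blast
    qed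
    ultimately show ?thesis using X(5) unfolding connected_space_clopen_in by blast
  qed
  have "exhaustion X P"
    unfolding exhaustion_def
  proof (intro conjI allI impI)
    show "openin X (P \<alpha>)" "second_countable (subtopology X (P \<alpha>))" "connectedin X (P \<alpha>)" for \<alpha>
      using good[of \<alpha>] by (simp_all add: good_def)
    show "X closure_of (P \<alpha>) \<subseteq> P \<beta>" if "\<alpha> < \<beta>" for \<alpha> \<beta>
      using clP[of \<alpha>] QsubP[OF that] by blast
    show "P \<alpha> = (\<Union>\<beta><\<alpha>. P \<beta>)" if lim: "limit_ord \<alpha>" for \<alpha>
    proof
      show "P \<alpha> \<subseteq> (\<Union>\<beta><\<alpha>. P \<beta>)"
      proof
        fix z assume "z \<in> P \<alpha>"
        then obtain \<beta> where "\<beta> < \<alpha>" "z \<in> Q \<beta>" by (auto simp: P_def)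
        moreover obtain \<gamma> where "\<beta> < \<gamma>" "\<gamma> < \<alpha>" using lim \<open>\<beta> < \<alpha>\<close> by (auto simp: limit_ord_def)
        ultimately show "z \<in> (\<Union>\<beta><\<alpha>. P \<beta>)" using QsubP[of \<beta> \<gamma>] by blast
      qed
      show "(\<Union>\<beta><\<alpha>. P \<beta>) \<subseteq> P \<alpha>" by (intro UN_least monoD[OF mono]) simp
    qed
  qed (rule PQ)
  then show ?thesis by blast
qed

text \<open>
  Disjoint neighbourhoods of the points \<open>y \<alpha>\<close> would meet \<open>P \<alpha>\<close>, hence \<open>P (f \<alpha>)\<close> for some
  \<open>f \<alpha> < \<alpha>\<close> at limits \<open>\<alpha>\<close>. By pressing down, uncountably many disjoint open sets would meet one
  second countable set \<open>P \<beta>\<close>.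
\<close>

lemma boundary_selection_not_relatively_discrete:
  assumes CW: "CW TYPE('a)" and X: "T5_space (X :: 'a topology)" "locally_second_countable X"
    and P: "exhaustion X P"
    and E: "stationary E" "\<And>\<alpha>. \<alpha> \<in> E \<Longrightarrow> y \<alpha> \<in> X closure_of (P \<alpha>) - P \<alpha>"
  shows "subtopology X (y ` E) \<noteq> discrete_topology (y ` E)"
proof
  assume disc: "subtopology X (y ` E) = discrete_topology (y ` E)"
  have fc: "first_countable X" using locally_second_countable_imp_first_countable X(2) by blast
  have yX: "y ` E \<subseteq> topspace X" using E(2) closure_of_subset_topspace[of X] by blast
  have inj: "inj_on y E"
  proof (rule inj_onI, rule ccontr)
    have *: False if "\<alpha> < \<beta>" "\<alpha> \<in> E" "\<beta> \<in> E" "y \<alpha> = y \<beta>" for \<alpha> \<beta>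
      using exhaustionD(4)[OF P that(1)] E(2)[OF that(2)] E(2)[OF that(3)] that(4) by auto
    fix \<alpha> \<beta> assume "\<alpha> \<in> E" "\<beta> \<in> E" "y \<alpha> = y \<beta>" "\<alpha> \<noteq> \<beta>"
    then show False using *[of \<alpha> \<beta>] *[of \<beta> \<alpha>] by (metis linorder_neqE)
  qed
  obtain U where U: "\<And>d. d \<in> y ` E \<Longrightarrow> openin X (U d)" "\<And>d. d \<in> y ` E \<Longrightarrow> d \<in> U d"
      "disjoint_family_on U (y ` E)"
    using relatively_discrete_imp_separated[OF CW X(1) fc yX disc card_of_image_omega1] by metis
  define E' where "E' = E \<inter> {\<alpha>. limit_ord \<alpha>}"
  have E': "stationary E'" unfolding E'_def by (rule stationary_Int_club[OF E(1) club_limit_ord])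
  have "\<exists>\<beta><\<alpha>. U (y \<alpha>) \<inter> P \<beta> \<noteq> {}" if \<alpha>: "\<alpha> \<in> E'" for \<alpha>
  proof -
    have \<alpha>E: "\<alpha> \<in> E" "limit_ord \<alpha>" using \<alpha> by (auto simp: E'_def)
    have "U (y \<alpha>) \<inter> X closure_of (P \<alpha>) \<noteq> {}" using U(2)[of "y \<alpha>"] E(2)[OF \<alpha>E(1)] \<alpha>E(1) by auto
    then have "U (y \<alpha>) \<inter> P \<alpha> \<noteq> {}"
      unfolding openin_Int_closure_of_eq_empty[OF U(1)[OF imageI[OF \<alpha>E(1)]]] .
    then show ?thesis unfolding exhaustionD(5)[OF P \<alpha>E(2)] by auto
  qed
  then obtain f where f: "\<And>\<alpha>. \<alpha> \<in> E' \<Longrightarrow> f \<alpha> < \<alpha>" "\<And>\<alpha>. \<alpha> \<in> E' \<Longrightarrow> U (y \<alpha>) \<inter> P (f \<alpha>) \<noteq> {}" by metis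
  obtain \<beta> where \<beta>: "stationary {\<alpha>\<in>E'. f \<alpha> = \<beta>}" using pressing_down[OF E' f(1)] by metis
  let ?E = "{\<alpha>\<in>E'. f \<alpha> = \<beta>}"
  have sub: "?E \<subseteq> E" by (auto simp: E'_def)
  have "countable (y ` ?E)"
  proof (rule countable_disjoint_open_meeting_second_countable[OF exhaustionD(1,2)[OF P], where V = U])
    fix d assume d: "d \<in> y ` ?E"
    then show "openin X (U d)" using U(1) sub by blast
    show "U d \<inter> P \<beta> \<noteq> {}" using d f(2) by auto
  next
    show "disjoint_family_on U (y ` ?E)"
      using U(3) sub by (meson disjoint_family_on_mono image_mono)
  qed
  then have "countable ?E" using inj_on_subset[OF inj sub] countable_image_inj_on by blast
  then show False using stationary_imp_uncountable[OF \<beta>] by simp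
qed

lemma sequentially_compact_imp_closedin:
  assumes "Hausdorff_space X" "first_countable X" "K \<subseteq> topspace X"
    and K: "sequentially_compact_space (subtopology X K)"
  shows "closedin X K"
proof -
  have "X closure_of K \<subseteq> K"
  proof
    fix z assume z: "z \<in> X closure_of K"
    then have zX: "z \<in> topspace X" using closure_of_subset_topspace by (metis subsetD)
    obtain B :: "nat \<Rightarrow> 'a set" where B: "\<And>n. openin X (B n)" "\<And>n. z \<in> B n" "decseq B"
      "\<And>U. openin X U \<Longrightarrow> z \<in> U \<Longrightarrow> \<exists>n. B n \<subseteq> U"
      using first_countable_decreasing_base[OF assms(2) zX] by metis
    have "\<exists>s. s \<in> B n \<inter> K" for n
    proof -
      have "B n \<inter> X closure_of K \<noteq> {}" using B(2) z by auto
      then have "B n \<inter> K \<noteq> {}" unfolding openin_Int_closure_of_eq_empty[OF B(1)] .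
      then show ?thesis by auto
    qed
    then obtain s where s: "\<And>n. s n \<in> B n \<inter> K" by metis
    have lim: "limitin X s z sequentially"
      unfolding limitin_sequentially
    proof (intro conjI zX allI impI)
      fix U assume "openin X U \<and> z \<in> U"
      then obtain n where n: "B n \<subseteq> U" using B(4) by metis
      have "s k \<in> U" if "n \<le> k" for k using s[of k] n decseqD[OF B(3) that] by auto
      then show "\<exists>N. \<forall>k\<ge>N. s k \<in> U" by blast
    qed
    have "range s \<subseteq> topspace (subtopology X K)" using s assms(3) by auto
    then obtain l r where lr: "strict_mono r" "limitin (subtopology X K) (s \<circ> r) l sequentially"
      using K unfolding sequentially_compact_space_def by blast
    then have "limitin X (s \<circ> r) l sequentially" "l \<in> K" by (simp_all add: limitin_subtopology)
    moreover have "limitin X (s \<circ> r) z sequentially" using limitin_subsequence[OF lr(1) lim] .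
    ultimately show "z \<in> K"
      using limitin_Hausdorff_unique[OF _ _ _ assms(1)] by (metis trivial_limit_sequentially)
  qed
  then show ?thesis using assms(3) closure_of_subset_eq[of K X] by blast
qed

text \<open>
  The dichotomy in the open subspace \<open>G\<close>, with its first alternative excluded by
  \<open>boundary_selection_not_relatively_discrete\<close>. It is used with \<open>G\<close> the whole space and with \<open>G\<close> the complement of a copy of \<open>\<omega>\<^sub>1\<close>. The set \<open>K\<close> is
  the closure in \<open>G\<close>; being sequentially compact it is closed in the whole space as well, so in
  the second use it stays away from the copy.
\<close>

theorem boundary_selection_sequentially_compact:
  assumes ax: "CW TYPE('a)" "|UNIV :: omega1 set| <o bounding_number" P22
    and X: "T5_space (X :: 'a topology)" "locally_compact_space X" "locally_second_countable X"
    and P: "exhaustion X P" and G: "openin X G"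
    and B: "stationary B" "\<And>\<alpha>. \<alpha> \<in> B \<Longrightarrow> y \<alpha> \<in> X closure_of (P \<alpha>) - P \<alpha>" "\<And>\<alpha>. \<alpha> \<in> B \<Longrightarrow> y \<alpha> \<in> G"
  obtains D K where "D \<subseteq> B" "stationary D" "y ` D \<subseteq> K" "K \<subseteq> X closure_of (y ` D)" "K \<subseteq> G" "closedin X K"
    "sequentially_compact_space (subtopology X K)" "\<not> compact_space (subtopology X K)"
proof -
  have fc: "first_countable X" using locally_second_countable_imp_first_countable X(3) by blast
  define Y where "Y = subtopology X G"
  have Ytop: "topspace Y = G" using openin_subset[OF G] by (auto simp: Y_def)
  have YT5: "T5_space Y" unfolding Y_def by (rule T5_subtopology[OF X(1)])
  have Yfc: "first_countable Y" unfolding Y_def by (rule first_countable_subtopology[OF fc])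
  have Ylc: "locally_compact_space Y" unfolding Y_def
    using locally_compact_space_open_subset X(1,2) G T5_imp_Hausdorff by blast
  have Ysub: "subtopology Y S = subtopology X S" if "S \<subseteq> G" for S
    using that unfolding Y_def subtopology_subtopology by (simp add: inf.absorb2)
  define L where "L \<xi> = P \<xi> \<inter> G" for \<xi>
  have L1: "openin Y (L \<xi>)" for \<xi>
    unfolding Y_def L_def openin_open_subtopology[OF G] using exhaustionD(1)[OF P] G by (simp add: openin_Int)
  have L2: "Lindelof_space (subtopology Y (L \<xi>))" for \<xi>
  proof -
    have "subtopology Y (L \<xi>) = subtopology X (L \<xi>)" by (rule Ysub) (simp add: L_def)
    then show ?thesis
      using second_countable_subtopology_mono[OF exhaustionD(2)[OF P], of "L \<xi>" \<xi>]
      by (simp add: second_countable_imp_Lindelof_space L_def)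
  qed
  have L3: "(\<Union>\<xi>. L \<xi>) = topspace Y"
    unfolding Ytop L_def using exhaustionD(6)[OF P] openin_subset[OF G] by blast
  have yY: "y \<alpha> \<in> topspace Y" if "\<alpha> \<in> B" for \<alpha> using B(3)[OF that] by (simp add: Ytop)
  have few: "countable {\<alpha>\<in>B. y \<alpha> \<in> L \<xi>}" for \<xi>
    by (rule countable_subset[OF _ countable_lessThan_omega1[of \<xi>]])
      (use exhaustion_boundary_less[OF P B(2)] in \<open>auto simp: L_def\<close>)
  have "(\<exists>E\<subseteq>B. stationary E \<and> subtopology Y (y ` E) = discrete_topology (y ` E)) \<or>
    (\<exists>D\<subseteq>B. stationary D \<and> sequentially_compact_space (subtopology Y (Y closure_of (y ` D))) \<and>
       \<not> compact_space (subtopology Y (Y closure_of (y ` D))))"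
    by (rule relatively_discrete_or_sequentially_compact[OF ax(2,3) T5_imp_Hausdorff[OF YT5]
        T5_imp_normal[OF YT5] Yfc Ylc L1 L2 L3 B(1) _ few]) (rule yY)
  then show thesis
  proof (elim disjE exE conjE)
    fix E assume E: "E \<subseteq> B" "stationary E" "subtopology Y (y ` E) = discrete_topology (y ` E)"
    have "y ` E \<subseteq> G" using B(3) E(1) by auto
    then have "subtopology X (y ` E) = discrete_topology (y ` E)"
      using Ysub[of "y ` E"] E(3) by simp
    moreover have "subtopology X (y ` E) \<noteq> discrete_topology (y ` E)"
      by (rule boundary_selection_not_relatively_discrete[OF ax(1) X(1,3) P E(2)]) (use B(2) E(1) in blast)
    ultimately show thesis by simp
  next
    fix D
    define K where "K = Y closure_of (y ` D)"
    assume D: "D \<subseteq> B" "stationary D" "sequentially_compact_space (subtopology Y (Y closure_of (y ` D)))"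
      "\<not> compact_space (subtopology Y (Y closure_of (y ` D)))"
    have yD: "y ` D \<subseteq> topspace Y" using yY D(1) by auto
    have KG: "K \<subseteq> G" unfolding K_def using closure_of_subset_topspace Ytop by metis
    have K: "sequentially_compact_space (subtopology X K)" "\<not> compact_space (subtopology X K)"
      using D(3,4) Ysub[OF KG] by (simp_all add: K_def)
    have "K \<subseteq> topspace X" using KG openin_subset[OF G] by blast
    then have "closedin X K" by (rule sequentially_compact_imp_closedin[OF T5_imp_Hausdorff[OF X(1)] fc _ K(1)])
    moreover have "K \<subseteq> X closure_of (y ` D)"
      unfolding K_def Y_def closure_of_subtopology by (meson Int_lower2 closure_of_mono inf_le2 le_infI2 order_trans)
    moreover have "y ` D \<subseteq> K" unfolding K_def by (rule closure_of_subset[OF yD])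
    ultimately show thesis using that[OF D(1,2) _ _ KG _ K] by blast
  qed
qed

section \<open>Copies of \<open>\<omega>\<^sub>1\<close>\<close>

lemma contains_copy_imp_embedding:
  assumes "contains_copy_of_omega1 X"
  shows "\<exists>w. embedding_map (euclidean :: omega1 topology) X w"
proof -
  obtain S where S: "S \<subseteq> topspace X" "subtopology X S homeomorphic_space (euclidean :: omega1 topology)"
    using assms unfolding contains_copy_of_omega1_def by auto
  have top: "topspace (subtopology X S) = S" using S(1) by auto
  obtain w where w: "homeomorphic_map (euclidean :: omega1 topology) (subtopology X S) w"
    using S(2) homeomorphic_space homeomorphic_space_sym by blast
  have "w ` UNIV = S" using homeomorphic_imp_surjective_map[OF w] top by simp
  then have "embedding_map euclidean X w" using w unfolding embedding_map_def by simp
  then show ?thesis by blast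
qed

lemma embedding_omega1D:
  assumes "embedding_map (euclidean :: omega1 topology) X w"
  shows "continuous_map euclidean X w" "inj w" "range w \<subseteq> topspace X"
    "open A \<Longrightarrow> \<exists>T. openin X T \<and> T \<inter> range w = w ` A"
proof -
  have hm: "homeomorphic_map euclidean (subtopology X (range w)) w"
    using assms by (simp add: embedding_map_def)
  show cont: "continuous_map euclidean X w"
    using homeomorphic_imp_continuous_map[OF hm] continuous_map_in_subtopology by blast
  show "inj w" using homeomorphic_imp_injective_map[OF hm] by simp
  show "range w \<subseteq> topspace X" using continuous_map_image_subset_topspace[OF cont] by simp
  assume "open A"
  then have "openin euclidean A" by simp
  then have "openin (subtopology X (range w)) (w ` A)"
    using homeomorphic_imp_open_map[OF hm] unfolding open_map_def by blast
  then obtain T where "openin X T \<and> w ` A = T \<inter> range w" unfolding openin_subtopology ..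
  then show "\<exists>T. openin X T \<and> T \<inter> range w = w ` A" by (intro exI[of _ T]) simp
qed

lemma compactin_omega1_segment:
  assumes "embedding_map (euclidean :: omega1 topology) X w"
  shows "compactin X (w ` {..\<delta>})"
  using image_compactin[OF _ embedding_omega1D(1)[OF assms]] compact_atMost_omega1[of \<delta>] by simp

text \<open>
  By first countability a point in the closure of \<open>w ` C\<close> is in the closure of \<open>w ` (C \<inter> {..\<delta>})\<close> for
  some \<open>\<delta>\<close>, and that set is compact.
\<close>

lemma closedin_omega1_image:
  assumes X: "Hausdorff_space X" "first_countable X"
    and w: "embedding_map (euclidean :: omega1 topology) X w" and "closed C"
  shows "closedin X (w ` C)"
proof -
  have seg: "closedin X (w ` (C \<inter> {..\<delta>}))" for \<delta>
  proof (rule compactin_imp_closedin[OF X(1)])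
    have "compact (C \<inter> {..\<delta>})" using compact_atMost_omega1 \<open>closed C\<close> by (rule closed_Int_compact[rotated])
    then show "compactin X (w ` (C \<inter> {..\<delta>}))"
      using image_compactin[OF _ embedding_omega1D(1)[OF w]] by simp
  qed
  have "X closure_of (w ` C) \<subseteq> w ` C"
  proof
    fix z assume z: "z \<in> X closure_of (w ` C)"
    have "(\<Union>\<delta>. w ` (C \<inter> {..\<delta>})) = w ` C" by auto
    moreover have "mono (\<lambda>\<delta>. w ` (C \<inter> {..\<delta>}))" by (rule monoI) auto
    ultimately obtain \<delta> where "z \<in> X closure_of (w ` (C \<inter> {..\<delta>}))"
      using closure_of_omega1_chain[OF X(2), of "\<lambda>\<delta>. w ` (C \<inter> {..\<delta>})" z] z by auto
    then show "z \<in> w ` C" unfolding closure_of_closedin[OF seg] by auto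
  qed
  moreover have "w ` C \<subseteq> topspace X" using embedding_omega1D(3)[OF w] by auto
  ultimately show ?thesis using closure_of_subset_eq[of "w ` C" X] by blast
qed

lemma omega1_neighbourhood:
  assumes w: "embedding_map (euclidean :: omega1 topology) X w"
    and "openin X U" "w \<alpha> \<in> U" "limit_ord \<alpha>"
  shows "\<exists>\<beta><\<alpha>. w ` {\<beta><..\<alpha>} \<subseteq> U"
proof -
  have "open {\<gamma>. w \<gamma> \<in> U}"
    using openin_continuous_map_preimage[OF embedding_omega1D(1)[OF w] assms(2)] by simp
  moreover have "\<alpha> \<in> {\<gamma>. w \<gamma> \<in> U}" using assms(3) by simp
  moreover obtain \<beta> where "\<beta> < \<alpha>" using assms(4) by (auto simp: limit_ord_def)
  ultimately have "\<exists>b<\<alpha>. {b<..\<alpha>} \<subseteq> {\<gamma>. w \<gamma> \<in> U}" by (rule open_left)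
  then show ?thesis by auto
qed

text \<open>
  Remove from \<open>X\<close> the points \<open>w \<xi>\<close> with \<open>\<xi>\<close> not isolated in \<open>\<omega>\<^sub>1\<close>. In the remaining normal open
  subspace \<open>Z\<close> the uncountable set of all other \<open>w \<xi>\<close> is closed and discrete, so it has a discrete
  open expansion. Let \<open>B \<xi>\<close> be connected neighbourhoods of \<open>w \<xi>\<close> inside this expansion. Each contains
  a point \<open>z \<xi>\<close> with \<open>f (z \<xi>) \<noteq> 0\<close>, and for uncountably many \<open>\<xi>\<close> the value exceeds one fixed
  \<open>1/(n+1)\<close> in modulus. Let \<open>\<delta>\<close> bound infinitely many of these. The compact segment
  \<open>w ` {..\<delta>}\<close> has an open relatively compact neighbourhood \<open>N\<close> whose closure avoids the rest of the copy and
  all points where \<open>\<bar>f\<bar> \<ge> 1/(n+1)\<close>. Infinitely many of the connected sets \<open>B \<xi>\<close> then cross the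
  frontier of \<open>N\<close>, which is a compact subset of \<open>Z\<close>. This contradicts discreteness.
\<close>

theorem no_omega1_in_zero_set_boundary:
  assumes CW: "CW TYPE('a)" and X: "T5_space (X :: 'a topology)" "first_countable X"
    "locally_compact_space X" "locally_connected_space X"
    and w: "embedding_map (euclidean :: omega1 topology) X w"
    and f: "continuous_map X euclideanreal f" "\<And>\<xi>. f (w \<xi>) = 0"
    and cl: "range w \<subseteq> X closure_of {x \<in> topspace X. f x \<noteq> 0}"
  shows False
proof -
  have Haus: "Hausdorff_space X" by (rule T5_imp_Hausdorff[OF X(1)])
  define I where "I = {\<xi> :: omega1. open {\<xi>}}"
  have "open I"
  proof -
    have "I = (\<Union>\<xi>\<in>I. {\<xi>})" by auto
    moreover have "open (\<Union>\<xi>\<in>I. {\<xi>})" by (rule open_UN) (simp add: I_def)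
    ultimately show ?thesis by simp
  qed
  note w' = embedding_omega1D[OF w]
  have clI: "closedin X (w ` (- I))"
    using closedin_omega1_image[OF Haus X(2) w] \<open>open I\<close> by (simp add: closed_Compl)
  define Z where "Z = topspace X - w ` (- I)"
  have Z: "openin X Z" unfolding Z_def using clI by blast
  have Ztop: "topspace (subtopology X Z) = Z" using openin_subset[OF Z] by auto
  have "range w \<inter> Z = w ` I" using w'(2,3) by (auto simp: Z_def inj_def)
  moreover have "closedin X (range w)" using closedin_omega1_image[OF Haus X(2) w closed_UNIV] .
  ultimately have clA: "closedin (subtopology X Z) (w ` I)"
    using closedin_subtopology by metis
  have disc: "subtopology X (w ` I) = discrete_topology (w ` I)"
  proof -
    have "openin (subtopology X (w ` I)) {x}" if x: "x \<in> w ` I" for x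
    proof -
      obtain \<xi> where \<xi>: "\<xi> \<in> I" "x = w \<xi>" using x by auto
      have op: "open {\<xi>}" using \<xi>(1) by (simp add: I_def)
      obtain T where T: "openin X T" "T \<inter> range w = w ` {\<xi>}" using w'(4)[OF op] by auto
      have "{x} = T \<inter> w ` I" using T(2) \<xi> by auto
      then show ?thesis unfolding openin_subtopology using T(1) by blast
    qed
    moreover have "topspace (subtopology X (w ` I)) = w ` I" using w'(3) by auto
    ultimately show ?thesis using discrete_topology_unique[of "w ` I" "subtopology X (w ` I)"] by auto
  qed
  have wIX: "w ` I \<subseteq> topspace X" using w'(3) by auto
  obtain U where U: "\<And>d. d \<in> w ` I \<Longrightarrow> openin X (U d)" "\<And>d. d \<in> w ` I \<Longrightarrow> d \<in> U d"
      "disjoint_family_on U (w ` I)"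
    using relatively_discrete_imp_separated[OF CW X(1,2) wIX disc card_of_image_omega1] by metis
  have "openin (subtopology X Z) (Z \<inter> (\<Union>d\<in>w ` I. U d))"
    using U(1) by (intro openin_subtopology_Int2 openin_Union) auto
  moreover have "w ` I \<subseteq> Z \<inter> (\<Union>d\<in>w ` I. U d)" using U(2) closedin_subset[OF clA] Ztop by blast
  ultimately have "\<exists>G. openin (subtopology X Z) G \<and> w ` I \<subseteq> G \<and>
      subtopology X Z closure_of G \<subseteq> Z \<inter> (\<Union>d\<in>w ` I. U d)"
    by (intro T5_shrinking[OF T5_subtopology[OF X(1)] clA])
  then obtain G where G: "openin (subtopology X Z) G" "w ` I \<subseteq> G"
      "subtopology X Z closure_of G \<subseteq> Z \<inter> (\<Union>d\<in>w ` I. U d)" by auto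
  have GX: "openin X G" "G \<subseteq> Z" using G(1) openin_open_subtopology[OF Z] by auto
  \<comment> \<open>the traces of \<open>G\<close> on the \<open>U d\<close> form a discrete family in \<open>Z\<close>\<close>
  have "\<exists>B. openin X B \<and> connectedin X B \<and> w \<xi> \<in> B \<and> B \<subseteq> U (w \<xi>) \<inter> G" if "\<xi> \<in> I" for \<xi>
  proof -
    have "openin X (U (w \<xi>) \<inter> G)" "w \<xi> \<in> U (w \<xi>) \<inter> G" using that U(1,2) GX(1) G(2) by auto
    moreover have "neighbourhood_base_of (\<lambda>B. openin X B \<and> connectedin X B) X"
      using X(4) by (simp add: locally_connected_space_alt)
    ultimately show ?thesis
      unfolding neighbourhood_base_of by (metis (no_types, lifting) subset_trans subsetD)
  qed
  then obtain B where B: "\<And>\<xi>. \<xi> \<in> I \<Longrightarrow> openin X (B \<xi>)" "\<And>\<xi>. \<xi> \<in> I \<Longrightarrow> connectedin X (B \<xi>)"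
      "\<And>\<xi>. \<xi> \<in> I \<Longrightarrow> w \<xi> \<in> B \<xi>" "\<And>\<xi>. \<xi> \<in> I \<Longrightarrow> B \<xi> \<subseteq> U (w \<xi>) \<inter> G"
    by metis
  have "\<exists>z. z \<in> B \<xi> \<and> f z \<noteq> 0" if "\<xi> \<in> I" for \<xi>
  proof -
    have "B \<xi> \<inter> X closure_of {x \<in> topspace X. f x \<noteq> 0} \<noteq> {}" using cl B(3)[OF that] by auto
    then have "B \<xi> \<inter> {x \<in> topspace X. f x \<noteq> 0} \<noteq> {}" unfolding openin_Int_closure_of_eq_empty[OF B(1)[OF that]] .
    then show ?thesis by auto
  qed
  then obtain z where z: "\<And>\<xi>. \<xi> \<in> I \<Longrightarrow> z \<xi> \<in> B \<xi>" "\<And>\<xi>. \<xi> \<in> I \<Longrightarrow> f (z \<xi>) \<noteq> 0" by metis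
  define J where "J n = {\<xi>\<in>I. \<bar>f (z \<xi>)\<bar> > inverse (real (Suc n))}" for n
  have "I = (\<Union>n. J n)"
  proof -
    have "\<exists>n. \<bar>f (z \<xi>)\<bar> > inverse (real (Suc n))" if "\<xi> \<in> I" for \<xi>
      using z(2)[OF that] reals_Archimedean[of "\<bar>f (z \<xi>)\<bar>"] by auto
    then show ?thesis by (auto simp: J_def)
  qed
  moreover have "uncountable I" unfolding I_def by (rule uncountable_isolated_omega1)
  ultimately obtain n where n: "uncountable (J n)" by auto
  then have "infinite (J n)" using countable_finite by blast
  then obtain a where a: "a \<subseteq> J n" "infinite a" "countable a"
    using infinite_countable_subset' by blast
  obtain \<delta> where \<delta>: "\<forall>\<alpha>\<in>a. \<alpha> < \<delta>" using countable_imp_bounded_omega1[OF a(3)] by auto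
  define K1 where "K1 = w ` {\<delta><..} \<union> {x \<in> topspace X. \<bar>f x\<bar> \<ge> inverse (real (Suc n))}"
  have "closedin X {x \<in> topspace X. \<bar>f x\<bar> \<ge> inverse (real (Suc n))}"
  proof -
    have "closedin X {x \<in> topspace X. f x \<in> {t. \<bar>t\<bar> \<ge> inverse (real (Suc n))}}"
      by (rule closedin_continuous_map_preimage[OF f(1)])
        (auto intro!: closed_Collect_le continuous_intros)
    then show ?thesis by simp
  qed
  then have K1: "closedin X K1"
    unfolding K1_def by (intro closedin_Un closedin_omega1_image[OF Haus X(2) w] closed_greaterThan_omega1)
  have K01: "w ` {..\<delta>} \<inter> K1 = {}" by (auto simp: K1_def f(2) inj_eq[OF w'(2)])
  obtain N0 L0 where N0: "openin X N0" "compactin X L0" "w ` {..\<delta>} \<subseteq> N0" "N0 \<subseteq> L0"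
    using locally_compact_space_compact_closed_compact[of X] Haus X(3) compactin_omega1_segment[OF w, of \<delta>] by blast
  have "openin X (N0 - K1)" using N0(1) K1 by blast
  moreover have "closedin X (w ` {..\<delta>})" using compactin_imp_closedin[OF Haus compactin_omega1_segment[OF w]] .
  moreover have "w ` {..\<delta>} \<subseteq> N0 - K1" using K01 N0(3) by blast
  ultimately have "\<exists>N. openin X N \<and> w ` {..\<delta>} \<subseteq> N \<and> X closure_of N \<subseteq> N0 - K1"
    by (intro T5_shrinking[OF X(1)])
  then obtain N where N: "openin X N" "w ` {..\<delta>} \<subseteq> N" "X closure_of N \<subseteq> N0 - K1" by auto
  define Fr where "Fr = X frontier_of N"
  have Fr: "Fr \<subseteq> X closure_of N" "Fr \<inter> N = {}" "closedin X Fr"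
    using frontier_of_openin[OF N(1)] closedin_frontier_of[of X N] by (auto simp: Fr_def)
  have Frc: "compactin X Fr" using closed_compactin[OF N0(2) _ Fr(3)] Fr(1) N(3) N0(4) by blast
  have FrW: "Fr \<inter> range w = {}"
  proof -
    have "{..\<delta>} \<union> {\<delta><..} = UNIV" by auto
    then have "range w \<subseteq> w ` {..\<delta>} \<union> w ` {\<delta><..}" by (simp flip: image_Un)
    then have "range w \<subseteq> N \<union> K1" using N(2) by (auto simp: K1_def)
    then show ?thesis using Fr(1,2) N(3) by blast
  qed
  have "\<exists>T. openin X T \<and> p \<in> T \<and> finite {\<xi>\<in>I. B \<xi> \<inter> T \<noteq> {}}" if p: "p \<in> Fr" for p
  proof (cases "p \<in> (\<Union>d\<in>w ` I. U d)")
    case True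
    then obtain \<eta> where \<eta>: "\<eta> \<in> I" "p \<in> U (w \<eta>)" by auto
    have "{\<xi>\<in>I. B \<xi> \<inter> U (w \<eta>) \<noteq> {}} \<subseteq> {\<eta>}"
    proof clarify
      fix \<xi> assume \<xi>: "\<xi> \<in> I" "\<xi> \<notin> {}" "B \<xi> \<inter> U (w \<eta>) \<noteq> {}"
      then have "U (w \<xi>) \<inter> U (w \<eta>) \<noteq> {}" using B(4)[OF \<xi>(1)] by blast
      then have "w \<xi> = w \<eta>" using disjoint_family_onD[OF U(3)] \<xi>(1) \<eta>(1) by blast
      then show "\<xi> = \<eta>" using w'(2) by (simp add: inj_eq)
    qed
    then have "finite {\<xi>\<in>I. B \<xi> \<inter> U (w \<eta>) \<noteq> {}}" by (rule finite_subset) simp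
    then show ?thesis using U(1) \<eta> by blast
  next
    case False
    define T where "T = Z - subtopology X Z closure_of G"
    have "openin (subtopology X Z) T" unfolding T_def using openin_diff[OF openin_topspace closedin_closure_of] Ztop by metis
    then have "openin X T" using openin_open_subtopology[OF Z] by blast
    moreover have "p \<in> T"
    proof -
      have "p \<in> topspace X" using p Fr(3) closedin_subset by blast
      then have "p \<in> Z" using p FrW by (auto simp: Z_def)
      then show ?thesis using False G(3) by (auto simp: T_def)
    qed
    moreover have "G \<inter> T = {}" using closure_of_subset[of G "subtopology X Z"] GX(2) Ztop by (auto simp: T_def)
    then have "{\<xi>\<in>I. B \<xi> \<inter> T \<noteq> {}} = {}" using B(4) by blast
    then have "finite {\<xi>\<in>I. B \<xi> \<inter> T \<noteq> {}}" by (simp only: finite.emptyI)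
    ultimately show ?thesis by (intro exI[of _ T]) simp
  qed
  then have "\<forall>p\<in>Fr. \<exists>T. openin X T \<and> p \<in> T \<and> finite {\<xi>\<in>I. B \<xi> \<inter> T \<noteq> {}}" ..
  from bchoice[OF this] obtain T
    where "\<forall>p\<in>Fr. openin X (T p) \<and> p \<in> T p \<and> finite {\<xi>\<in>I. B \<xi> \<inter> T p \<noteq> {}}" ..
  then have T: "\<And>p. p \<in> Fr \<Longrightarrow> openin X (T p)" "\<And>p. p \<in> Fr \<Longrightarrow> p \<in> T p"
      "\<And>p. p \<in> Fr \<Longrightarrow> finite {\<xi>\<in>I. B \<xi> \<inter> T p \<noteq> {}}" by simp_all
  have "\<exists>Q. finite Q \<and> Q \<subseteq> Fr \<and> Fr \<subseteq> \<Union>(T ` Q)"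
  proof -
    have "\<exists>\<F>. finite \<F> \<and> \<F> \<subseteq> T ` Fr \<and> Fr \<subseteq> \<Union>\<F>"
      using T(1,2) by (intro compactinD[OF Frc]) auto
    then show ?thesis by (metis finite_subset_image)
  qed
  then obtain Q where Q: "finite Q" "Q \<subseteq> Fr" "Fr \<subseteq> \<Union>(T ` Q)" by auto
  have "a \<subseteq> (\<Union>p\<in>Q. {\<xi>\<in>I. B \<xi> \<inter> T p \<noteq> {}})"
  proof
    fix \<xi> assume "\<xi> \<in> a"
    then have \<xi>: "\<xi> \<in> I" "\<bar>f (z \<xi>)\<bar> > inverse (real (Suc n))" "\<xi> < \<delta>" using a(1) \<delta> by (auto simp: J_def)
    have "w \<xi> \<in> N" using N(2) \<xi>(3) by auto
    then have "B \<xi> \<inter> N \<noteq> {}" using B(3)[OF \<xi>(1)] by blast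
    moreover have "z \<xi> \<in> topspace X" using z(1)[OF \<xi>(1)] openin_subset[OF B(1)[OF \<xi>(1)]] by blast
    then have "z \<xi> \<in> K1" using \<xi>(2) by (simp add: K1_def)
    then have "z \<xi> \<notin> N" using N(3) closure_of_subset[OF openin_subset[OF N(1)]] by blast
    then have "B \<xi> - N \<noteq> {}" using z(1)[OF \<xi>(1)] by blast
    ultimately have "B \<xi> \<inter> Fr \<noteq> {}" unfolding Fr_def by (intro connectedin_Int_frontier_of B(2)[OF \<xi>(1)])
    then show "\<xi> \<in> (\<Union>p\<in>Q. {\<xi>\<in>I. B \<xi> \<inter> T p \<noteq> {}})" using Q(3) \<xi>(1) by blast
  qed
  moreover have "finite (\<Union>p\<in>Q. {\<xi>\<in>I. B \<xi> \<inter> T p \<noteq> {}})" using Q(1,2) T(3) by blast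
  ultimately show False using a(2) finite_subset by blast
qed

section \<open>A separation property of the square\<close>

lemma connected_integer_valued_constant:
  fixes f :: "'a::topological_space \<Rightarrow> real"
  assumes "connected S" "continuous_on S f" "\<And>x. x \<in> S \<Longrightarrow> f x \<in> \<int>" "x \<in> S" "y \<in> S"
  shows "f x = f y"
proof -
  have *: False if xy: "x \<in> S" "y \<in> S" "f x < f y" for x y
  proof -
    obtain i j :: int where ij: "f x = of_int i" "f y = of_int j"
      using assms(3)[OF xy(1)] assms(3)[OF xy(2)] by (auto elim!: Ints_cases)
    have "connected (f ` S)" using assms(1,2) by (rule connected_continuous_image[rotated])
    moreover have "f x \<le> of_int i + 1/2" "of_int i + 1/2 \<le> f y" using ij xy(3) by auto
    ultimately have "of_int i + 1/2 \<in> f ` S" using xy(1,2) by (meson connectedD_interval imageI)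
    then obtain v where "v \<in> S" "f v = of_int i + 1/2" by auto
    then obtain k :: int where "of_int i + 1/2 = (of_int k :: real)" using assms(3) by (metis Ints_cases)
    then have "real_of_int (2 * i + 1) = real_of_int (2 * k)" by simp
    then have "2 * i + 1 = 2 * k" by (simp only: of_int_eq_iff)
    then show False by presburger
  qed
  show ?thesis using *[of x y] *[of y x] assms(4,5) by (metis linorder_neqE)
qed

lemma connected_nonintegral_floor_constant:
  fixes f :: "'a::topological_space \<Rightarrow> real"
  assumes "connected S" "continuous_on S f" "\<And>x. x \<in> S \<Longrightarrow> f x \<notin> \<int>" "x \<in> S" "y \<in> S"
  shows "\<lfloor>f x\<rfloor> = \<lfloor>f y\<rfloor>"
proof -
  have *: False if xy: "x \<in> S" "y \<in> S" "\<lfloor>f x\<rfloor> < \<lfloor>f y\<rfloor>" for x y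
  proof -
    have "connected (f ` S)" using assms(1,2) by (rule connected_continuous_image[rotated])
    moreover have "f x \<le> of_int \<lfloor>f y\<rfloor>" using xy(3) by linarith
    moreover have "of_int \<lfloor>f y\<rfloor> \<le> f y" by simp
    ultimately have "of_int \<lfloor>f y\<rfloor> \<in> f ` S" using xy(1,2) by (meson connectedD_interval imageI)
    then show False using assms(3) by (metis Ints_of_int imageE)
  qed
  show ?thesis using *[of x y] *[of y x] assms(4,5) by (metis linorder_neqE)
qed

lemma no_int_between_0_1: "0 < real_of_int i \<Longrightarrow> real_of_int i < 1 \<Longrightarrow> False"
  by simp

text \<open>
  Unicoherence of the square, in the form of Janiszewski's theorem: if the union of the disjoint closed
  sets \<open>J\<close> and \<open>L\<close> separates the left edge from the right edge, then \<open>J\<close> meets the bottom edge or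
  \<open>L\<close> meets the top edge. Let \<open>u\<close> be a Urysohn function that is \<open>0\<close> exactly on \<open>J\<close>
  and \<open>1\<close> exactly on \<open>L\<close>. The circle-valued map \<open>\<theta>\<close> that is \<open>exp (i\<pi>u)\<close> on \<open>A\<close> and
  \<open>exp (-i\<pi>u)\<close> on \<open>B\<close> is continuous and lifts to a real angle \<open>2\<pi>\<phi>\<close>. From left to right, \<open>\<phi>\<close>
  changes from \<open>u/2 + k\<close> to \<open>l - u/2\<close> with integers \<open>k\<close> and \<open>l\<close> that do not depend on the height.
  A bottom edge missing \<open>J\<close> forces \<open>l = k + 1\<close>, a top edge missing \<open>L\<close> forces \<open>l = k\<close>.
\<close>

lemma square_separation:
  fixes A B J L :: "(real \<times> real) set"
  assumes cl: "closed A" "closed B" "closed J" "closed L"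
    and AB: "A \<union> B = {0..1} \<times> {0..1}" "A \<inter> B = J \<union> L" "J \<inter> L = {}"
    and edges: "\<And>s. s \<in> {0..1} \<Longrightarrow> (0, s) \<in> A" "\<And>s. s \<in> {0..1} \<Longrightarrow> (1, s) \<in> B"
      "\<And>t. t \<in> {0..1} \<Longrightarrow> (t, 0) \<notin> J" "\<And>t. t \<in> {0..1} \<Longrightarrow> (t, 1) \<notin> L"
  shows False
proof -
  let ?Q = "{0..1} \<times> {0..1} :: (real \<times> real) set"
  obtain u :: "real \<times> real \<Rightarrow> real" where u: "continuous_on UNIV u" "\<And>p. u p \<in> closed_segment 0 1"
      "\<And>p. u p = 0 \<longleftrightarrow> p \<in> J" "\<And>p. u p = 1 \<longleftrightarrow> p \<in> L"
    using Urysohn_strong[OF cl(3,4) AB(3), of "0 :: real" 1] by auto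
  have u01: "0 \<le> u p" "u p \<le> 1" for p using u(2)[of p] by (auto simp: closed_segment_eq_real_ivl)
  have uc: "continuous_on S u" for S using u(1) continuous_on_subset by blast
  define \<theta> where "\<theta> p = (if p \<in> A then cis (pi * u p) else cis (- (pi * u p)))" for p
  have cis_B: "\<theta> p = cis (- (pi * u p))" if "p \<in> B" for p
  proof (cases "p \<in> A")
    case True
    then have "u p = 0 \<or> u p = 1" using that AB(2) u(3,4) by blast
    then show ?thesis using True by (auto simp: \<theta>_def complex_eq_iff)
  qed (simp add: \<theta>_def)
  have "continuous_on (A \<union> B) \<theta>"
    unfolding \<theta>_def
  proof (rule continuous_on_cases[OF cl(1,2)])
    show "continuous_on A (\<lambda>p. cis (pi * u p))" "continuous_on B (\<lambda>p. cis (- (pi * u p)))"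
      unfolding cis_conv_exp by (intro continuous_intros uc)+
    show "\<forall>p. p \<in> A \<and> p \<notin> A \<or> p \<in> B \<and> p \<in> A \<longrightarrow> cis (pi * u p) = cis (- (pi * u p))"
    proof (intro allI impI)
      fix p assume "p \<in> A \<and> p \<notin> A \<or> p \<in> B \<and> p \<in> A"
      then have "p \<in> A" "p \<in> B" by auto
      then show "cis (pi * u p) = cis (- (pi * u p))" using cis_B[of p] by (simp add: \<theta>_def)
    qed
  qed
  moreover have "contractible ?Q" by (intro convex_imp_contractible convex_Times) auto
  moreover have "\<theta> p \<noteq> 0" for p by (simp add: \<theta>_def)
  ultimately obtain g where g: "continuous_on ?Q g" "\<And>p. p \<in> ?Q \<Longrightarrow> \<theta> p = exp (g p)"
    using continuous_logarithm_on_contractible[of ?Q \<theta>] unfolding AB(1) by metis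
  define \<phi> where "\<phi> p = Im (g p) / (2 * pi)" for p
  have \<phi>c: "continuous_on S \<phi>" if "S \<subseteq> ?Q" for S
    unfolding \<phi>_def using continuous_on_subset[OF g(1) that] by (intro continuous_intros) auto
  have lift: "\<exists>k :: int. Im z = x + 2 * pi * of_int k" if "cis x = exp z" for x z
  proof -
    have "exp z = exp (\<i> * complex_of_real x)" using that by (simp add: cis_conv_exp)
    then obtain n :: int where "z = \<i> * complex_of_real x + (of_int (2 * n) * pi) * \<i>"
      unfolding exp_eq by blast
    then have "Im z = x + 2 * pi * of_int n" by simp
    then show ?thesis ..
  qed
  have onA: "\<exists>k :: int. \<phi> p = u p / 2 + of_int k" if "p \<in> A" for p
  proof -
    have "p \<in> ?Q" using that AB(1) by blast
    then have "cis (pi * u p) = exp (g p)" using g(2)[of p] that by (simp add: \<theta>_def)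
    then obtain k :: int where "Im (g p) = pi * u p + 2 * pi * of_int k" using lift by blast
    then have "\<phi> p = u p / 2 + of_int k" by (simp add: \<phi>_def field_simps)
    then show ?thesis ..
  qed
  have onB: "\<exists>k :: int. \<phi> p = of_int k - u p / 2" if "p \<in> B" for p
  proof -
    have "p \<in> ?Q" using that AB(1) by blast
    then have "cis (- (pi * u p)) = exp (g p)" using g(2)[of p] cis_B[OF that] by simp
    then obtain k :: int where "Im (g p) = - (pi * u p) + 2 * pi * of_int k" using lift by blast
    then have "\<phi> p = of_int k - u p / 2" by (simp add: \<phi>_def field_simps)
    then show ?thesis ..
  qed
  \<comment> \<open>away from \<open>J\<close> the angle avoids the integers, away from \<open>L\<close> the half-integers\<close>
  have nJ: "\<phi> p \<notin> \<int>" if "p \<in> ?Q" "p \<notin> J" for p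
  proof
    assume "\<phi> p \<in> \<int>"
    then obtain m :: int where m: "\<phi> p = of_int m" by (auto elim: Ints_cases)
    have "0 < u p" using u01[of p] u(3)[of p] that(2) by (metis order_le_less)
    have "p \<in> A \<or> p \<in> B" using that(1) unfolding AB(1)[symmetric] by simp
    then show False
    proof
      assume "p \<in> A"
      from onA[OF this] obtain k :: int where 1: "\<phi> p = u p / 2 + of_int k" ..
      have "real_of_int (m - k) = u p / 2" using m 1 by simp
      then have "0 < real_of_int (m - k)" "real_of_int (m - k) < 1" using \<open>0 < u p\<close> u01[of p] by auto
      then show False by (rule no_int_between_0_1)
    next
      assume "p \<in> B"
      from onB[OF this] obtain k :: int where 2: "\<phi> p = of_int k - u p / 2" ..
      have "real_of_int (k - m) = u p / 2" using m 2 by simp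
      then have "0 < real_of_int (k - m)" "real_of_int (k - m) < 1" using \<open>0 < u p\<close> u01[of p] by auto
      then show False by (rule no_int_between_0_1)
    qed
  qed
  have nL: "\<phi> p + 1/2 \<notin> \<int>" if "p \<in> ?Q" "p \<notin> L" for p
  proof
    assume "\<phi> p + 1/2 \<in> \<int>"
    then obtain m :: int where m: "\<phi> p + 1/2 = of_int m" by (auto elim: Ints_cases)
    have "u p < 1" using u01[of p] u(4)[of p] that(2) by (metis order_le_less)
    have "p \<in> A \<or> p \<in> B" using that(1) unfolding AB(1)[symmetric] by simp
    then show False
    proof
      assume "p \<in> A"
      from onA[OF this] obtain k :: int where 1: "\<phi> p = u p / 2 + of_int k" ..
      have "real_of_int (m - k) = u p / 2 + 1/2" using m 1 by simp
      then have "0 < real_of_int (m - k)" "real_of_int (m - k) < 1" using \<open>u p < 1\<close> u01[of p] by auto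
      then show False by (rule no_int_between_0_1)
    next
      assume "p \<in> B"
      from onB[OF this] obtain k :: int where 2: "\<phi> p = of_int k - u p / 2" ..
      have "real_of_int (m - k) = 1/2 - u p / 2" using m 2 by simp
      then have "0 < real_of_int (m - k)" "real_of_int (m - k) < 1" using \<open>u p < 1\<close> u01[of p] by auto
      then show False by (rule no_int_between_0_1)
    qed
  qed
  have seg: "connected ({a} \<times> {0..1} :: (real \<times> real) set)" "connected ({0..1} \<times> {a} :: (real \<times> real) set)" for a
    by (rule convex_connected, rule convex_Times, simp, simp)+
  have left: "\<phi> (0, 0) - u (0, 0) / 2 = \<phi> (0, 1) - u (0, 1) / 2"
  proof (rule connected_integer_valued_constant[OF seg(1)[of 0], where f = "\<lambda>p. \<phi> p - u p / 2"])
    show "continuous_on ({0} \<times> {0..1}) (\<lambda>p. \<phi> p - u p / 2)" by (intro continuous_intros \<phi>c uc) auto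
    fix p :: "real \<times> real" assume "p \<in> {0} \<times> {0..1}"
    then have "p \<in> A" using edges(1) by auto
    then show "\<phi> p - u p / 2 \<in> \<int>" using onA by fastforce
  qed auto
  have right: "\<phi> (1, 0) + u (1, 0) / 2 = \<phi> (1, 1) + u (1, 1) / 2"
  proof (rule connected_integer_valued_constant[OF seg(1)[of 1], where f = "\<lambda>p. \<phi> p + u p / 2"])
    show "continuous_on ({1} \<times> {0..1}) (\<lambda>p. \<phi> p + u p / 2)" by (intro continuous_intros \<phi>c uc) auto
    fix p :: "real \<times> real" assume "p \<in> {1} \<times> {0..1}"
    then have "p \<in> B" using edges(2) by auto
    then show "\<phi> p + u p / 2 \<in> \<int>" using onB by fastforce
  qed auto
  have bottom: "\<lfloor>\<phi> (0, 0)\<rfloor> = \<lfloor>\<phi> (1, 0)\<rfloor>"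
    by (rule connected_nonintegral_floor_constant[OF seg(2)[of 0] \<phi>c]) (use nJ edges(3) in auto)
  have top: "\<lfloor>\<phi> (0, 1) + 1/2\<rfloor> = \<lfloor>\<phi> (1, 1) + 1/2\<rfloor>"
  proof (rule connected_nonintegral_floor_constant[OF seg(2)[of 1], where f = "\<lambda>p. \<phi> p + 1/2"])
    show "continuous_on ({0..1} \<times> {1}) (\<lambda>p. \<phi> p + 1/2)" by (intro continuous_intros \<phi>c) auto
  qed (use nL edges(4) in auto)
  obtain k :: int where k: "\<phi> (0, 0) = u (0, 0) / 2 + of_int k" using onA[OF edges(1)[of 0]] by auto
  obtain l :: int where l: "\<phi> (1, 0) = of_int l - u (1, 0) / 2" using onB[OF edges(2)[of 0]] by auto
  have "u (0, 0) \<noteq> 0" "u (1, 0) \<noteq> 0" using u(3) edges(3) by auto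
  then have "\<lfloor>\<phi> (0, 0)\<rfloor> = k" "\<lfloor>\<phi> (1, 0)\<rfloor> = l - 1"
    unfolding floor_eq_iff k l using u01[of "(0, 0)"] u01[of "(1, 0)"] by auto
  then have "l = k + 1" using bottom by simp
  moreover have "\<phi> (0, 1) = u (0, 1) / 2 + of_int k" "\<phi> (1, 1) = of_int l - u (1, 1) / 2"
    using left right k l by simp_all
  moreover have "u (0, 1) \<noteq> 1" "u (1, 1) \<noteq> 1" using u(4) edges(4) by auto
  then have "u (0, 1) < 1" "u (1, 1) < 1" using u01[of "(0, 1)"] u01[of "(1, 1)"] by auto
  ultimately have "\<lfloor>\<phi> (0, 1) + 1/2\<rfloor> = k" "\<lfloor>\<phi> (1, 1) + 1/2\<rfloor> = l"
    unfolding floor_eq_iff using u01[of "(0, 1)"] u01[of "(1, 1)"] by auto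
  then show False using top \<open>l = k + 1\<close> by simp
qed

section \<open>Euclidean space\<close>

lemma continuous_map_Euclidean_coordinate: "continuous_map (Euclidean_space n) euclideanreal (\<lambda>x. x i)"
  unfolding Euclidean_space_def
  by (intro continuous_map_from_subtopology continuous_map_product_projection) simp

lemma second_countable_Euclidean_space: "second_countable (Euclidean_space n)"
proof -
  obtain \<B> :: "(nat \<Rightarrow> real) set set" where \<B>: "countable \<B>" "\<And>C. C \<in> \<B> \<Longrightarrow> open C"
      "\<And>S. open S \<Longrightarrow> \<exists>U. U \<subseteq> \<B> \<and> S = \<Union>U"
    using univ_second_countable by metis
  have "second_countable (euclidean :: (nat \<Rightarrow> real) topology)"
    unfolding second_countable_def
  proof (intro exI[of _ \<B>] conjI ballI allI impI \<B>(1))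
    show "openin euclidean V" if "V \<in> \<B>" for V using \<B>(2)[OF that] by simp
    fix U :: "(nat \<Rightarrow> real) set" and x assume U: "openin euclidean U \<and> x \<in> U"
    then have "open U" by simp
    from \<B>(3)[OF this] obtain W where "W \<subseteq> \<B>" "U = \<Union>W" by auto
    then show "\<exists>V\<in>\<B>. x \<in> V \<and> V \<subseteq> U" using U by blast
  qed
  then show ?thesis unfolding Euclidean_space_def euclidean_product_topology
    by (rule second_countable_subtopology)
qed

lemma compactin_Euclidean_box: "compactin (Euclidean_space n) {x \<in> topspace (Euclidean_space n). \<forall>i<n. \<bar>x i\<bar> \<le> r}"
proof -
  let ?S = "\<lambda>i. if i < n then {-r..r} else {0 :: real}"
  have "compactin (powertop_real UNIV) (PiE UNIV ?S)"
    unfolding compactin_PiE by auto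
  moreover have "PiE UNIV ?S = {x \<in> topspace (Euclidean_space n). \<forall>i<n. \<bar>x i\<bar> \<le> r}"
    by (auto simp: PiE_iff topspace_Euclidean_space abs_le_iff minus_le_iff split: if_splits)
  ultimately show ?thesis
    by (auto simp: Euclidean_space_def compactin_subtopology)
qed

lemma compactin_Euclidean_bounded:
  assumes "compactin (Euclidean_space n) K"
  obtains r where "0 < r" "\<forall>x\<in>K. \<forall>i<n. \<bar>x i\<bar> < r"
proof -
  have "\<exists>b. \<forall>x\<in>K. \<bar>x i\<bar> \<le> b" for i
  proof -
    have "compact ((\<lambda>x. x i) ` K)"
      using image_compactin[OF assms continuous_map_Euclidean_coordinate] by simp
    then show ?thesis using compact_imp_bounded bounded_real by (metis (mono_tags, lifting) imageI)
  qed
  then obtain b where b: "\<And>i x. x \<in> K \<Longrightarrow> \<bar>x i\<bar> \<le> b i" by metis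
  define r where "r = 1 + (\<Sum>i<n. \<bar>b i\<bar>)"
  show thesis
  proof
    show "0 < r" unfolding r_def by (simp add: add_pos_nonneg sum_nonneg)
    show "\<forall>x\<in>K. \<forall>i<n. \<bar>x i\<bar> < r"
    proof (intro ballI allI impI)
    fix x i assume "x \<in> K" "i < n"
    have "\<bar>b i\<bar> \<le> (\<Sum>i<n. \<bar>b i\<bar>)" using \<open>i < n\<close> by (intro member_le_sum) auto
    then show "\<bar>x i\<bar> < r" unfolding r_def using b[OF \<open>x \<in> K\<close>, of i] by linarith
    qed
  qed
qed

lemma path_component_of_Euclidean_segment:
  assumes "x \<in> topspace (Euclidean_space n)" "y \<in> topspace (Euclidean_space n)"
    and "\<And>t. t \<in> {0..1} \<Longrightarrow> (\<lambda>i. (1 - t) * x i + t * y i) \<in> S"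
  shows "path_component_of (subtopology (Euclidean_space n) S) x y"
  unfolding path_component_of_def
proof (intro exI conjI)
  let ?g = "\<lambda>t i. (1 - t) * x i + t * y i :: real"
  have "?g t = (\<lambda>i. if i < n then (1 - t) * x i + t * y i else 0)" for t
    using assms(1,2) by (auto simp: topspace_Euclidean_space)
  then have "continuous_map (top_of_set {0..1}) (Euclidean_space n) ?g"
    by (simp add: continuous_map_componentwise_Euclidean_space) (intro allI impI continuous_intros)
  then show "pathin (subtopology (Euclidean_space n) S) ?g"
    unfolding pathin_def continuous_map_in_subtopology using assms(3) by auto
qed auto

text \<open>
  From a point with a large coordinate \<open>i\<close>, first move straight to the point \<open>m\<close> that keeps this
  coordinate, has \<open>r\<close> at another coordinate \<open>j\<close> and \<open>0\<close> elsewhere, then let coordinate \<open>i\<close> go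
  to \<open>0\<close>. The second coordinate requires \<open>n > 1\<close>; on the line the complement has two
  components.
\<close>

lemma path_connected_Euclidean_box_complement:
  assumes n: "1 < n" and r: "0 \<le> r"
  defines "R \<equiv> {x \<in> topspace (Euclidean_space n). \<exists>i<n. r \<le> \<bar>x i\<bar>}"
  shows "path_connectedin (Euclidean_space n) R"
proof -
  let ?E = "subtopology (Euclidean_space n) R"
  have R: "x \<in> R \<longleftrightarrow> (\<forall>i\<ge>n. x i = 0) \<and> (\<exists>i<n. r \<le> \<bar>x i\<bar>)" for x
    by (simp add: R_def topspace_Euclidean_space)
  define e where "e j = (\<lambda>i :: nat. if i = j then r else 0)" for j :: nat
  have move: "path_component_of ?E x (e j)" if x: "x \<in> R" "i < n" "r \<le> \<bar>x i\<bar>" "j < n" "j \<noteq> i" for x i j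
  proof -
    define m where "m = (\<lambda>k. if k = i then x i else if k = j then r else 0)"
    have top: "x \<in> topspace (Euclidean_space n)" "m \<in> topspace (Euclidean_space n)"
        "e j \<in> topspace (Euclidean_space n)"
      using x by (auto simp: R m_def e_def topspace_Euclidean_space)
    have "path_component_of ?E x m"
    proof (rule path_component_of_Euclidean_segment[OF top(1,2)])
      fix t :: real
      have "(1 - t) * x i + t * m i = x i" by (simp add: m_def algebra_simps)
      then show "(\<lambda>k. (1 - t) * x k + t * m k) \<in> R"
        unfolding R using x(2,3) top(1,2) by (auto simp: topspace_Euclidean_space intro!: exI[of _ i])
    qed
    moreover have "path_component_of ?E m (e j)"
    proof (rule path_component_of_Euclidean_segment[OF top(2,3)])
      fix t :: real
      have "(1 - t) * m j + t * e j j = r" using x(5) by (simp add: m_def e_def algebra_simps)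
      then show "(\<lambda>k. (1 - t) * m k + t * e j k) \<in> R"
        unfolding R using x(4) top(2,3) r by (auto simp: topspace_Euclidean_space intro!: exI[of _ j])
    qed
    ultimately show ?thesis by (rule path_component_of_trans)
  qed
  have base: "path_component_of ?E x (e 0)" if x: "x \<in> R" for x
  proof -
    obtain i where i: "i < n" "r \<le> \<bar>x i\<bar>" using x by (auto simp: R)
    show ?thesis
    proof (cases "i = 0")
      case True
      have "path_component_of ?E x (e 1)" using move[OF x i, of 1] n True by simp
      moreover have "e 1 \<in> R" unfolding R using n r by (auto simp: e_def intro!: exI[of _ 1])
      then have "path_component_of ?E (e 1) (e 0)" using move[of "e 1" 1 0] n r by (simp add: e_def)
      ultimately show ?thesis by (rule path_component_of_trans)
    next
      case False
      then show ?thesis using move[OF x i, of 0] n by simp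
    qed
  qed
  have "path_connected_space ?E"
    unfolding path_connected_space_iff_path_component
    using base by (metis IntD2 path_component_of_sym path_component_of_trans topspace_subtopology)
  then show ?thesis unfolding path_connectedin_def by (auto simp: R_def)
qed

lemma openin_Euclidean_imp_cube:
  assumes S: "openin (Euclidean_space n) S" and c: "c \<in> S"
  obtains \<epsilon> where "0 < \<epsilon>" "{y \<in> topspace (Euclidean_space n). \<forall>i<n. \<bar>y i - c i\<bar> < \<epsilon>} \<subseteq> S"
proof -
  obtain T where T: "openin (powertop_real UNIV) T" "S = T \<inter> {x. \<forall>i\<ge>n. x i = 0}"
    using S unfolding Euclidean_space_def openin_subtopology by auto
  have c0: "c \<in> T" "\<And>i. n \<le> i \<Longrightarrow> c i = 0" using c T(2) by auto
  obtain U where U: "\<And>i. openin euclideanreal (U i)" "c \<in> PiE UNIV U" "PiE UNIV U \<subseteq> T"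
    using T(1) c0(1) unfolding openin_product_topology_alt by (metis UNIV_I)
  have "\<exists>e>0. ball (c i) e \<subseteq> U i" for i
  proof -
    have "open (U i)" "c i \<in> U i" using U(1,2) by (auto simp: PiE_iff)
    then show ?thesis by (rule openE) auto
  qed
  then obtain e where e: "\<And>i. 0 < e i" "\<And>i. ball (c i) (e i) \<subseteq> U i" by metis
  define \<epsilon> where "\<epsilon> = Min (insert 1 (e ` {..<n}))"
  show thesis
  proof
    show "0 < \<epsilon>" unfolding \<epsilon>_def using e(1) by (subst Min_gr_iff) auto
    show "{y \<in> topspace (Euclidean_space n). \<forall>i<n. \<bar>y i - c i\<bar> < \<epsilon>} \<subseteq> S"
    proof clarify
      fix y assume y: "y \<in> topspace (Euclidean_space n)" "\<forall>i<n. \<bar>y i - c i\<bar> < \<epsilon>"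
      have "y i \<in> U i" for i
      proof (cases "i < n")
        case True
        have "\<epsilon> \<le> e i" unfolding \<epsilon>_def using True by (intro Min_le) auto
        then have "\<bar>y i - c i\<bar> < e i" using y(2) True by (meson less_le_trans)
        then have "y i \<in> ball (c i) (e i)" by (simp add: dist_real_def abs_minus_commute)
        then show ?thesis using e(2) by blast
      next
        case False
        then have "y i = c i" using y(1) c0(2) by (simp add: topspace_Euclidean_space)
        then show ?thesis using U(2) by (simp add: PiE_iff)
      qed
      then have "y \<in> T" using U(3) by (auto simp: PiE_iff)
      then show "y \<in> S" using T(2) y(1) by (simp add: topspace_Euclidean_space)
    qed
  qed
qed

lemma openin_Euclidean_cube:
  "openin (Euclidean_space n) {y \<in> topspace (Euclidean_space n). \<forall>i<n. \<bar>y i - c i\<bar> < \<epsilon>}"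
proof -
  let ?E = "Euclidean_space n"
  have *: "openin ?E {y \<in> topspace ?E. \<bar>y i - c i\<bar> < \<epsilon>}" for i
  proof -
    have "openin ?E {y \<in> topspace ?E. y i \<in> ball (c i) \<epsilon>}"
      by (rule openin_continuous_map_preimage[OF continuous_map_Euclidean_coordinate]) simp
    then show ?thesis by (simp add: dist_real_def abs_minus_commute)
  qed
  have "{y \<in> topspace ?E. \<forall>i<n. \<bar>y i - c i\<bar> < \<epsilon>} =
      topspace ?E \<inter> (\<Inter>i\<in>{..<n}. {y \<in> topspace ?E. \<bar>y i - c i\<bar> < \<epsilon>})" by auto
  moreover have "openin ?E (topspace ?E \<inter> (\<Inter>i\<in>{..<n}. {y \<in> topspace ?E. \<bar>y i - c i\<bar> < \<epsilon>}))"
  proof (cases "n = 0")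
    case False
    then have "openin ?E (\<Inter>i\<in>{..<n}. {y \<in> topspace ?E. \<bar>y i - c i\<bar> < \<epsilon>})"
      using * by (intro openin_Inter) auto
    then show ?thesis by (intro openin_Int) auto
  qed simp
  ultimately show ?thesis by (simp only:)
qed

text \<open>
  Coordinatewise, \<open>t \<mapsto> t / (1 + \<bar>t\<bar>)\<close> maps the line onto the interval from \<open>-1\<close> to \<open>1\<close>, with
  inverse \<open>u \<mapsto> u / (1 - \<bar>u\<bar>)\<close>.
\<close>

lemma Euclidean_cube_homeomorphic:
  assumes "0 < \<epsilon>" "c \<in> topspace (Euclidean_space n)"
  shows "subtopology (Euclidean_space n) {y \<in> topspace (Euclidean_space n). \<forall>i<n. \<bar>y i - c i\<bar> < \<epsilon>}
    homeomorphic_space Euclidean_space n"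
proof -
  let ?E = "Euclidean_space n"
  define Q where "Q = {y \<in> topspace ?E. \<forall>i<n. \<bar>y i - c i\<bar> < \<epsilon>}"
  have in_E: "y \<in> topspace ?E \<longleftrightarrow> (\<forall>i\<ge>n. y i = 0)" for y by (simp add: topspace_Euclidean_space)
  define f where "f = (\<lambda>y i. if i < n then ((y i - c i) / \<epsilon>) / (1 - \<bar>(y i - c i) / \<epsilon>\<bar>) else 0 :: real)"
  define g where "g = (\<lambda>y i. if i < n then c i + \<epsilon> * (y i / (1 + \<bar>y i\<bar>)) else 0 :: real)"
  have Qu: "\<bar>(y i - c i) / \<epsilon>\<bar> < 1" if "y \<in> Q" "i < n" for y i
    using that assms(1) by (simp add: Q_def)
  have "continuous_map (subtopology ?E Q) ?E f"
    unfolding f_def continuous_map_componentwise_Euclidean_space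
  proof (intro allI impI)
    fix i assume i: "i < n"
    have co: "continuous_map (subtopology ?E Q) euclideanreal (\<lambda>y. y i)"
      by (intro continuous_map_from_subtopology continuous_map_Euclidean_coordinate)
    have cu: "continuous_map (subtopology ?E Q) euclideanreal (\<lambda>y. (y i - c i) / \<epsilon>)"
      using assms(1) by (intro continuous_map_real_divide continuous_map_diff co) auto
    show "continuous_map (subtopology ?E Q) euclideanreal
        (\<lambda>y. ((y i - c i) / \<epsilon>) / (1 - \<bar>(y i - c i) / \<epsilon>\<bar>))"
    proof (rule continuous_map_real_divide[OF cu])
      show "continuous_map (subtopology ?E Q) euclideanreal (\<lambda>y. 1 - \<bar>(y i - c i) / \<epsilon>\<bar>)"
        by (rule continuous_map_diff[OF _ continuous_map_real_abs[OF cu]]) simp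
      fix y assume "y \<in> topspace (subtopology ?E Q)"
      then have "\<bar>(y i - c i) / \<epsilon>\<bar> < 1" using Qu[of y i] i by simp
      then show "1 - \<bar>(y i - c i) / \<epsilon>\<bar> \<noteq> 0" by linarith
    qed
  qed
  moreover have "continuous_map ?E (subtopology ?E Q) g"
    unfolding continuous_map_in_subtopology
  proof (intro conjI)
    show "continuous_map ?E ?E g"
      unfolding g_def continuous_map_componentwise_Euclidean_space
      by (intro allI impI continuous_map_add continuous_map_real_mult continuous_map_real_divide
          continuous_map_real_abs continuous_map_Euclidean_coordinate) auto
    show "g \<in> topspace ?E \<rightarrow> Q"
    proof
      fix y :: "nat \<Rightarrow> real"
      have "\<bar>\<epsilon> * (y i / (1 + \<bar>y i\<bar>))\<bar> < \<epsilon>" for i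
      proof -
        have "\<bar>y i / (1 + \<bar>y i\<bar>)\<bar> < 1" by (simp add: abs_divide)
        moreover have "\<bar>\<epsilon> * q\<bar> < \<epsilon>" if "\<bar>q\<bar> < 1" for q
          using mult_strict_left_mono[OF that assms(1)] assms(1) by (simp add: abs_mult)
        ultimately show ?thesis by blast
      qed
      then show "g y \<in> Q" by (auto simp: Q_def in_E g_def)
    qed
  qed
  moreover have "g (f y) = y" if "y \<in> topspace (subtopology ?E Q)" for y
  proof
    fix i
    show "g (f y) i = y i"
    proof (cases "i < n")
      case True
      define u where "u = (y i - c i) / \<epsilon>"
      have u: "\<bar>u\<bar> < 1" unfolding u_def using Qu[of y i] that True by simp
      have "(u / (1 - \<bar>u\<bar>)) / (1 + \<bar>u / (1 - \<bar>u\<bar>)\<bar>) = u"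
        using u by (cases "u \<ge> 0") (simp_all add: field_simps abs_if split: if_splits)
      moreover have "f y i = u / (1 - \<bar>u\<bar>)" using True unfolding f_def u_def by simp
      moreover have "g (f y) i = c i + \<epsilon> * (f y i / (1 + \<bar>f y i\<bar>))" using True unfolding g_def by simp
      ultimately have "g (f y) i = c i + \<epsilon> * u" by (simp only:)
      then show ?thesis using assms(1) by (simp add: u_def)
    next
      case False
      then show ?thesis using that by (simp add: g_def in_E)
    qed
  qed
  moreover have "f (g y) = y" if "y \<in> topspace ?E" for y
  proof
    fix i
    show "f (g y) i = y i"
    proof (cases "i < n")
      case True
      define u where "u = y i / (1 + \<bar>y i\<bar>)"
      have "(g y i - c i) / \<epsilon> = u" using True assms(1) by (simp add: g_def u_def)
      then have "f (g y) i = u / (1 - \<bar>u\<bar>)" using True by (simp add: f_def)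
      also have "\<dots> = y i"
        unfolding u_def by (cases "y i \<ge> 0") (simp_all add: field_simps abs_if)
      finally show ?thesis .
    next
      case False
      then show ?thesis using that by (simp add: f_def in_E)
    qed
  qed
  ultimately have "homeomorphic_maps (subtopology ?E Q) ?E f g"
    unfolding homeomorphic_maps_def by blast
  then show ?thesis unfolding Q_def homeomorphic_space_def by blast
qed

section \<open>Manifolds\<close>

text \<open>
  With arbitrarily small \<^emph>\<open>open\<close> charts, each homeomorphic to the full Euclidean space, the notion
  passes to open subspaces, and every chart is open, contractible and locally path connected.
\<close>

definition locally_Euclidean :: "nat \<Rightarrow> 'a topology \<Rightarrow> bool"
  where "locally_Euclidean n X \<longleftrightarrow> (\<forall>W x. openin X W \<and> x \<in> W \<longrightarrow>
    (\<exists>V. openin X V \<and> x \<in> V \<and> V \<subseteq> W \<and> subtopology X V homeomorphic_space Euclidean_space n))"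

text \<open>
  The image of a small neighbourhood under a chart contains an open cube, and open cubes are homeomorphic to
  the whole space. The preimage of the cube is open in \<open>X\<close>, not just in the chart domain \<open>N\<close>,
  because it lies in the open set \<open>U\<close> inside \<open>N\<close>.
\<close>

lemma manifold_imp_locally_Euclidean:
  assumes "manifold_of_dim n X"
  shows "locally_Euclidean n X"
  unfolding locally_Euclidean_def
proof (intro allI impI)
  fix W x assume W: "openin X W \<and> x \<in> W"
  then have "x \<in> topspace X" using openin_subset by blast
  from bspec[OF assms[unfolded manifold_of_dim_def] this]
  obtain U N where UN: "openin X U" "x \<in> U" "U \<subseteq> N" "N \<subseteq> topspace X"
      "subtopology X N homeomorphic_space Euclidean_space n"
    by (elim exE conjE)
  let ?E = "Euclidean_space n"
  obtain \<phi> \<psi> where hm: "homeomorphic_maps (subtopology X N) ?E \<phi> \<psi>"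
    using UN(5) unfolding homeomorphic_space_def by blast
  have \<phi>: "homeomorphic_map (subtopology X N) ?E \<phi>" and \<psi>: "homeomorphic_map ?E (subtopology X N) \<psi>"
    using hm homeomorphic_map_maps homeomorphic_maps_sym by blast+
  have topN: "topspace (subtopology X N) = N" using UN(4) by auto
  have "openin (subtopology X N) (U \<inter> W)"
    unfolding openin_subtopology using UN(1,3) W by (intro exI[of _ "U \<inter> W"]) auto
  then have op: "openin ?E (\<phi> ` (U \<inter> W))"
    using homeomorphic_imp_open_map[OF \<phi>] unfolding open_map_def by blast
  have "\<phi> x \<in> \<phi> ` (U \<inter> W)" using UN(2) W by blast
  then obtain \<epsilon> where \<epsilon>: "0 < \<epsilon>" "{y \<in> topspace ?E. \<forall>i<n. \<bar>y i - \<phi> x i\<bar> < \<epsilon>} \<subseteq> \<phi> ` (U \<inter> W)"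
    by (rule openin_Euclidean_imp_cube[OF op])
  define Q where "Q = {y \<in> topspace ?E. \<forall>i<n. \<bar>y i - \<phi> x i\<bar> < \<epsilon>}"
  have \<phi>x: "\<phi> x \<in> topspace ?E" using openin_subset[OF op] \<open>\<phi> x \<in> \<phi> ` (U \<inter> W)\<close> by (rule subsetD)
  have "\<forall>y\<in>topspace (subtopology X N). \<psi> (\<phi> y) = y" using hm unfolding homeomorphic_maps_def by blast
  then have inv: "\<psi> (\<phi> y) = y" if "y \<in> N" for y using that unfolding topN by simp
  define V where "V = \<psi> ` Q"
  have VUW: "V \<subseteq> U \<inter> W"
  proof -
    have "V \<subseteq> \<psi> ` \<phi> ` (U \<inter> W)" unfolding V_def Q_def using \<epsilon>(2) by (rule image_mono)
    also have "\<dots> = U \<inter> W" using inv UN(3) by (force simp: image_image)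
    finally show ?thesis .
  qed
  have "openin (subtopology X N) V"
    unfolding V_def Q_def using homeomorphic_imp_open_map[OF \<psi>] openin_Euclidean_cube
    unfolding open_map_def by blast
  then obtain T where T: "openin X T" "V = T \<inter> N" unfolding openin_subtopology by blast
  have "V = T \<inter> U" using T(2) VUW UN(3) by blast
  then have "openin X V" using T(1) UN(1) by (simp add: openin_Int)
  moreover have "x \<in> V"
  proof -
    have "\<phi> x \<in> Q" using \<phi>x \<epsilon>(1) by (simp add: Q_def)
    then have "\<psi> (\<phi> x) \<in> V" unfolding V_def by blast
    then show ?thesis using inv UN(2,3) by auto
  qed
  moreover have "subtopology X V homeomorphic_space ?E"
  proof -
    have "homeomorphic_map (subtopology ?E Q) (subtopology (subtopology X N) V) \<psi>"
    proof (rule homeomorphic_map_subtopologies[OF \<psi>])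
      have "Q \<subseteq> topspace ?E" by (auto simp: Q_def)
      then show "\<psi> ` (topspace ?E \<inter> Q) = topspace (subtopology X N) \<inter> V"
        unfolding topN V_def using VUW UN(3) unfolding V_def by (simp add: inf.absorb2) blast
    qed
    moreover have "subtopology (subtopology X N) V = subtopology X V"
    proof -
      have "N \<inter> V = V" using VUW UN(3) by blast
      then show ?thesis by (simp add: subtopology_subtopology)
    qed
    ultimately have "subtopology X V homeomorphic_space subtopology ?E Q"
      using homeomorphic_map_imp_homeomorphic_space homeomorphic_space_sym by metis
    also have "subtopology ?E Q homeomorphic_space ?E"
      unfolding Q_def by (rule Euclidean_cube_homeomorphic[OF \<epsilon>(1) \<phi>x])
    finally (homeomorphic_space_trans) show ?thesis .
  qed
  ultimately show "\<exists>V. openin X V \<and> x \<in> V \<and> V \<subseteq> W \<and> subtopology X V homeomorphic_space ?E"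
    using VUW by blast
qed

lemma locally_EuclideanD:
  assumes "locally_Euclidean n X" "openin X W" "x \<in> W"
  obtains V where "openin X V" "x \<in> V" "V \<subseteq> W" "subtopology X V homeomorphic_space Euclidean_space n"
  using assms unfolding locally_Euclidean_def by blast

lemma locally_Euclidean_open_subtopology:
  assumes "locally_Euclidean n X" "openin X S"
  shows "locally_Euclidean n (subtopology X S)"
  unfolding locally_Euclidean_def
proof (intro allI impI)
  fix W x assume "openin (subtopology X S) W \<and> x \<in> W"
  then have W: "openin X W" "W \<subseteq> S" "x \<in> W" using openin_open_subtopology[OF assms(2)] by auto
  from locally_EuclideanD[OF assms(1) W(1,3)]
  obtain V where V: "openin X V" "x \<in> V" "V \<subseteq> W" "subtopology X V homeomorphic_space Euclidean_space n" .
  then have "openin (subtopology X S) V" "subtopology (subtopology X S) V = subtopology X V"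
    using W(2) openin_open_subtopology[OF assms(2)] by (auto simp: subtopology_subtopology inf.absorb2)
  then show "\<exists>V. openin (subtopology X S) V \<and> x \<in> V \<and> V \<subseteq> W \<and>
      subtopology (subtopology X S) V homeomorphic_space Euclidean_space n" using V by auto
qed

lemma locally_Euclidean_imp_locally_second_countable:
  assumes "locally_Euclidean n X"
  shows "locally_second_countable X"
  unfolding locally_second_countable_def
proof
  fix x assume "x \<in> topspace X"
  from locally_EuclideanD[OF assms openin_topspace this]
  obtain V where "openin X V" "x \<in> V" "subtopology X V homeomorphic_space Euclidean_space n" .
  then show "\<exists>U. openin X U \<and> x \<in> U \<and> second_countable (subtopology X U)"
    using second_countable_Euclidean_space homeomorphic_space_second_countability by blast
qed

lemma locally_compact_Euclidean_space: "locally_compact_space (Euclidean_space n)"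
  unfolding locally_compact_space_def
proof
  let ?E = "Euclidean_space n"
  fix x assume x: "x \<in> topspace ?E"
  then have "compactin ?E {x}" by simp
  then obtain r where r: "\<forall>y\<in>{x}. \<forall>i<n. \<bar>y i\<bar> < r" by (rule compactin_Euclidean_bounded)
  let ?U = "{y \<in> topspace ?E. \<forall>i<n. \<bar>y i - 0\<bar> < r}"
  have "openin ?E ?U" using openin_Euclidean_cube[of n "\<lambda>_. 0" r] by simp
  moreover have "x \<in> ?U" using x r by simp
  moreover have "?U \<subseteq> {x \<in> topspace ?E. \<forall>i<n. \<bar>x i\<bar> \<le> r}" by auto
  ultimately show "\<exists>U K. openin ?E U \<and> compactin ?E K \<and> x \<in> U \<and> U \<subseteq> K"
    using compactin_Euclidean_box by blast
qed

lemma locally_Euclidean_imp_locally_compact: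
  assumes "locally_Euclidean n X"
  shows "locally_compact_space X"
  unfolding locally_compact_space_def
proof
  fix x assume "x \<in> topspace X"
  from locally_EuclideanD[OF assms openin_topspace this]
  obtain V where V: "openin X V" "x \<in> V" "subtopology X V homeomorphic_space Euclidean_space n" .
  have "locally_compact_space (subtopology X V)"
    using V(3) homeomorphic_locally_compact_space locally_compact_Euclidean_space by blast
  moreover have "x \<in> topspace (subtopology X V)" using V(2) \<open>x \<in> topspace X\<close> by simp
  ultimately obtain U K where "openin (subtopology X V) U" "compactin (subtopology X V) K" "x \<in> U" "U \<subseteq> K"
    unfolding locally_compact_space_def by blast
  then show "\<exists>U K. openin X U \<and> compactin X K \<and> x \<in> U \<and> U \<subseteq> K"
    using openin_open_subtopology[OF V(1)] by (metis compactin_subtopology)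
qed

lemma locally_Euclidean_imp_locally_path_connected:
  assumes "locally_Euclidean n X"
  shows "locally_path_connected_space X"
  unfolding locally_path_connected_space_alt neighbourhood_base_of
proof (intro allI impI)
  fix W x assume "openin X W \<and> x \<in> W"
  then have W: "openin X W" "x \<in> W" by auto
  from locally_EuclideanD[OF assms this]
  obtain V where V: "openin X V" "x \<in> V" "V \<subseteq> W" "subtopology X V homeomorphic_space Euclidean_space n" .
  have "path_connected_space (subtopology X V)"
    using V(4) homeomorphic_path_connected_space path_connected_Euclidean_space by blast
  then have "path_connectedin X V" using openin_subset[OF V(1)] by (simp add: path_connectedin_def)
  then show "\<exists>U V. openin X U \<and> (openin X V \<and> path_connectedin X V) \<and> x \<in> U \<and> U \<subseteq> V \<and> V \<subseteq> W"
    using V by blast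
qed

lemma locally_Euclidean_local_properties:
  assumes "locally_Euclidean n X"
  shows "locally_compact_space X" "locally_second_countable X" "first_countable X"
    "locally_connected_space X"
  using locally_Euclidean_imp_locally_compact[OF assms]
    locally_Euclidean_imp_locally_second_countable[OF assms]
    locally_second_countable_imp_first_countable
    locally_path_connected_imp_locally_connected_space[OF
      locally_Euclidean_imp_locally_path_connected[OF assms]]
  by blast+

section \<open>Small neighbourhoods whose frontier lies on one side\<close>

text \<open>
  In the compact space \<open>F \<inter> C\<close>, with \<open>C\<close> a small compact neighbourhood, quasi-components are
  components, so the point \<open>w\<close> can be separated from the part of \<open>F \<inter> C\<close> outside a smaller
  neighbourhood \<open>N\<close> by a partition into closed sets \<open>H\<close> and \<open>H'\<close>. Normality fits the frontier of an open
  set \<open>G\<close> between them.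
\<close>

lemma neighbourhood_with_frontier_off_closed_set:
  assumes X: "T5_space X" "locally_compact_space X"
    and F: "closedin X F" "w \<in> F" "connected_component_of_set (subtopology X F) w = {w}"
    and V: "openin X V" "w \<in> V"
  obtains G where "openin X G" "w \<in> G" "compactin X (X closure_of G)" "X closure_of G \<subseteq> V"
    "X frontier_of G \<inter> F = {}"
proof -
  have Haus: "Hausdorff_space X" by (rule T5_imp_Hausdorff[OF X(1)])
  have "neighbourhood_base_of (\<lambda>C. compactin X C \<and> closedin X C) X"
    using X(2) Haus locally_compact_space_neighbourhood_base_closedin by blast
  from this[unfolded neighbourhood_base_of, rule_format, OF conjI[OF V]]
  obtain N C where NC: "openin X N" "compactin X C" "closedin X C" "w \<in> N" "N \<subseteq> C" "C \<subseteq> V" by auto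
  define T where "T = subtopology X (F \<inter> C)"
  have FC: "closedin X (F \<inter> C)" "compactin X (F \<inter> C)"
    using F(1) NC(2,3) by (auto simp: closed_Int_compactin)
  have topT: "topspace T = F \<inter> C" using closedin_subset[OF FC(1)] by (auto simp: T_def)
  have T: "compact_space T" "Hausdorff_space T"
    using FC(2) Haus by (simp_all add: T_def compactin_subspace Hausdorff_space_subtopology)
  have wT: "w \<in> topspace T" using F(2) NC(4,5) topT by auto
  have "connected_component_of_set T w \<subseteq> connected_component_of_set (subtopology X F) w"
  proof (rule connected_component_of_maximal)
    have c: "connectedin T (connected_component_of_set T w)" by (rule connectedin_connected_component_of)
    moreover have "connected_component_of_set T w \<subseteq> F"
      using connectedin_subset_topspace[OF c] topT by auto
    ultimately show "connectedin (subtopology X F) (connected_component_of_set T w)"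
      by (simp add: T_def connectedin_subtopology)
    show "w \<in> connected_component_of_set T w" using wT by (simp add: connected_component_of_refl)
  qed
  moreover have "w \<in> connected_component_of_set T w" using wT by (simp add: connected_component_of_refl)
  ultimately have "connected_component_of_set T w = {w}" using F(3) by auto
  moreover have "quasi_component_of T w = connected_component_of T w"
    using quasi_eq_connected_components_of[of T] T quasi_eq_connected_components_of_pointwise_alt[of T] by blast
  ultimately have Q: "quasi_component_of_set T w = {w}" by simp
  have "{w} \<in> quasi_components_of T"
    using quasi_component_in_quasi_components_of[of T w] wT unfolding Q by simp
  moreover have S: "compactin T (F \<inter> C - N)"
  proof -
    have "closedin X (F \<inter> C - N)" using FC(1) NC(1) by blast
    then have "compactin X (F \<inter> C - N)" by (rule closed_compactin[OF FC(2), rotated]) auto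
    then show ?thesis by (auto simp: T_def compactin_subtopology)
  qed
  ultimately have "separated_between T {w} (F \<inter> C - N)"
    using separated_between_quasi_component_compact NC(4) by (metis DiffE disjnt_insert1 disjnt_empty1)
  then obtain H H' where H: "closedin T H" "closedin T H'" "H \<union> H' = F \<inter> C" "disjnt H H'"
      "w \<in> H" "F \<inter> C - N \<subseteq> H'"
    unfolding separated_between_alt topT by auto
  have HX: "closedin X H" "closedin X H'"
    using H(1,2) closedin_closed_subtopology[OF FC(1)] unfolding T_def by blast+
  have "openin X (N - H')" using NC(1) HX(2) by blast
  moreover have "H \<subseteq> N - H'" using H(3,4,6) by (auto simp: disjnt_iff)
  ultimately obtain G where G: "openin X G" "H \<subseteq> G" "X closure_of G \<subseteq> N - H'"
    using T5_shrinking[OF X(1) HX(1)] by metis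
  have sub: "X closure_of G \<subseteq> C" using G(3) NC(5) by blast
  show thesis
  proof
    show "openin X G" "w \<in> G" using G(1,2) H(5) by auto
    show "compactin X (X closure_of G)" by (rule closed_compactin[OF NC(2) sub]) simp
    show "X closure_of G \<subseteq> V" using sub NC(6) by blast
    show "X frontier_of G \<inter> F = {}"
    proof -
      have "X frontier_of G = X closure_of G - G" by (rule frontier_of_openin[OF G(1)])
      then have "X frontier_of G \<inter> F \<subseteq> (F \<inter> C) - H - H'" using sub G(2,3) by blast
      then show ?thesis using H(3) by blast
    qed
  qed
qed

lemma chart_compact_complement:
  assumes n: "1 < n" and V: "V \<subseteq> topspace X" "subtopology X V homeomorphic_space Euclidean_space n"
    and K: "compactin X K" "K \<subseteq> V"
  obtains R D where "path_connectedin X R" "R \<noteq> {}" "R \<subseteq> V - K" "compactin X D" "D \<subseteq> V" "V - R \<subseteq> D"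
proof -
  let ?E = "Euclidean_space n"
  have topV: "topspace (subtopology X V) = V" using V(1) by auto
  obtain \<phi> \<psi> where hm: "homeomorphic_maps (subtopology X V) ?E \<phi> \<psi>"
    using V(2) unfolding homeomorphic_space_def by auto
  then have cont: "continuous_map (subtopology X V) ?E \<phi>" "continuous_map ?E (subtopology X V) \<psi>"
    and inv: "\<And>x. x \<in> V \<Longrightarrow> \<psi> (\<phi> x) = x" "\<And>y. y \<in> topspace ?E \<Longrightarrow> \<phi> (\<psi> y) = y"
    unfolding homeomorphic_maps_def topV by auto
  have inE: "\<phi> x \<in> topspace ?E" if "x \<in> V" for x
    using continuous_map_image_subset_topspace[OF cont(1)] that unfolding topV by blast
  have inV: "\<psi> y \<in> V" if "y \<in> topspace ?E" for y
    using continuous_map_image_subset_topspace[OF cont(2)] that unfolding topV by blast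
  have "compactin (subtopology X V) K" using K by (simp add: compactin_subtopology)
  from image_compactin[OF this cont(1)]
  obtain r where r: "0 < r" "\<forall>x\<in>\<phi> ` K. \<forall>i<n. \<bar>x i\<bar> < r"
    by (rule compactin_Euclidean_bounded)
  define R0 where "R0 = {x \<in> topspace ?E. \<exists>i<n. r \<le> \<bar>x i\<bar>}"
  define D0 where "D0 = {x \<in> topspace ?E. \<forall>i<n. \<bar>x i\<bar> \<le> r}"
  show thesis
  proof
    have "path_connectedin (subtopology X V) (\<psi> ` R0)"
      unfolding R0_def using path_connectedin_continuous_map_image[OF cont(2)]
        path_connected_Euclidean_box_complement[OF n] r(1) by (meson less_imp_le)
    then show "path_connectedin X (\<psi> ` R0)" by (simp add: path_connectedin_subtopology)
    have "(\<lambda>i. if i = 0 then r else 0) \<in> R0" using n r(1) by (auto simp: R0_def topspace_Euclidean_space intro!: exI[of _ 0])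
    then show "\<psi> ` R0 \<noteq> {}" by blast
    show "\<psi> ` R0 \<subseteq> V - K"
    proof (rule image_subsetI)
      fix y assume y: "y \<in> R0"
      then obtain i where i: "y \<in> topspace ?E" "i < n" "r \<le> \<bar>y i\<bar>" by (auto simp: R0_def)
      have "\<psi> y \<notin> K"
      proof
        assume "\<psi> y \<in> K"
        then have "\<phi> (\<psi> y) \<in> \<phi> ` K" by (rule imageI)
        then have "\<bar>y i\<bar> < r" using r(2) i(2) unfolding inv(2)[OF i(1)] by blast
        then show False using i(3) by simp
      qed
      then show "\<psi> y \<in> V - K" using inV[OF i(1)] by simp
    qed
    have "compactin (subtopology X V) (\<psi> ` D0)"
      unfolding D0_def by (rule image_compactin[OF compactin_Euclidean_box cont(2)])
    then show "compactin X (\<psi> ` D0)" "\<psi> ` D0 \<subseteq> V" by (simp_all add: compactin_subtopology)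
    show "V - \<psi> ` R0 \<subseteq> \<psi> ` D0"
    proof
      fix x assume x: "x \<in> V - \<psi> ` R0"
      then have "x = \<psi> (\<phi> x)" "\<phi> x \<in> topspace ?E" using inv(1) inE by auto
      moreover have "\<phi> x \<notin> R0" using x \<open>x = \<psi> (\<phi> x)\<close> by auto
      ultimately have "\<phi> x \<in> D0" by (auto simp: R0_def D0_def)
      then show "x \<in> \<psi> ` D0" using \<open>x = \<psi> (\<phi> x)\<close> by auto
    qed
  qed
qed

text \<open>
  The straight-line homotopy in a chart.
\<close>

lemma chart_path_homotopy:
  assumes V: "subtopology X V homeomorphic_space Euclidean_space n"
    and a: "pathin (subtopology X V) a" and b: "pathin (subtopology X V) b"
    and ends: "a 0 = b 0" "a 1 = b 1"
  obtains h where "continuous_map (top_of_set ({0..1} \<times> {0..1 :: real})) (subtopology X V) h"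
    "\<And>t. t \<in> {0..1} \<Longrightarrow> h (t, 0) = a t" "\<And>t. t \<in> {0..1} \<Longrightarrow> h (t, 1) = b t"
    "\<And>s. s \<in> {0..1} \<Longrightarrow> h (0, s) = a 0" "\<And>s. s \<in> {0..1} \<Longrightarrow> h (1, s) = a 1"
proof -
  let ?E = "Euclidean_space n" and ?Y = "subtopology X V" and ?Q = "top_of_set ({0..1} \<times> {0..1 :: real})"
  obtain \<phi> \<psi> where "homeomorphic_maps ?Y ?E \<phi> \<psi>"
    using V unfolding homeomorphic_space_def by auto
  then have cont: "continuous_map ?Y ?E \<phi>" "continuous_map ?E ?Y \<psi>"
    and inv: "\<And>x. x \<in> topspace ?Y \<Longrightarrow> \<psi> (\<phi> x) = x"
    unfolding homeomorphic_maps_def by auto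
  have inY: "a t \<in> topspace ?Y" "b t \<in> topspace ?Y" if "t \<in> {0..1}" for t
    using continuous_map_image_subset_topspace[OF a[unfolded pathin_def]]
      continuous_map_image_subset_topspace[OF b[unfolded pathin_def]] that by auto
  define k where "k = (\<lambda>p i. (1 - snd p) * \<phi> (a (fst p)) i + snd p * \<phi> (b (fst p)) i :: real)"
  have fst01: "continuous_map ?Q (top_of_set {0..1}) fst"
    by (auto simp: continuous_map_in_subtopology intro: continuous_intros)
  have coord: "continuous_map ?Q euclideanreal (\<lambda>p. \<phi> (c (fst p)) i)" if "pathin ?Y c" for c i
  proof -
    have "continuous_map (top_of_set {0..1}) euclideanreal ((\<lambda>x. x i) \<circ> (\<phi> \<circ> c))"
      using that cont(1) continuous_map_Euclidean_coordinate
      unfolding pathin_def by (intro continuous_map_compose)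
    from continuous_map_compose[OF fst01 this] show ?thesis by (simp add: o_def)
  qed
  have snd: "continuous_map ?Q euclideanreal snd" by (auto intro: continuous_intros)
  have "continuous_map ?Q ?E (\<lambda>p i. if i < n then k p i else 0)"
    unfolding continuous_map_componentwise_Euclidean_space k_def
    by (intro allI impI continuous_map_add continuous_map_real_mult continuous_map_diff coord a b snd) simp
  moreover have "(\<lambda>i. if i < n then k p i else 0) = k p" if p: "p \<in> {0..1} \<times> {0..1}" for p
  proof -
    have "fst p \<in> {0..1}" using p by auto
    then have "\<phi> (a (fst p)) \<in> topspace ?E" "\<phi> (b (fst p)) \<in> topspace ?E"
      using inY continuous_map_image_subset_topspace[OF cont(1)] by blast+
    then show ?thesis by (auto simp: k_def topspace_Euclidean_space)
  qed
  ultimately have "continuous_map ?Q ?E k"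
    by (rule continuous_map_eq) auto
  then have "continuous_map ?Q ?Y (\<psi> \<circ> k)" using cont(2) by (rule continuous_map_compose)
  moreover have "(\<psi> \<circ> k) (t, 0) = a t" "(\<psi> \<circ> k) (t, 1) = b t" if "t \<in> {0..1}" for t
    using inv inY[OF that] by (simp_all add: k_def)
  moreover have "(\<psi> \<circ> k) (e, s) = a e" if "e = 0 \<or> e = 1" for e s :: real
  proof -
    have "a e = b e" using that ends by auto
    then have "k (e, s) = \<phi> (a e)" by (auto simp: k_def algebra_simps)
    moreover have "a e \<in> topspace ?Y" using inY(1)[of e] that by auto
    ultimately show ?thesis using inv by simp
  qed
  ultimately show thesis by (intro that[of "\<psi> \<circ> k"]) auto
qed

text \<open>
  Pulling the sets back along a homotopy between the two paths reduces the claim to the square. This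
  is how a statement about a space of arbitrary dimension follows from one about the plane.
\<close>

lemma chart_two_sided_separation:
  assumes V: "openin X V" "subtopology X V homeomorphic_space Euclidean_space n"
    and G: "openin X G" "w \<in> G" "q \<notin> X closure_of G"
    and J: "closedin X J" "closedin X L" "J \<inter> L = {}" "X frontier_of G = J \<union> L"
    and pa: "path_component_of (subtopology X (V - J)) w q"
    and pb: "path_component_of (subtopology X (V - L)) w q"
  shows False
proof -
  obtain a where a: "pathin (subtopology X (V - J)) a" "a 0 = w" "a 1 = q"
    using pa unfolding path_component_of_def by blast
  obtain b where b: "pathin (subtopology X (V - L)) b" "b 0 = w" "b 1 = q"
    using pb unfolding path_component_of_def by blast
  have aV: "pathin (subtopology X V) a" "\<And>t. t \<in> {0..1} \<Longrightarrow> a t \<notin> J"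
    using a(1) unfolding pathin_def continuous_map_in_subtopology by auto
  have bV: "pathin (subtopology X V) b" "\<And>t. t \<in> {0..1} \<Longrightarrow> b t \<notin> L"
    using b(1) unfolding pathin_def continuous_map_in_subtopology by auto
  let ?Q = "{0..1} \<times> {0..1} :: (real \<times> real) set"
  obtain h where h: "continuous_map (top_of_set ?Q) (subtopology X V) h"
    "\<And>t. t \<in> {0..1} \<Longrightarrow> h (t, 0) = a t" "\<And>t. t \<in> {0..1} \<Longrightarrow> h (t, 1) = b t"
    "\<And>s. s \<in> {0..1} \<Longrightarrow> h (0, s) = a 0" "\<And>s. s \<in> {0..1} \<Longrightarrow> h (1, s) = a 1"
    by (rule chart_path_homotopy[OF V(2) aV(1) bV(1)]) (use a(2,3) b(2,3) in simp_all)
  have hX: "continuous_map (top_of_set ?Q) X h" using h(1) by (simp add: continuous_map_in_subtopology)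
  have cl: "closed {p \<in> ?Q. h p \<in> C}" if "closedin X C" for C
  proof -
    have "closedin (top_of_set ?Q) {p \<in> ?Q. h p \<in> C}"
      using closedin_continuous_map_preimage[OF hX that] by simp
    moreover have "closed ?Q" by (intro closed_Times) auto
    ultimately show ?thesis using closedin_closed_trans by blast
  qed
  have hin: "h p \<in> topspace X" if "p \<in> ?Q" for p
    using continuous_map_image_subset_topspace[OF hX] that by auto
  have fr: "J \<union> L = X closure_of G - G" using J(4) frontier_of_openin[OF G(1)] by simp
  have GX: "G \<subseteq> X closure_of G" by (rule closure_of_subset[OF openin_subset[OF G(1)]])
  show False
  proof (rule square_separation[of "{p \<in> ?Q. h p \<in> X closure_of G}" "{p \<in> ?Q. h p \<in> topspace X - G}"
        "{p \<in> ?Q. h p \<in> J}" "{p \<in> ?Q. h p \<in> L}"])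
    show "closed {p \<in> ?Q. h p \<in> X closure_of G}" by (rule cl) simp
    show "closed {p \<in> ?Q. h p \<in> topspace X - G}" by (rule cl) (use G(1) in blast)
    show "closed {p \<in> ?Q. h p \<in> J}" by (rule cl[OF J(1)])
    show "closed {p \<in> ?Q. h p \<in> L}" by (rule cl[OF J(2)])
    show "{p \<in> ?Q. h p \<in> X closure_of G} \<union> {p \<in> ?Q. h p \<in> topspace X - G} = ?Q"
      using hin GX by blast
    show "{p \<in> ?Q. h p \<in> X closure_of G} \<inter> {p \<in> ?Q. h p \<in> topspace X - G} =
        {p \<in> ?Q. h p \<in> J} \<union> {p \<in> ?Q. h p \<in> L}"
      using hin fr by blast
    show "{p \<in> ?Q. h p \<in> J} \<inter> {p \<in> ?Q. h p \<in> L} = {}" using J(3) by blast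
    show "(0, s) \<in> {p \<in> ?Q. h p \<in> X closure_of G}" if "s \<in> {0..1}" for s :: real
      using h(4)[OF that] a(2) G(2) GX that by auto
    show "(1, s) \<in> {p \<in> ?Q. h p \<in> topspace X - G}" if "s \<in> {0..1}" for s :: real
      using h(5)[OF that] a(3) G(3) GX that hin[of "(1, s)"] by auto
    show "(t, 0) \<notin> {p \<in> ?Q. h p \<in> J}" if "t \<in> {0..1}" for t :: real
      using h(2)[OF that] aV(2)[OF that] by auto
    show "(t, 1) \<notin> {p \<in> ?Q. h p \<in> L}" if "t \<in> {0..1}" for t :: real
      using h(3)[OF that] bV(2)[OF that] by auto
  qed
qed

text \<open>
  Let \<open>G\<close> be a small neighbourhood of \<open>w\<close> whose frontier misses the boundary of \<open>U\<close>. Then the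
  frontier splits into compact parts \<open>J\<close>, inside \<open>U\<close>, and \<open>L\<close>, outside the closure of \<open>U\<close>. Together
  they separate \<open>w\<close> from a path connected set \<open>R\<close> around the end of a chart \<open>V\<close>. By
  \<open>chart_two_sided_separation\<close>, one of them does so alone, and the path component of \<open>w\<close> in the
  complement of that part is the required neighbourhood.
\<close>

theorem neighbourhood_with_one_sided_frontier:
  assumes X: "T5_space X" "locally_Euclidean n X" and n: "1 < n"
    and U: "openin X U" and w: "w \<in> X closure_of U - U"
    and comp: "connected_component_of_set (subtopology X (X closure_of U - U)) w = {w}"
    and W: "openin X W" "w \<in> W"
  obtains \<Omega> where "openin X \<Omega>" "w \<in> \<Omega>" "compactin X (X closure_of \<Omega>)" "X closure_of \<Omega> \<subseteq> W"
    "X frontier_of \<Omega> \<subseteq> U \<or> X frontier_of \<Omega> \<inter> X closure_of U = {}"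
proof -
  note result = that
  have Haus: "Hausdorff_space X" by (rule T5_imp_Hausdorff[OF X(1)])
  have lc: "locally_compact_space X" by (rule locally_Euclidean_imp_locally_compact[OF X(2)])
  obtain V where V: "openin X V" "w \<in> V" "V \<subseteq> W" "subtopology X V homeomorphic_space Euclidean_space n"
    by (rule locally_EuclideanD[OF X(2) W])
  have "closedin X (X closure_of U - U)" by (rule closedin_diff[OF closedin_closure_of U])
  then obtain G where G: "openin X G" "w \<in> G" "compactin X (X closure_of G)" "X closure_of G \<subseteq> V"
    "X frontier_of G \<inter> (X closure_of U - U) = {}"
    by (rule neighbourhood_with_frontier_off_closed_set[OF X(1) lc _ w comp V(1,2)])
  obtain R D where R: "path_connectedin X R" "R \<noteq> {}" "R \<subseteq> V - X closure_of G" "compactin X D" "D \<subseteq> V"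
      "V - R \<subseteq> D"
    by (rule chart_compact_complement[OF n openin_subset[OF V(1)] V(4) G(3,4)])
  define J where "J = X frontier_of G \<inter> X closure_of U"
  define L where "L = X frontier_of G - U"
  have fr: "X frontier_of G = X closure_of G - G" by (rule frontier_of_openin[OF G(1)])
  have UX: "U \<subseteq> X closure_of U" by (rule closure_of_subset[OF openin_subset[OF U]])
  have Jc: "closedin X J" unfolding J_def by (intro closedin_Int closedin_frontier_of closedin_closure_of)
  have J: "J \<subseteq> U" "w \<notin> J" using G(2,5) fr unfolding J_def by auto
  have Lc: "closedin X L" unfolding L_def by (rule closedin_diff[OF closedin_frontier_of U])
  have L: "L \<inter> X closure_of U = {}" "L \<subseteq> X closure_of G" "w \<notin> L"
    using G(2,5) fr unfolding L_def by auto
  have JL: "J \<inter> L = {}" "X frontier_of G = J \<union> L" using J(1) UX unfolding J_def L_def by auto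
  have one: thesis if K: "closedin X K" "w \<notin> K" "K \<subseteq> U \<or> K \<inter> X closure_of U = {}"
    and miss: "\<And>q. q \<in> R \<Longrightarrow> \<not> path_component_of (subtopology X (V - K)) w q" for K
  proof -
    have VK: "openin X (V - K)" using V(1) K(1) by blast
    have lpc: "locally_path_connected_space (subtopology X (V - K))"
      using locally_path_connected_space_open_subset[OF locally_Euclidean_imp_locally_path_connected[OF X(2)] VK] .
    define \<Omega> where "\<Omega> = path_component_of_set (subtopology X (V - K)) w"
    have open_comp: "openin X (path_component_of_set (subtopology X (V - K)) z)" for z
      using openin_path_component_of_locally_path_connected_space[OF lpc, of z]
        openin_open_subtopology[OF VK] by blast
    have \<Omega>1: "openin X \<Omega>" unfolding \<Omega>_def by (rule open_comp)
    have \<Omega>V: "\<Omega> \<subseteq> V - K"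
      unfolding \<Omega>_def using path_component_of_subset_topspace[of "subtopology X (V - K)" w] by auto
    have "\<Omega> \<subseteq> D" using \<Omega>V miss R(6) unfolding \<Omega>_def by blast
    moreover have "closedin X D" using compactin_imp_closedin[OF Haus R(4)] .
    ultimately have clD: "X closure_of \<Omega> \<subseteq> D" by (rule closure_of_minimal)
    have "X frontier_of \<Omega> \<subseteq> K"
    proof
      fix z assume "z \<in> X frontier_of \<Omega>"
      then have z: "z \<in> X closure_of \<Omega>" "z \<notin> \<Omega>" using frontier_of_openin[OF \<Omega>1] by auto
      show "z \<in> K"
      proof (rule ccontr)
        assume "z \<notin> K"
        then have zV: "z \<in> topspace (subtopology X (V - K))"
          using z(1) clD R(5) openin_subset[OF V(1)] by auto
        let ?P = "path_component_of_set (subtopology X (V - K)) z"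
        have "z \<in> ?P" using zV by (simp add: path_component_of_refl)
        then have "?P \<inter> X closure_of \<Omega> \<noteq> {}" using z(1) by blast
        then have "?P \<inter> \<Omega> \<noteq> {}" unfolding openin_Int_closure_of_eq_empty[OF open_comp] .
        then obtain y where "path_component_of (subtopology X (V - K)) z y"
            "path_component_of (subtopology X (V - K)) w y" by (auto simp: \<Omega>_def)
        then have "path_component_of (subtopology X (V - K)) w z"
          by (meson path_component_of_sym path_component_of_trans)
        then show False using z(2) by (simp add: \<Omega>_def)
      qed
    qed
    then have side: "X frontier_of \<Omega> \<subseteq> U \<or> X frontier_of \<Omega> \<inter> X closure_of U = {}" using K(3) by blast
    have w\<Omega>: "w \<in> \<Omega>"
    proof -
      have "w \<in> topspace (subtopology X (V - K))" using V(2) K(2) openin_subset[OF V(1)] by auto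
      then show ?thesis unfolding \<Omega>_def by (simp add: path_component_of_refl)
    qed
    have cp: "compactin X (X closure_of \<Omega>)" by (rule closed_compactin[OF R(4) clD]) simp
    have "X closure_of \<Omega> \<subseteq> W" using clD R(5) V(3) by blast
    then show thesis by (rule result[OF \<Omega>1 w\<Omega> cp _ side])
  qed
  show thesis
  proof (cases "\<forall>q\<in>R. \<not> path_component_of (subtopology X (V - J)) w q")
    case True
    then show thesis using one[OF Jc J(2)] J(1) by blast
  next
    case False
    then obtain q where q: "q \<in> R" "path_component_of (subtopology X (V - J)) w q" by auto
    show thesis
    proof (rule one[OF Lc L(3)])
      show "L \<subseteq> U \<or> L \<inter> X closure_of U = {}" using L(1) by simp
      fix p assume p: "p \<in> R"
      show "\<not> path_component_of (subtopology X (V - L)) w p"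
      proof
        assume wp: "path_component_of (subtopology X (V - L)) w p"
        have "path_component_of (subtopology X R) p q"
          using R(1) p q(1) unfolding path_connectedin_def path_connected_space_iff_path_component by auto
        moreover have "R \<subseteq> V - L" using R(3) L(2) by blast
        ultimately have "path_component_of (subtopology X (V - L)) p q"
          by (meson path_component_of_mono)
        then have "path_component_of (subtopology X (V - L)) w q" using wp path_component_of_trans by metis
        moreover have "q \<notin> X closure_of G" using q(1) R(3) by blast
        ultimately show False
          using chart_two_sided_separation[OF V(1,4) G(1,2) _ Jc Lc JL q(2)] by blast
      qed
    qed
  qed
qed

section \<open>No copy of \<open>\<omega>\<^sub>1\<close> in a hereditarily normal manifold\<close>

lemma compactin_exhaustion_bounded:
  assumes P: "exhaustion X P" and K: "compactin X K" "K \<subseteq> (\<Union>\<beta>\<in>A. P \<beta>)" and A: "A \<noteq> {}"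
  shows "\<exists>\<beta>\<in>A. K \<subseteq> P \<beta>"
proof -
  have "\<exists>\<F>. finite \<F> \<and> \<F> \<subseteq> P ` A \<and> K \<subseteq> \<Union>\<F>"
    by (rule compactinD[OF K(1)]) (use exhaustionD(1)[OF P] K(2) in auto)
  then obtain F where F: "finite F" "F \<subseteq> A" "K \<subseteq> \<Union>(P ` F)" by (metis finite_subset_image)
  show ?thesis
  proof (cases "F = {}")
    case True
    then show ?thesis using F(3) A by auto
  next
    case False
    have "\<Union>(P ` F) \<subseteq> P (Max F)"
      by (intro UN_least exhaustion_mono[OF P] Max_ge F(1))
    then show ?thesis using F Max_in[OF F(1) False] by blast
  qed
qed

text \<open>
  Each \<open>w \<beta>\<close> appears in some \<open>P (r \<beta>)\<close>. Conversely, \<open>P \<gamma>\<close> contains \<open>w \<beta>\<close> only for \<open>\<beta>\<close> below some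
  \<open>s \<gamma>\<close>, since its trace on the copy is Lindelof and covered by the open initial segments. The limit
  ordinals closed under \<open>r\<close> and \<open>s\<close> are as required.
\<close>

lemma club_copy_on_boundary:
  assumes P: "exhaustion X P" and w: "embedding_map (euclidean :: omega1 topology) X w"
  shows "\<exists>C. club C \<and> (\<forall>\<alpha>\<in>C. limit_ord \<alpha> \<and> w \<alpha> \<in> X closure_of (P \<alpha>) - P \<alpha>)"
proof -
  note w' = embedding_omega1D[OF w]
  have "\<forall>\<beta>. \<exists>\<gamma>. w \<beta> \<in> P \<gamma>"
  proof
    fix \<beta>
    have "w \<beta> \<in> (\<Union>\<gamma>. P \<gamma>)" unfolding exhaustionD(6)[OF P] using w'(3) by auto
    then show "\<exists>\<gamma>. w \<beta> \<in> P \<gamma>" by auto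
  qed
  then obtain r where r: "\<And>\<beta>. w \<beta> \<in> P (r \<beta>)" by metis
  have "\<forall>\<gamma>. \<exists>\<delta>. \<forall>\<beta>. w \<beta> \<in> P \<gamma> \<longrightarrow> \<beta> < \<delta>"
  proof
    fix \<gamma>
    have "\<forall>\<delta>. \<exists>T. openin X T \<and> T \<inter> range w = w ` {..<\<delta>}" using w'(4) by simp
    then obtain T where T: "\<And>\<delta>. openin X (T \<delta>)" "\<And>\<delta>. T \<delta> \<inter> range w = w ` {..<\<delta>}" by metis
    let ?S = "range w \<inter> P \<gamma>"
    have "Lindelof_space (subtopology X ?S)"
      by (rule second_countable_imp_Lindelof_space[OF second_countable_subtopology_mono[OF exhaustionD(2)[OF P]]])
        (rule Int_lower2)
    moreover have "?S \<subseteq> topspace X" using w'(3) by auto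
    moreover have "?S \<subseteq> \<Union>(range T)"
    proof clarify
      fix \<beta> :: omega1
      obtain \<delta> where "\<beta> < \<delta>" using omega1_no_greatest by blast
      then show "w \<beta> \<in> \<Union>(range T)" using T(2)[of \<delta>] by blast
    qed
    ultimately obtain \<T> where \<T>: "countable \<T>" "\<T> \<subseteq> range T" "?S \<subseteq> \<Union>\<T>"
      using T(1) Lindelof_space_subtopology_subset[of ?S X] by (metis (no_types, lifting) rangeE)
    then obtain A where A: "countable A" "\<T> = T ` A" by (metis countable_subset_image)
    obtain \<delta> where \<delta>: "\<forall>\<alpha>\<in>A. \<alpha> < \<delta>" using countable_imp_bounded_omega1[OF A(1)] by auto
    have "\<beta> < \<delta>" if "w \<beta> \<in> P \<gamma>" for \<beta>
    proof -
      have "w \<beta> \<in> ?S" using that by simp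
      then obtain \<alpha> where \<alpha>: "\<alpha> \<in> A" "w \<beta> \<in> T \<alpha>" using \<T>(3) unfolding A(2) by auto
      then have "w \<beta> \<in> w ` {..<\<alpha>}" using T(2)[of \<alpha>] by auto
      then have "\<beta> < \<alpha>" using w'(2) by (auto simp: inj_eq)
      then show ?thesis using \<delta> \<alpha>(1) by (meson less_trans)
    qed
    then show "\<exists>\<delta>. \<forall>\<beta>. w \<beta> \<in> P \<gamma> \<longrightarrow> \<beta> < \<delta>" by auto
  qed
  then obtain s where s: "\<And>\<gamma> \<beta>. w \<beta> \<in> P \<gamma> \<Longrightarrow> \<beta> < s \<gamma>" by metis
  define C where "C = {\<alpha>. limit_ord \<alpha> \<and> (\<forall>\<beta><\<alpha>. max (r \<beta>) (s \<beta>) < \<alpha>)}"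
  have "club C" unfolding C_def by (rule club_limit_closed_under)
  moreover have "limit_ord \<alpha> \<and> w \<alpha> \<in> X closure_of (P \<alpha>) - P \<alpha>" if "\<alpha> \<in> C" for \<alpha>
  proof -
    have \<alpha>: "limit_ord \<alpha>" "\<And>\<beta>. \<beta> < \<alpha> \<Longrightarrow> r \<beta> < \<alpha>" "\<And>\<beta>. \<beta> < \<alpha> \<Longrightarrow> s \<beta> < \<alpha>"
      using that by (auto simp: C_def)
    have "w \<alpha> \<notin> P \<alpha>"
    proof
      assume "w \<alpha> \<in> P \<alpha>"
      then obtain \<gamma> where "\<gamma> < \<alpha>" "w \<alpha> \<in> P \<gamma>" unfolding exhaustionD(5)[OF P \<alpha>(1)] by auto
      then show False using s[of \<alpha> \<gamma>] \<alpha>(3)[of \<gamma>] by simp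
    qed
    moreover have "w \<alpha> \<in> X closure_of (P \<alpha>)"
      unfolding in_closure_of
    proof (intro conjI allI impI)
      show "w \<alpha> \<in> topspace X" using w'(3) by auto
      fix T assume "w \<alpha> \<in> T \<and> openin X T"
      then obtain \<beta> where \<beta>: "\<beta> < \<alpha>" "w ` {\<beta><..\<alpha>} \<subseteq> T"
        using omega1_neighbourhood[OF w, of T \<alpha>] \<alpha>(1) by auto
      then obtain \<gamma> where \<gamma>: "\<beta> < \<gamma>" "\<gamma> < \<alpha>" using \<alpha>(1) by (auto simp: limit_ord_def)
      have "w \<gamma> \<in> P \<alpha>" by (rule subsetD[OF exhaustion_mono[OF P less_imp_le[OF \<alpha>(2)[OF \<gamma>(2)]]] r])
      moreover have "w \<gamma> \<in> T" using \<beta>(2) \<gamma> by auto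
      ultimately show "\<exists>y. y \<in> P \<alpha> \<and> y \<in> T" by blast
    qed
    ultimately show ?thesis using \<alpha>(1) by simp
  qed
  ultimately show ?thesis by blast
qed

lemma connectedin_subset_open_if_avoids_frontier:
  assumes "connectedin X S" "S \<inter> \<Omega> \<noteq> {}" "S \<inter> X frontier_of \<Omega> = {}"
  shows "S \<subseteq> \<Omega>"
  using connectedin_Int_frontier_of[OF assms(1,2)] assms(3) by blast

text \<open>
  Suppose the set were stationary, and take neighbourhoods \<open>\<Omega> \<alpha>\<close> of \<open>w \<alpha>\<close> with one-sided frontier that
  omit some point of \<open>P \<alpha>\<close>. A frontier outside the closure of the connected set \<open>P \<alpha>\<close>
  would put all of \<open>P \<alpha>\<close> into \<open>\<Omega> \<alpha>\<close>. So the compact frontier lies in \<open>P \<alpha>\<close>, hence in \<open>P \<beta>\<close> for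
  one \<open>\<beta>\<close> that works for stationarily many \<open>\<alpha>\<close>. Then \<open>\<Omega> \<alpha>\<close> includes the whole component
  \<open>Q (w \<alpha>)\<close> of \<open>w \<alpha>\<close> outside the closure of \<open>P \<beta>\<close>. This component contains \<open>w \<delta>\<close> for all
  \<open>\<delta>\<close> in an interval ending at \<open>\<alpha>\<close>, so pressing down again makes it the same for stationarily many
  \<open>\<alpha>\<close>. A single \<open>\<Omega> \<alpha>\<close> would contain all these \<open>w \<alpha>\<close>, although its closure is compact.
\<close>

lemma trivial_boundary_components_nonstationary:
  assumes X: "T5_space X" "locally_Euclidean n X" and n: "1 < n"
    and P: "exhaustion X P" and w: "embedding_map (euclidean :: omega1 topology) X w"
    and S: "\<And>\<alpha>. \<alpha> \<in> S \<Longrightarrow> limit_ord \<alpha>" "\<And>\<alpha>. \<alpha> \<in> S \<Longrightarrow> w \<alpha> \<in> X closure_of (P \<alpha>) - P \<alpha>"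
      "\<And>\<alpha>. \<alpha> \<in> S \<Longrightarrow> connected_component_of_set (subtopology X (X closure_of (P \<alpha>) - P \<alpha>)) (w \<alpha>) = {w \<alpha>}"
  shows "\<not> stationary S"
proof
  assume st: "stationary S"
  note w' = embedding_omega1D[OF w]
  have Haus: "Hausdorff_space X" by (rule T5_imp_Hausdorff[OF X(1)])
  note lcon = locally_Euclidean_local_properties(4)[OF X(2)]
  have "\<exists>\<Omega>. openin X \<Omega> \<and> w \<alpha> \<in> \<Omega> \<and> compactin X (X closure_of \<Omega>) \<and> (\<exists>\<beta><\<alpha>. X frontier_of \<Omega> \<subseteq> P \<beta>)"
    if \<alpha>: "\<alpha> \<in> S" for \<alpha>
  proof -
    have "P \<alpha> \<noteq> {}" using S(2)[OF \<alpha>] by auto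
    then obtain p where p: "p \<in> P \<alpha>" by auto
    have "closedin X {p}"
      using Haus p openin_subset[OF exhaustionD(1)[OF P]] by (meson Hausdorff_imp_t1_space closedin_t1_singleton subsetD)
    then have Wo: "openin X (topspace X - {p})" by blast
    have Ww: "w \<alpha> \<in> topspace X - {p}" using w'(3) p S(2)[OF \<alpha>] by auto
    obtain \<Omega> where \<Omega>: "openin X \<Omega>" "w \<alpha> \<in> \<Omega>" "compactin X (X closure_of \<Omega>)"
        "X closure_of \<Omega> \<subseteq> topspace X - {p}"
        "X frontier_of \<Omega> \<subseteq> P \<alpha> \<or> X frontier_of \<Omega> \<inter> X closure_of (P \<alpha>) = {}"
      by (rule neighbourhood_with_one_sided_frontier[OF X n exhaustionD(1)[OF P] S(2)[OF \<alpha>] S(3)[OF \<alpha>] Wo Ww])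
    have cl\<Omega>: "\<Omega> \<subseteq> X closure_of \<Omega>" by (rule closure_of_subset[OF openin_subset[OF \<Omega>(1)]])
    have "X frontier_of \<Omega> \<inter> X closure_of (P \<alpha>) \<noteq> {}"
    proof
      assume no: "X frontier_of \<Omega> \<inter> X closure_of (P \<alpha>) = {}"
      have "\<Omega> \<inter> X closure_of (P \<alpha>) \<noteq> {}" using \<Omega>(2) S(2)[OF \<alpha>] by blast
      then have "\<Omega> \<inter> P \<alpha> \<noteq> {}" unfolding openin_Int_closure_of_eq_empty[OF \<Omega>(1)] .
      moreover have "P \<alpha> \<subseteq> X closure_of (P \<alpha>)" by (rule closure_of_subset[OF openin_subset[OF exhaustionD(1)[OF P]]])
      ultimately have "P \<alpha> \<subseteq> \<Omega>"
        using no by (intro connectedin_subset_open_if_avoids_frontier[OF exhaustionD(3)[OF P]]) blast+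
      then show False using p \<Omega>(4) cl\<Omega> by blast
    qed
    then have fr: "X frontier_of \<Omega> \<subseteq> P \<alpha>" using \<Omega>(5) by blast
    have "compactin X (X frontier_of \<Omega>)"
      by (rule closed_compactin[OF \<Omega>(3) _ closedin_frontier_of]) (simp add: frontier_of_def)
    moreover have "X frontier_of \<Omega> \<subseteq> (\<Union>\<beta>\<in>{..<\<alpha>}. P \<beta>)" using fr exhaustionD(5)[OF P S(1)[OF \<alpha>]] by simp
    moreover have "{..<\<alpha>} \<noteq> {}" using S(1)[OF \<alpha>] by (auto simp: limit_ord_def)
    ultimately have "\<exists>\<beta>\<in>{..<\<alpha>}. X frontier_of \<Omega> \<subseteq> P \<beta>" by (rule compactin_exhaustion_bounded[OF P])
    then show ?thesis using \<Omega>(1-3) by auto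
  qed
  then obtain \<Omega> g where \<Omega>: "\<And>\<alpha>. \<alpha> \<in> S \<Longrightarrow> openin X (\<Omega> \<alpha>)" "\<And>\<alpha>. \<alpha> \<in> S \<Longrightarrow> w \<alpha> \<in> \<Omega> \<alpha>"
      "\<And>\<alpha>. \<alpha> \<in> S \<Longrightarrow> compactin X (X closure_of (\<Omega> \<alpha>))" "\<And>\<alpha>. \<alpha> \<in> S \<Longrightarrow> g \<alpha> < \<alpha>"
      "\<And>\<alpha>. \<alpha> \<in> S \<Longrightarrow> X frontier_of (\<Omega> \<alpha>) \<subseteq> P (g \<alpha>)"
    by metis
  obtain \<beta> where \<beta>: "stationary {\<alpha>\<in>S. g \<alpha> = \<beta>}" by (rule pressing_down[OF st \<Omega>(4)])
  define S' where "S' = {\<alpha>\<in>S. g \<alpha> = \<beta>}"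
  have S': "S' \<subseteq> S" "\<And>\<alpha>. \<alpha> \<in> S' \<Longrightarrow> \<beta> < \<alpha>" "\<And>\<alpha>. \<alpha> \<in> S' \<Longrightarrow> X frontier_of (\<Omega> \<alpha>) \<subseteq> P \<beta>"
    using \<Omega>(4,5) by (auto simp: S'_def)
  define Z where "Z = topspace X - X closure_of (P \<beta>)"
  have Z: "openin X Z" unfolding Z_def by (intro openin_diff openin_topspace closedin_closure_of)
  have lZ: "locally_connected_space (subtopology X Z)"
    using locally_connected_space_open_subset lcon Z by blast
  define Q where "Q x = connected_component_of_set (subtopology X Z) x" for x
  have Q: "openin X (Q x)" "connectedin X (Q x)" "Q x \<subseteq> Z" for x
  proof -
    have "openin (subtopology X Z) (Q x)" unfolding Q_def
      by (rule openin_connected_component_of_locally_connected_space[OF lZ])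
    then show "openin X (Q x)" using openin_open_subtopology[OF Z] by blast
    have c: "connectedin (subtopology X Z) (Q x)" unfolding Q_def by (rule connectedin_connected_component_of)
    then show "connectedin X (Q x)" "Q x \<subseteq> Z" by (simp_all add: connectedin_subtopology)
  qed
  have wQ: "w \<alpha> \<in> Q (w \<alpha>)" if "\<alpha> \<in> S'" for \<alpha>
  proof -
    have "w \<alpha> \<notin> X closure_of (P \<beta>)"
      using exhaustionD(4)[OF P S'(2)[OF that]] S(2)[of \<alpha>] S'(1) that by blast
    then have "w \<alpha> \<in> topspace (subtopology X Z)" using w'(3) by (auto simp: Z_def)
    then show ?thesis unfolding Q_def by (simp add: connected_component_of_refl)
  qed
  have PclP: "P \<beta> \<subseteq> X closure_of (P \<beta>)" by (rule closure_of_subset[OF openin_subset[OF exhaustionD(1)[OF P]]])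
  have Q\<Omega>: "Q (w \<alpha>) \<subseteq> \<Omega> \<alpha>" if "\<alpha> \<in> S'" for \<alpha>
  proof (rule connectedin_subset_open_if_avoids_frontier[OF Q(2)])
    show "Q (w \<alpha>) \<inter> \<Omega> \<alpha> \<noteq> {}" using wQ[OF that] \<Omega>(2) S'(1) that by blast
    show "Q (w \<alpha>) \<inter> X frontier_of (\<Omega> \<alpha>) = {}"
      using S'(3)[OF that] Q(3)[of "w \<alpha>"] PclP unfolding Z_def by blast
  qed
  have "\<exists>\<gamma><\<alpha>. w ` {\<gamma><..\<alpha>} \<subseteq> Q (w \<alpha>)" if "\<alpha> \<in> S'" for \<alpha>
    by (rule omega1_neighbourhood[OF w Q(1) wQ[OF that] S(1)]) (use S'(1) that in blast)
  then obtain f where f: "\<And>\<alpha>. \<alpha> \<in> S' \<Longrightarrow> f \<alpha> < \<alpha>" "\<And>\<alpha>. \<alpha> \<in> S' \<Longrightarrow> w ` {f \<alpha><..\<alpha>} \<subseteq> Q (w \<alpha>)" by metis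
  obtain \<gamma> where \<gamma>: "stationary {\<alpha>\<in>S'. f \<alpha> = \<gamma>}"
    by (rule pressing_down[OF \<beta>[folded S'_def] f(1)])
  \<comment> \<open>the neighbourhoods \<open>Q (w \<alpha>)\<close> with \<open>f \<alpha> = \<gamma>\<close> all contain the point just above \<open>\<gamma>\<close>\<close>
  define \<delta> where "\<delta> = next_ord \<gamma>"
  have Qeq: "Q (w \<alpha>) = Q (w \<delta>)" if \<alpha>: "\<alpha> \<in> S'" "f \<alpha> = \<gamma>" for \<alpha>
  proof -
    have "\<delta> \<in> {f \<alpha><..\<alpha>}" using \<alpha> f(1)[OF \<alpha>(1)] less_next_ord next_ord_le by (auto simp: \<delta>_def)
    then have "w \<delta> \<in> Q (w \<alpha>)" using f(2)[OF \<alpha>(1)] by blast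
    then show ?thesis unfolding Q_def by (simp add: connected_component_of_equiv)
  qed
  obtain \<alpha>0 where \<alpha>0: "\<alpha>0 \<in> S'" "f \<alpha>0 = \<gamma>" using stationary_unbounded[OF \<gamma>] by blast
  then have \<alpha>0S: "\<alpha>0 \<in> S" using S'(1) by blast
  have "X closure_of (\<Omega> \<alpha>0) \<subseteq> (\<Union>\<mu>\<in>UNIV. P \<mu>)"
    using closure_of_subset_topspace[of X] exhaustionD(6)[OF P] by simp
  from compactin_exhaustion_bounded[OF P \<Omega>(3)[OF \<alpha>0S] this]
  obtain \<mu> where \<mu>: "X closure_of (\<Omega> \<alpha>0) \<subseteq> P \<mu>" by auto
  obtain \<alpha> where \<alpha>: "\<alpha> \<in> S'" "f \<alpha> = \<gamma>" "\<mu> < \<alpha>" using stationary_unbounded[OF \<gamma>, of \<mu>] by blast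
  have "w \<alpha> \<in> Q (w \<alpha>0)" using wQ[OF \<alpha>(1)] Qeq[OF \<alpha>(1,2)] Qeq[OF \<alpha>0] by simp
  then have "w \<alpha> \<in> P \<mu>"
    using Q\<Omega>[OF \<alpha>0(1)] closure_of_subset[OF openin_subset[OF \<Omega>(1)[OF \<alpha>0S]]] \<mu> by blast
  then have "w \<alpha> \<in> P \<alpha>" by (rule subsetD[OF exhaustion_mono[OF P less_imp_le[OF \<alpha>(3)]]])
  then show False using S(2)[of \<alpha>] S'(1) \<alpha>(1) by blast
qed

lemma sequentially_compact_contains_omega1:
  assumes PPI: "PPI_plus TYPE('a)" and X: "T5_space (X :: 'a topology)" "first_countable X"
    and K: "sequentially_compact_space (subtopology X K)" "\<not> compact_space (subtopology X K)"
  shows "\<exists>w. embedding_map (euclidean :: omega1 topology) X w \<and> range w \<subseteq> K"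
proof -
  have "contains_copy_of_omega1 (subtopology X K)"
    using PPI K T5_subtopology[OF X(1), of K] first_countable_subtopology[OF X(2), of K]
    unfolding PPI_plus_def by (simp add: T5_imp_Hausdorff T5_imp_regular)
  from contains_copy_imp_embedding[OF this]
  obtain w where "embedding_map (euclidean :: omega1 topology) (subtopology X K) w" ..
  then have "embedding_map euclidean X w" "range w \<subseteq> K"
    by (auto simp: embedding_map_in_subtopology)
  then show ?thesis by blast
qed

lemma connectedin_subset_omega1_copy:
  assumes w: "embedding_map (euclidean :: omega1 topology) X w"
    and S: "connectedin X S" "S \<subseteq> range w" "w \<alpha> \<in> S"
  shows "S = {w \<alpha>}"
proof -
  have hm: "homeomorphic_map euclidean (subtopology X (range w)) w"
    using w by (simp add: embedding_map_def)
  have img: "w ` (w -` S) = S" using S(2) by blast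
  have "connectedin (subtopology X (range w)) (w ` (w -` S))"
    unfolding img using S(1,2) by (simp add: connectedin_subtopology)
  then have "connected (w -` S)"
    using homeomorphic_map_connectedness[OF hm, of "w -` S"] by simp
  then have "w -` S = {\<alpha>}" using connected_omega1_imp_eq S(3) by auto
  then show ?thesis using img by auto
qed

text \<open>
  For stationarily many \<open>\<alpha>\<close> the component \<open>cc \<alpha>\<close> of \<open>w \<alpha>\<close> in the boundary of \<open>P \<alpha>\<close> is
  nontrivial, and it is not contained in the copy, which has no nontrivial connected subsets. The dichotomy is used
  twice: for points \<open>y \<alpha>\<close> of \<open>cc \<alpha>\<close> off the copy, to get the function \<open>f\<close>, and for points
  \<open>e \<alpha>\<close> of \<open>cc \<alpha>\<close> on the boundary \<open>E\<close> of \<open>{f \<noteq> 0}\<close>, to get a copy of \<open>\<omega>\<^sub>1\<close> inside \<open>E\<close>.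
\<close>

theorem no_omega1_copy:
  assumes ax: "CW TYPE('a)" "PPI_plus TYPE('a)" "|UNIV :: omega1 set| <o bounding_number" P22
    and X: "T5_space (X :: 'a topology)" "locally_Euclidean n X" and n: "1 < n"
    and P: "exhaustion X P"
  shows "\<not> embedding_map (euclidean :: omega1 topology) X w"
proof
  assume w: "embedding_map (euclidean :: omega1 topology) X w"
  note w' = embedding_omega1D[OF w]
  note lc = locally_Euclidean_local_properties(1)[OF X(2)]
    and lsc = locally_Euclidean_local_properties(2)[OF X(2)]
    and fc = locally_Euclidean_local_properties(3)[OF X(2)]
    and lcon = locally_Euclidean_local_properties(4)[OF X(2)]
  have Haus: "Hausdorff_space X" by (rule T5_imp_Hausdorff[OF X(1)])
  define bd where "bd \<alpha> = X closure_of (P \<alpha>) - P \<alpha>" for \<alpha>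
  define cc where "cc \<alpha> = connected_component_of_set (subtopology X (bd \<alpha>)) (w \<alpha>)" for \<alpha>
  obtain C where C: "club C" "\<And>\<alpha>. \<alpha> \<in> C \<Longrightarrow> limit_ord \<alpha>" "\<And>\<alpha>. \<alpha> \<in> C \<Longrightarrow> w \<alpha> \<in> bd \<alpha>"
    using club_copy_on_boundary[OF P w] unfolding bd_def by auto
  define B where "B = {\<alpha>\<in>C. cc \<alpha> \<noteq> {w \<alpha>}}"
  have B: "stationary B"
    unfolding stationary_def
  proof (intro allI impI notI)
    fix D assume D: "club D" "B \<inter> D = {}"
    have "\<not> stationary (C \<inter> D)"
    proof (rule trivial_boundary_components_nonstationary[OF X n P w])
      fix \<alpha> assume \<alpha>: "\<alpha> \<in> C \<inter> D"
      show "limit_ord \<alpha>" "w \<alpha> \<in> X closure_of (P \<alpha>) - P \<alpha>" using C(2,3)[of \<alpha>] \<alpha> by (auto simp: bd_def)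
      show "connected_component_of_set (subtopology X (X closure_of (P \<alpha>) - P \<alpha>)) (w \<alpha>) = {w \<alpha>}"
        using \<alpha> D(2) unfolding B_def cc_def bd_def by blast
    qed
    then show False using club_imp_stationary[OF club_Int[OF C(1) D(1)]] by simp
  qed
  have cc: "connectedin X (cc \<alpha>)" "cc \<alpha> \<subseteq> bd \<alpha>" for \<alpha>
  proof -
    have c: "connectedin (subtopology X (bd \<alpha>)) (cc \<alpha>)" unfolding cc_def by (rule connectedin_connected_component_of)
    then show "connectedin X (cc \<alpha>)" "cc \<alpha> \<subseteq> bd \<alpha>" by (simp_all add: connectedin_subtopology)
  qed
  have wcc: "w \<alpha> \<in> cc \<alpha>" if "\<alpha> \<in> C" for \<alpha>
  proof -
    have "w \<alpha> \<in> topspace (subtopology X (bd \<alpha>))" using C(3)[OF that] w'(3) by auto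
    then show ?thesis unfolding cc_def by (simp add: connected_component_of_refl)
  qed
  have "\<exists>y. y \<in> cc \<alpha> \<and> y \<notin> range w" if \<alpha>: "\<alpha> \<in> B" for \<alpha>
  proof (rule ccontr)
    assume "\<not> ?thesis"
    then have "cc \<alpha> \<subseteq> range w" by blast
    moreover have "w \<alpha> \<in> cc \<alpha>" using wcc \<alpha> by (simp add: B_def)
    ultimately have "cc \<alpha> = {w \<alpha>}" by (rule connectedin_subset_omega1_copy[OF w cc(1)])
    then show False using \<alpha> by (simp add: B_def)
  qed
  then obtain y where y: "\<And>\<alpha>. \<alpha> \<in> B \<Longrightarrow> y \<alpha> \<in> cc \<alpha>" "\<And>\<alpha>. \<alpha> \<in> B \<Longrightarrow> y \<alpha> \<notin> range w" by metis
  have ybd: "y \<alpha> \<in> X closure_of (P \<alpha>) - P \<alpha>" if "\<alpha> \<in> B" for \<alpha>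
    using y(1)[OF that] cc(2)[of \<alpha>] unfolding bd_def by blast
  have clW: "closedin X (range w)" by (rule closedin_omega1_image[OF Haus fc w closed_UNIV])
  have Go: "openin X (topspace X - range w)" using clW by blast
  have yG: "y \<alpha> \<in> topspace X - range w" if "\<alpha> \<in> B" for \<alpha>
    using ybd[OF that] y(2)[OF that] closure_of_subset_topspace[of X "P \<alpha>"] by blast
  obtain D K where DK: "D \<subseteq> B" "stationary D" "y ` D \<subseteq> K" "K \<subseteq> topspace X - range w" "closedin X K"
    by (rule boundary_selection_sequentially_compact[OF ax(1,3,4) X(1) lc lsc P Go B ybd yG])
  have "disjnt (range w) K" using DK(4) by (auto simp: disjnt_iff)
  then obtain f where f0: "continuous_map X (top_of_set {0..1 :: real}) f" "f ` range w \<subseteq> {0}" "f ` K \<subseteq> {1}"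
    using Urysohn_lemma[OF T5_imp_normal[OF X(1)] clW DK(5), of 0 1] by auto
  have f: "continuous_map X euclideanreal f" using f0(1) continuous_map_in_subtopology by blast
  define A where "A = {x \<in> topspace X. f x \<noteq> 0}"
  have Ao: "openin X A"
  proof -
    have "openin X {x \<in> topspace X. f x \<in> - {0}}"
      by (rule openin_continuous_map_preimage[OF f]) (simp add: open_Compl)
    then show ?thesis by (simp add: A_def)
  qed
  define E where "E = X closure_of A - A"
  have E: "closedin X E" unfolding E_def by (rule closedin_diff[OF closedin_closure_of Ao])
  have "\<exists>e. e \<in> cc \<alpha> \<inter> E" if \<alpha>: "\<alpha> \<in> D" for \<alpha>
  proof (rule ccontr)
    assume "\<not> ?thesis"
    then have no: "cc \<alpha> \<inter> E = {}" by blast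
    have ccX: "cc \<alpha> \<subseteq> topspace X" using connectedin_subset_topspace[OF cc(1)] .
    have \<alpha>B: "\<alpha> \<in> B" "\<alpha> \<in> C" using \<alpha> DK(1) by (auto simp: B_def)
    have "f (y \<alpha>) = 1" using \<alpha> DK(3) f0(3) by auto
    then have "y \<alpha> \<in> A" using y(1)[OF \<alpha>B(1)] ccX by (auto simp: A_def)
    then have "A \<inter> cc \<alpha> \<noteq> {}" using y(1)[OF \<alpha>B(1)] by blast
    moreover have "cc \<alpha> \<inter> X frontier_of A = {}" using no frontier_of_openin[OF Ao] by (simp add: E_def)
    ultimately have "cc \<alpha> \<subseteq> A"
      by (intro connectedin_subset_open_if_avoids_frontier[OF cc(1)]) auto
    then have "w \<alpha> \<in> A" using wcc[OF \<alpha>B(2)] by blast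
    then show False using f0(2) by (auto simp: A_def)
  qed
  then obtain e where e: "\<And>\<alpha>. \<alpha> \<in> D \<Longrightarrow> e \<alpha> \<in> cc \<alpha> \<inter> E" by metis
  have ebd: "e \<alpha> \<in> X closure_of (P \<alpha>) - P \<alpha>" if "\<alpha> \<in> D" for \<alpha>
    using e[OF that] cc(2)[of \<alpha>] unfolding bd_def by blast
  have eX: "e \<alpha> \<in> topspace X" if "\<alpha> \<in> D" for \<alpha>
    using ebd[OF that] closure_of_subset_topspace[of X "P \<alpha>"] by blast
  obtain D' K' where K': "D' \<subseteq> D" "K' \<subseteq> X closure_of (e ` D')"
      "sequentially_compact_space (subtopology X K')" "\<not> compact_space (subtopology X K')"
    by (rule boundary_selection_sequentially_compact[OF ax(1,3,4) X(1) lc lsc P openin_topspace DK(2) ebd eX])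
  have "X closure_of (e ` D') \<subseteq> E" using e K'(1) by (intro closure_of_minimal E) auto
  then have K'E: "K' \<subseteq> E" using K'(2) by blast
  obtain v where v: "embedding_map (euclidean :: omega1 topology) X v" "range v \<subseteq> K'"
    using sequentially_compact_contains_omega1[OF ax(2) X(1) fc K'(3,4)] by auto
  have vE: "v \<xi> \<in> E" for \<xi> using v(2) K'E by auto
  show False
  proof (rule no_omega1_in_zero_set_boundary[OF ax(1) X(1) fc lc lcon v(1) f])
    show "f (v \<xi>) = 0" for \<xi>
      using vE[of \<xi>] embedding_omega1D(3)[OF v(1)] by (auto simp: E_def A_def)
    show "range v \<subseteq> X closure_of {x \<in> topspace X. f x \<noteq> 0}" using vE by (auto simp: E_def A_def)
  qed
qed

theorem connected_imp_second_countable: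
  assumes ax: "CW TYPE('a)" "PPI_plus TYPE('a)" "|UNIV :: omega1 set| <o bounding_number" P22
    and X: "T5_space (X :: 'a topology)" "locally_Euclidean n X" "connected_space X" and n: "1 < n"
  shows "second_countable X"
proof -
  note lc = locally_Euclidean_local_properties(1)[OF X(2)]
    and lsc = locally_Euclidean_local_properties(2)[OF X(2)]
    and fc = locally_Euclidean_local_properties(3)[OF X(2)]
    and lcon = locally_Euclidean_local_properties(4)[OF X(2)]
  obtain P where P: "exhaustion X P" using exhaustion_exists[OF ax X(1) lc lsc lcon X(3)] ..
  have "\<not> stationary {\<alpha>. X closure_of (P \<alpha>) - P \<alpha> \<noteq> {}}"
  proof
    assume st: "stationary {\<alpha>. X closure_of (P \<alpha>) - P \<alpha> \<noteq> {}}"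
    define y where "y \<alpha> = (SOME y. y \<in> X closure_of (P \<alpha>) - P \<alpha>)" for \<alpha>
    have y: "y \<alpha> \<in> X closure_of (P \<alpha>) - P \<alpha>" if "\<alpha> \<in> {\<alpha>. X closure_of (P \<alpha>) - P \<alpha> \<noteq> {}}" for \<alpha>
    proof -
      have "\<exists>y. y \<in> X closure_of (P \<alpha>) - P \<alpha>" using that by blast
      then show ?thesis unfolding y_def by (rule someI_ex)
    qed
    have yX: "y \<alpha> \<in> topspace X" if "\<alpha> \<in> {\<alpha>. X closure_of (P \<alpha>) - P \<alpha> \<noteq> {}}" for \<alpha>
      using y[OF that] closure_of_subset_topspace[of X "P \<alpha>"] by blast
    obtain K where K: "sequentially_compact_space (subtopology X K)" "\<not> compact_space (subtopology X K)"
      by (rule boundary_selection_sequentially_compact[OF ax(1,3,4) X(1) lc lsc P openin_topspace st y yX])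
    then show False
      using sequentially_compact_contains_omega1[OF ax(2) X(1) fc K] no_omega1_copy[OF ax X(1,2) n P] by blast
  qed
  then obtain C where C: "club C" "\<And>\<alpha>. \<alpha> \<in> C \<Longrightarrow> X closure_of (P \<alpha>) - P \<alpha> = {}"
    unfolding stationary_def by blast
  have "\<exists>\<alpha>. P \<alpha> = topspace X"
  proof (cases "topspace X = {}")
    case True
    then show ?thesis using openin_subset[OF exhaustionD(1)[OF P]] by blast
  next
    case False
    then have "(\<Union>\<alpha>. P \<alpha>) \<noteq> {}" unfolding exhaustionD(6)[OF P] .
    then obtain \<beta> where \<beta>: "P \<beta> \<noteq> {}" by blast
    obtain \<alpha> where \<alpha>: "\<alpha> \<in> C" "\<beta> < \<alpha>" using C(1) unfolding club_def by blast
    have "P \<alpha> \<noteq> {}" using \<beta> exhaustion_mono[OF P, of \<beta> \<alpha>] \<alpha>(2) by auto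
    moreover have "closedin X (P \<alpha>)"
      using C(2)[OF \<alpha>(1)] closure_of_subset_eq[of "P \<alpha>" X] openin_subset[OF exhaustionD(1)[OF P]] by blast
    ultimately show ?thesis using X(3) exhaustionD(1)[OF P] unfolding connected_space_clopen_in by blast
  qed
  then show ?thesis using exhaustionD(2)[OF P] by (metis subtopology_topspace)
qed

section \<open>Metrizability\<close>

text \<open>
  Urysohn's metrization theorem: Urysohn functions for the countably many pairs of basic sets with
  \<open>X closure_of U \<subseteq> V\<close> embed the space into a countable power of the line.
\<close>

lemma regular_second_countable_imp_metrizable:
  assumes X: "Hausdorff_space X" "regular_space X" "second_countable X"
  shows "metrizable_space X"
proof -
  have norm: "normal_space X"
    using regular_second_countable_imp_hereditarily_normal_space X(2,3) hereditarily_inc by blast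
  obtain \<B> where "countable \<B>" "\<forall>V\<in>\<B>. openin X V"
      "\<forall>U x. openin X U \<and> x \<in> U \<longrightarrow> (\<exists>V\<in>\<B>. x \<in> V \<and> V \<subseteq> U)"
    using X(3)[unfolded second_countable_def] by blast
  then have \<B>: "countable \<B>" "\<And>V. V \<in> \<B> \<Longrightarrow> openin X V"
      "\<And>U x. openin X U \<Longrightarrow> x \<in> U \<Longrightarrow> \<exists>V\<in>\<B>. x \<in> V \<and> V \<subseteq> U" by simp_all
  define I where "I = {(U, V). U \<in> \<B> \<and> V \<in> \<B> \<and> X closure_of U \<subseteq> V}"
  have "countable I" by (rule countable_subset[of _ "\<B> \<times> \<B>"]) (use \<B>(1) in \<open>auto simp: I_def\<close>)
  have "\<exists>f. continuous_map X euclideanreal f \<and> f ` (X closure_of (fst p)) \<subseteq> {0} \<and> f ` (topspace X - snd p) \<subseteq> {1}"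
    if "p \<in> I" for p
  proof -
    have "closedin X (topspace X - snd p)" using that \<B>(2) by (auto simp: I_def)
    moreover have "disjnt (X closure_of (fst p)) (topspace X - snd p)" using that by (auto simp: I_def disjnt_iff)
    ultimately obtain f where f: "continuous_map X (top_of_set {0..1 :: real}) f"
        "f ` (X closure_of (fst p)) \<subseteq> {0}" "f ` (topspace X - snd p) \<subseteq> {1}"
      using Urysohn_lemma[OF norm closedin_closure_of, of "topspace X - snd p" "fst p" 0 1] by auto
    have "continuous_map X euclideanreal f" using f(1) continuous_map_in_subtopology by blast
    with f(2,3) show ?thesis by (intro exI[of _ f] conjI)
  qed
  then obtain f where f: "\<And>p. p \<in> I \<Longrightarrow> continuous_map X euclideanreal (f p)"
      "\<And>p. p \<in> I \<Longrightarrow> f p ` (X closure_of (fst p)) \<subseteq> {0}"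
      "\<And>p. p \<in> I \<Longrightarrow> f p ` (topspace X - snd p) \<subseteq> {1}" by metis
  define Y where "Y = product_topology (\<lambda>_. euclideanreal) I"
  define F where "F x = (\<lambda>p\<in>I. f p x)" for x
  have sep: "\<exists>p\<in>I. f p x = 0 \<and> f p ` (topspace X - W) \<subseteq> {1}" if W: "openin X W" "x \<in> W" for W x
  proof -
    obtain V where V: "V \<in> \<B>" "x \<in> V" "V \<subseteq> W" using \<B>(3)[OF W] by auto
    have "neighbourhood_base_of (closedin X) X" using X(2) by (simp add: neighbourhood_base_of_closedin)
    from this[unfolded neighbourhood_base_of, rule_format, OF conjI[OF \<B>(2)[OF V(1)] V(2)]]
    obtain N C where N: "openin X N" "closedin X C" "x \<in> N" "N \<subseteq> C" "C \<subseteq> V" by auto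
    obtain U where U: "U \<in> \<B>" "x \<in> U" "U \<subseteq> N" using \<B>(3)[OF N(1,3)] by auto
    have "X closure_of U \<subseteq> C" using U(3) N(2,4) by (intro closure_of_minimal) auto
    then have p: "(U, V) \<in> I" using U(1) V(1) N(5) by (auto simp: I_def)
    have "x \<in> X closure_of U" using U(2) closure_of_subset[OF openin_subset[OF \<B>(2)[OF U(1)]]] by blast
    then have "f (U, V) x = 0" using f(2)[OF p] by auto
    moreover have "f (U, V) ` (topspace X - W) \<subseteq> {1}" using f(3)[OF p] V(3) by auto
    ultimately show ?thesis using p by blast
  qed
  have FY: "F ` topspace X \<subseteq> topspace Y" by (auto simp: Y_def F_def)
  have Ftop: "topspace (subtopology Y (F ` topspace X)) = F ` topspace X" using FY by auto
  have "continuous_map X Y F"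
    unfolding Y_def F_def continuous_map_componentwise using f(1) by auto
  then have cont: "continuous_map X (subtopology Y (F ` topspace X)) F"
    by (auto simp: continuous_map_in_subtopology)
  have "open_map X (subtopology Y (F ` topspace X)) F"
    unfolding open_map_def
  proof (intro allI impI)
    fix W assume W: "openin X W"
    show "openin (subtopology Y (F ` topspace X)) (F ` W)"
    proof (subst openin_subopen, intro ballI)
      fix z assume "z \<in> F ` W"
      then obtain x where x: "x \<in> W" "z = F x" by auto
      obtain p where p: "p \<in> I" "f p x = 0" "f p ` (topspace X - W) \<subseteq> {1}" using sep[OF W x(1)] by auto
      define T where "T = {z \<in> topspace Y. z p \<in> {..<1 :: real}}"
      have "openin Y T"
        unfolding T_def Y_def
        by (rule openin_continuous_map_preimage[OF continuous_map_product_projection[OF p(1)]]) simp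
      then have "openin (subtopology Y (F ` topspace X)) (T \<inter> F ` topspace X)"
        by (auto simp: openin_subtopology)
      moreover have "z \<in> T \<inter> F ` topspace X"
        using x p(1,2) FY openin_subset[OF W] by (auto simp: T_def F_def)
      moreover have "T \<inter> F ` topspace X \<subseteq> F ` W"
      proof
        fix v assume "v \<in> T \<inter> F ` topspace X"
        then obtain u where u: "u \<in> topspace X" "v = F u" "f p u < 1" using p(1) by (auto simp: T_def F_def)
        then have "u \<in> W" using p(3) by auto
        then show "v \<in> F ` W" using u(2) by blast
      qed
      ultimately show "\<exists>T. openin (subtopology Y (F ` topspace X)) T \<and> z \<in> T \<and> T \<subseteq> F ` W" by blast
    qed
  qed
  moreover have "inj_on F (topspace X)"
  proof (rule inj_onI, rule ccontr)
    fix x y assume xy: "x \<in> topspace X" "y \<in> topspace X" "F x = F y" "x \<noteq> y"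
    then have "closedin X {y}" using X(1) by (meson Hausdorff_imp_t1_space closedin_t1_singleton)
    then have "openin X (topspace X - {y})" by blast
    moreover have "x \<in> topspace X - {y}" using xy by simp
    ultimately obtain p where p: "p \<in> I" "f p x = 0" "f p ` (topspace X - (topspace X - {y})) \<subseteq> {1}"
      using sep by blast
    have "f p y = 1" using p(3) xy(2) by auto
    moreover have "f p x = f p y" using fun_cong[OF xy(3), of p] p(1) by (simp add: F_def)
    ultimately show False using p(2) by simp
  qed
  ultimately have "homeomorphic_map X (subtopology Y (F ` topspace X)) F"
    using cont Ftop by (intro bijective_open_imp_homeomorphic_map) auto
  then have hs: "X homeomorphic_space subtopology Y (F ` topspace X)" by (rule homeomorphic_map_imp_homeomorphic_space)
  have "countable {p \<in> I. \<not> (\<exists>a. topspace (euclideanreal) \<subseteq> {a})}"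
    by (rule countable_subset[OF _ \<open>countable I\<close>]) auto
  then have "metrizable_space Y"
    unfolding Y_def metrizable_space_product_topology by (auto simp: metrizable_space_euclidean)
  then show ?thesis
    using homeomorphic_metrizable_space[OF hs] metrizable_space_subtopology by blast
qed

text \<open>
  The metrics on the pieces are truncated at \<open>1\<close>, and points of different pieces get distance \<open>1\<close>.
\<close>

lemma metrizable_space_open_partition:
  assumes C: "\<And>C. C \<in> \<C> \<Longrightarrow> openin X C" "\<And>C. C \<in> \<C> \<Longrightarrow> metrizable_space (subtopology X C)"
    and part: "pairwise disjnt \<C>" "\<Union>\<C> = topspace X"
  shows "metrizable_space X"
proof -
  have "\<exists>m. Metric_space C m \<and> subtopology X C = Metric_space.mtopology C m" if CC: "C \<in> \<C>" for C
  proof -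
    obtain M m where m: "Metric_space M m" "subtopology X C = Metric_space.mtopology M m"
      using C(2)[OF CC] unfolding metrizable_space_def by blast
    have "M = topspace (subtopology X C)" unfolding m(2) Metric_space.topspace_mtopology[OF m(1)] ..
    also have "\<dots> = C" using openin_subset[OF C(1)[OF CC]] by auto
    finally have "M = C" .
    then show ?thesis using m by blast
  qed
  then obtain m where m: "\<And>C. C \<in> \<C> \<Longrightarrow> Metric_space C (m C)"
      "\<And>C. C \<in> \<C> \<Longrightarrow> subtopology X C = Metric_space.mtopology C (m C)" by metis
  have "\<forall>x\<in>topspace X. \<exists>C. C \<in> \<C> \<and> x \<in> C" using part(2) by blast
  then obtain c where c: "\<And>x. x \<in> topspace X \<Longrightarrow> c x \<in> \<C>" "\<And>x. x \<in> topspace X \<Longrightarrow> x \<in> c x" by metis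
  have same: "c x = C" if "C \<in> \<C>" "x \<in> C" for x C
  proof (rule ccontr)
    assume "c x \<noteq> C"
    moreover have "x \<in> topspace X" using that part(2) by blast
    ultimately have "disjnt (c x) C" using part(1) c(1) that(1) by (simp add: pairwise_def)
    then show False using c(2)[OF \<open>x \<in> topspace X\<close>] that(2) by (auto simp: disjnt_iff)
  qed
  define d where "d x y = (if x \<in> topspace X \<and> y \<in> topspace X then
      if c x = c y then min 1 (m (c x) x y) else 1 else 0)" for x y
  have mD: "0 \<le> m (c x) x y" "m (c x) x y = m (c x) y x" "m (c x) x y = 0 \<longleftrightarrow> x = y"
    if "x \<in> topspace X" "y \<in> topspace X" "c x = c y" for x y
  proof -
    interpret Metric_space "c x" "m (c x)" by (rule m(1)[OF c(1)[OF that(1)]])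
    have "x \<in> c x" "y \<in> c x" using c(2)[OF that(1)] c(2)[OF that(2)] that(3) by simp_all
    then show "0 \<le> m (c x) x y" "m (c x) x y = m (c x) y x" "m (c x) x y = 0 \<longleftrightarrow> x = y"
      by (simp_all add: commute)
  qed
  have tri: "m (c x) x z \<le> m (c x) x y + m (c x) y z"
    if "x \<in> topspace X" "y \<in> topspace X" "z \<in> topspace X" "c x = c y" "c y = c z" for x y z
  proof -
    interpret Metric_space "c x" "m (c x)" by (rule m(1)[OF c(1)[OF that(1)]])
    have "x \<in> c x" "y \<in> c x" "z \<in> c x" using c(2)[OF that(1)] c(2)[OF that(2)] c(2)[OF that(3)] that(4,5) by simp_all
    then show ?thesis by (rule triangle)
  qed
  have met: "Metric_space (topspace X) d"
  proof
    show nonneg: "0 \<le> d x y" for x y using mD(1)[of x y] by (auto simp: d_def)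
    show "d x y = d y x" for x y using mD(2)[of x y] by (auto simp: d_def)
    show "d x y = 0 \<longleftrightarrow> x = y" if "x \<in> topspace X" "y \<in> topspace X" for x y
      using mD(3)[OF that] mD(3)[of x x] that by (auto simp: d_def min_def split: if_splits)
    show "d x z \<le> d x y + d y z" if xyz: "x \<in> topspace X" "y \<in> topspace X" "z \<in> topspace X" for x y z
    proof (cases "c x = c y \<and> c y = c z")
      case True
      then have "m (c x) x z \<le> m (c x) x y + m (c y) y z" using tri[OF xyz] by simp
      moreover have "0 \<le> m (c x) x y" by (rule mD(1)) (use xyz True in auto)
      moreover have "0 \<le> m (c y) y z" by (rule mD(1)) (use xyz True in auto)
      ultimately show ?thesis using True xyz by (simp add: d_def min_def)
    next
      case False
      then have "d x y = 1 \<or> d y z = 1" using xyz by (auto simp: d_def)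
      moreover have "d x z \<le> 1" by (simp add: d_def)
      ultimately show ?thesis using nonneg[of x y] nonneg[of y z] by auto
    qed
  qed
  interpret D: Metric_space "topspace X" d by (rule met)
  have "openin X U \<longleftrightarrow> openin D.mtopology U" for U
  proof
    assume U: "openin X U"
    show "openin D.mtopology U"
      unfolding D.openin_mtopology
    proof (intro conjI allI impI)
      show "U \<subseteq> topspace X" by (rule openin_subset[OF U])
      fix x assume x: "x \<in> U"
      then have xX: "x \<in> topspace X" using openin_subset[OF U] by blast
      interpret M: Metric_space "c x" "m (c x)" by (rule m(1)[OF c(1)[OF xX]])
      have "openin (subtopology X (c x)) (U \<inter> c x)" using U by (rule openin_subtopology_Int)
      then have "openin M.mtopology (U \<inter> c x)" unfolding m(2)[OF c(1)[OF xX]] .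
      then obtain r where r: "0 < r" "M.mball x r \<subseteq> U \<inter> c x"
        unfolding M.openin_mtopology using x c(2)[OF xX] by auto
      have "D.mball x (min r 1) \<subseteq> U"
      proof
        fix y assume "y \<in> D.mball x (min r 1)"
        then have y: "y \<in> topspace X" "d x y < r" "d x y < 1" by auto
        then have cxy: "c x = c y" using xX by (auto simp: d_def split: if_splits)
        then have "m (c x) x y < r" using y xX by (auto simp: d_def split: if_splits)
        moreover have "y \<in> c x" using c(2)[OF y(1)] cxy by simp
        ultimately have "y \<in> M.mball x r" unfolding M.in_mball using c(2)[OF xX] by blast
        then show "y \<in> U" using r(2) by blast
      qed
      then show "\<exists>r>0. D.mball x r \<subseteq> U" using r(1) by (intro exI[of _ "min r 1"]) simp
    qed
  next
    assume "openin D.mtopology U"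
    then have UX: "U \<subseteq> topspace X" and U: "\<And>x. x \<in> U \<Longrightarrow> \<exists>r>0. D.mball x r \<subseteq> U"
      unfolding D.openin_mtopology by auto
    show "openin X U"
    proof (subst openin_subopen, intro ballI)
      fix x assume x: "x \<in> U"
      then have xX: "x \<in> topspace X" using UX by blast
      interpret M: Metric_space "c x" "m (c x)" by (rule m(1)[OF c(1)[OF xX]])
      obtain r where r: "0 < r" "D.mball x r \<subseteq> U" using U[OF x] by auto
      have "openin (subtopology X (c x)) (M.mball x r)" unfolding m(2)[OF c(1)[OF xX]] by (rule M.openin_mball)
      then have "openin X (M.mball x r)" using openin_open_subtopology[OF C(1)[OF c(1)[OF xX]]] by blast
      moreover have "x \<in> M.mball x r" using r(1) c(2)[OF xX] by simp
      moreover have "M.mball x r \<subseteq> U"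
      proof
        fix y assume "y \<in> M.mball x r"
        then have y: "y \<in> c x" "m (c x) x y < r" by auto
        then have "y \<in> topspace X" using openin_subset[OF C(1)[OF c(1)[OF xX]]] by blast
        moreover have "c y = c x" by (rule same[OF c(1)[OF xX] y(1)])
        ultimately have "y \<in> D.mball x r" using y(2) xX by (simp add: d_def)
        then show "y \<in> U" using r(2) by blast
      qed
      ultimately show "\<exists>T. openin X T \<and> x \<in> T \<and> T \<subseteq> U" by blast
    qed
  qed
  then have "X = D.mtopology" by (simp add: topology_eq)
  then show ?thesis unfolding metrizable_space_def using met by blast
qed

theorem theorem1p4:
  assumes "GA TYPE('a set set)"
  shows "\<forall>M :: 'a topology. \<forall>n > 1. manifold_of_dim n M \<and> T5_space M \<longrightarrow> metrizable_space M"
proof (intro allI impI)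
  fix M :: "'a topology" and n :: nat
  assume n: "1 < n" and "manifold_of_dim n M \<and> T5_space M"
  then have M: "locally_Euclidean n M" "T5_space M" using manifold_imp_locally_Euclidean by auto
  have ax: "CW TYPE('a)" "PPI_plus TYPE('a)" "|UNIV :: omega1 set| <o bounding_number" P22
    using assms unfolding GA_def by (auto intro: CW_lower PPI_plus_lower)
  note lcon = locally_Euclidean_local_properties(4)[OF M(1)]
  show "metrizable_space M"
  proof (rule metrizable_space_open_partition[of "connected_components_of M"])
    fix C assume C: "C \<in> connected_components_of M"
    show Co: "openin M C" by (rule openin_connected_components_of_locally_connected_space[OF lcon C])
    have "connected_space (subtopology M C)"
      using connectedin_connected_components_of[OF C] by (simp add: connectedin_def)
    then have "second_countable (subtopology M C)"
      by (rule connected_imp_second_countable[OF ax T5_subtopology[OF M(2)] locally_Euclidean_open_subtopology[OF M(1) Co] _ n])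
    then show "metrizable_space (subtopology M C)"
      using T5_subtopology[OF M(2), of C]
      by (intro regular_second_countable_imp_metrizable T5_imp_Hausdorff T5_imp_regular)
  qed (simp_all add: pairwise_disjoint_connected_components_of Union_connected_components_of)
qed

end
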